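(* Let $(X,\mathbb{Z})$ be a minimal dynamical system on a compact metric space $X$, let $k$ be a natural number such that $\operatorname{mdim} X < k$, and let $\mathbb{D}$ be a superdendrite. Then for almost every continuous map $f : X \to \mathbb{D}^k$ the induced map $f^{\mathbb{Z}} : X \to (\mathbb{D}^k)^{\mathbb{Z}}$ is an embedding.
   Context: A dynamical system $(X,\mathbb{Z})$ on a compact metric space $X$ is a continuous action of the group $\mathbb{Z}$ on $X$, written additively as $(x,z)\mapsto x+z$ (so $x+0=x$, $(x+z)+z'=x+(z+z')$, and $x\mapsto x+z$ is a homeomorphism of $X$ for every $z\in\mathbb{Z}$). The system is minimal if $X$ is non-empty and every orbit $x+\mathbb{Z}$ is dense in $X$. Mean dimension: for a finite open cover $\mathcal{U}$ of $X$ let $\operatorname{ord}\mathcal{U}$ be the maximal number of elements of $\mathcal{U}$ with a common point, and let $\mathcal{D}(\mathcal{U})$ be the minimum of $\operatorname{ord}\mathcal{V}-1$ over all finite open covers $\mathcal{V}$ of $X$ refining $\mathcal{U}$. For $n\ge 1$ let $\mathcal{U}^{n}=\bigvee_{z=0}^{n-1}(\mathcal{U}-z)$ be the common refinement (all intersections $\bigcap_{z=0}^{n-1}(U_z-z)$ with $U_z\in\mathcal{U}$). Then $\operatorname{mdim}X=\sup_{\mathcal{U}}\lim_{n\to\infty}\frac{1}{n}\mathcal{D}(\mathcal{U}^{n})\in[0,\infty]$, the supremum being over all finite open covers $\mathcal{U}$ of $X$ (the limit exists by subadditivity). A dendrite is a (non-degenerate) compact connected locally connected metric space containing no simple closed curve.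 An end-point of a dendrite $D$ is a point $p$ having arbitrarily small open neighborhoods whose boundary is a single point (equivalently, $p\in D$ such that $D\setminus\{p\}$ is connected). A superdendrite is a dendrite whose set of end-points is dense. For a continuous map $f:X\to\mathbb{D}^k$ the induced map $f^{\mathbb{Z}}:X\to(\mathbb{D}^k)^{\mathbb{Z}}$ is $f^{\mathbb{Z}}(x)=(f(x+z))_{z\in\mathbb{Z}}$, where $(\mathbb{D}^k)^{\mathbb{Z}}$ has the product topology. An embedding is a homeomorphism onto its image. "Almost every map" is meant in the sense of Baire category: the set of continuous maps $f:X\to\mathbb{D}^k$ having the property contains a dense $G_\delta$ subset of the space $C(X,\mathbb{D}^k)$ of all continuous maps with the topology of uniform convergence. *)

theory Defs
  imports "HOL-Analysis.Analysis"
begin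

section \<open>Dynamical systems\<close>

text \<open>The point \<open>x + z\<close> is written \<open>act x z\<close>. Outside \<open>topspace X\<close> the function \<open>act\<close> is irrelevant.\<close>

definition dynamical_system :: "'a topology \<Rightarrow> ('a \<Rightarrow> int \<Rightarrow> 'a) \<Rightarrow> bool" where
  "dynamical_system X act \<longleftrightarrow>
     continuous_map (prod_topology X (discrete_topology UNIV)) X (\<lambda>(x, z). act x z) \<and>
     (\<forall>x \<in> topspace X. act x 0 = x) \<and>
     (\<forall>x \<in> topspace X. \<forall>z z'. act (act x z) z' = act x (z + z'))"

definition minimal_system :: "'a topology \<Rightarrow> ('a \<Rightarrow> int \<Rightarrow> 'a) \<Rightarrow> bool" where
  "minimal_system X act \<longleftrightarrow>
     dynamical_system X act \<and> topspace X \<noteq> {} \<and>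
     (\<forall>x \<in> topspace X. X closure_of (range (act x)) = topspace X)"

lemma dynamical_system_homeomorphic_map:
  assumes "dynamical_system X act"
  shows "homeomorphic_map X X (\<lambda>x. act x z)"
proof -
  have cont: "continuous_map X X (\<lambda>x. act x w)" for w
  proof -
    have "continuous_map X (prod_topology X (discrete_topology UNIV)) (\<lambda>x. (x, w))"
      by (simp add: continuous_map_pairwise o_def)
    from continuous_map_compose[OF this, of X "\<lambda>(x, z). act x z"] show ?thesis
      using assms by (simp add: dynamical_system_def o_def)
  qed
  have "homeomorphic_maps X X (\<lambda>x. act x z) (\<lambda>x. act x (- z))"
    using assms cont by (simp add: homeomorphic_maps_def dynamical_system_def)
  then show ?thesis
    using homeomorphic_map_maps by blast
qed


section \<open>Mean dimension\<close>

definition finite_open_cover :: "'a topology \<Rightarrow> 'a set set \<Rightarrow> bool" where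
  "finite_open_cover X \<U> \<longleftrightarrow> finite \<U> \<and> (\<forall>U \<in> \<U>. openin X U) \<and> \<Union>\<U> = topspace X"

definition refines :: "'a set set \<Rightarrow> 'a set set \<Rightarrow> bool" where
  "refines \<V> \<U> \<longleftrightarrow> (\<forall>V \<in> \<V>. \<exists>U \<in> \<U>. V \<subseteq> U)"

definition cover_ord :: "'a topology \<Rightarrow> 'a set set \<Rightarrow> nat" where
  "cover_ord X \<U> = (SUP x \<in> topspace X. card {U \<in> \<U>. x \<in> U})"

text \<open>The subtraction is on natural numbers; for non-empty \<open>X\<close> every cover has order at least 1,
  so it does not truncate.\<close>

definition cover_dim :: "'a topology \<Rightarrow> 'a set set \<Rightarrow> nat" where
  "cover_dim X \<U> = (INF \<V> \<in> {\<V>. finite_open_cover X \<V> \<and> refines \<V> \<U>}. cover_ord X \<V> - 1)"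

text \<open>The cover \<open>\<U>\<^sup>n\<close>, meant for \<open>n \<ge> 1\<close> (for \<open>n = 0\<close> the intersection is \<open>UNIV\<close>, which
  does not affect the limit below). The set \<open>U - z\<close> is the image of \<open>U\<close> under \<open>x \<mapsto> x + (- z)\<close>.\<close>

definition iterated_cover :: "('a \<Rightarrow> int \<Rightarrow> 'a) \<Rightarrow> 'a set set \<Rightarrow> nat \<Rightarrow> 'a set set" where
  "iterated_cover act \<U> n =
     (\<lambda>W. \<Inter>z<n. (\<lambda>x. act x (- int z)) ` W z) ` ({..<n} \<rightarrow>\<^sub>E \<U>)"

definition mdim :: "'a topology \<Rightarrow> ('a \<Rightarrow> int \<Rightarrow> 'a) \<Rightarrow> ereal" where
  "mdim X act = (SUP \<U> \<in> {\<U>. finite_open_cover X \<U>}.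
     lim (\<lambda>n. ereal (real (cover_dim X (iterated_cover act \<U> n)) / real n)))"


section \<open>Superdendrites\<close>

definition dendrite :: "'b metric \<Rightarrow> bool" where
  "dendrite D \<longleftrightarrow>
     (\<exists>p \<in> mspace D. \<exists>q \<in> mspace D. p \<noteq> q) \<and>
     compact_space (mtopology_of D) \<and>
     connected_space (mtopology_of D) \<and>
     locally_connected_space (mtopology_of D) \<and>
     \<not> (\<exists>S \<subseteq> mspace D.
          subtopology (mtopology_of D) S homeomorphic_space top_of_set (sphere (0::complex) 1))"

definition end_points :: "'b topology \<Rightarrow> 'b set" where
  "end_points D = {p \<in> topspace D. \<forall>W. openin D W \<and> p \<in> W \<longrightarrow>
     (\<exists>U q. openin D U \<and> p \<in> U \<and> U \<subseteq> W \<and> D frontier_of U = {q})}"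

definition superdendrite :: "'b metric \<Rightarrow> bool" where
  "superdendrite D \<longleftrightarrow>
     dendrite D \<and> mtopology_of D closure_of end_points (mtopology_of D) = mspace D"


section \<open>Powers, induced maps and genericity\<close>

text \<open>The power \<open>D\<^sup>k\<close> with the maximum metric; points are extensional functions on \<open>{..<k}\<close>.
  The metric induces the product topology, see \<open>mtopology_of_power_metric\<close> below.\<close>

definition power_metric :: "nat \<Rightarrow> 'b metric \<Rightarrow> (nat \<Rightarrow> 'b) metric" where
  "power_metric k D = funspace {..<k} D"

definition induced_map :: "('a \<Rightarrow> int \<Rightarrow> 'a) \<Rightarrow> ('a \<Rightarrow> 'c) \<Rightarrow> 'a \<Rightarrow> int \<Rightarrow> 'c" where
  "induced_map act f x = (\<lambda>z. f (act x z))"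

definition for_almost_every :: "'c topology \<Rightarrow> ('c \<Rightarrow> bool) \<Rightarrow> bool" where
  "for_almost_every C P \<longleftrightarrow>
     (\<exists>G. gdelta_in C G \<and> C closure_of G = topspace C \<and> (\<forall>f \<in> G. P f))"

lemma mspace_power_metric: "mspace (power_metric k D) = {..<k} \<rightarrow>\<^sub>E mspace D"
proof -
  interpret Metric_space "mspace D" "mdist D" by simp
  have "mbounded (f ` {..<k})" if "f ` {..<k} \<subseteq> mspace D" for f
    using that by (simp add: compactin_imp_mbounded finite_imp_compactin)
  then show ?thesis
    by (auto simp: power_metric_def fspace_def PiE_def image_subset_iff)
qed

lemma mtopology_of_power_metric:
  "mtopology_of (power_metric k D) = product_topology (\<lambda>_. mtopology_of D) {..<k}"
proof -
  interpret D: Metric_space "mspace D" "mdist D" by simp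
  interpret P: Metric_space "mspace (power_metric k D)" "mdist (power_metric k D)" by simp
  let ?M = "mspace (power_metric k D)" and ?d = "mdist (power_metric k D)"
  have dle: "?d x y \<le> a \<longleftrightarrow> (\<forall>i<k. mdist D (x i) (y i) \<le> a)"
    if "x \<in> ?M" "y \<in> ?M" "a \<ge> 0" for x y a
  proof (cases "k = 0")
    case True
    then show ?thesis using that by (simp add: power_metric_def D.fdist_def lessThan_empty_iff)
  next
    case False
    then have "{..<k} \<noteq> {}" by (simp add: lessThan_empty_iff)
    from D.funspace_mdist_le[OF _ _ this, of x y a] that show ?thesis
      by (auto simp: power_metric_def)
  qed
  show ?thesis
  proof (rule topology_eq[THEN iffD2, rule_format])
    fix U
    show "openin (mtopology_of (power_metric k D)) U \<longleftrightarrow>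
          openin (product_topology (\<lambda>_. mtopology_of D) {..<k}) U"
    proof
      assume "openin (mtopology_of (power_metric k D)) U"
      then have U: "U \<subseteq> ?M" "\<And>x. x \<in> U \<Longrightarrow> \<exists>r>0. P.mball x r \<subseteq> U"
        by (auto simp: mtopology_of_def P.openin_mtopology)
      show "openin (product_topology (\<lambda>_. mtopology_of D) {..<k}) U"
        unfolding openin_product_topology_alt
      proof
        fix x assume x: "x \<in> U"
        then obtain r where r: "r > 0" "P.mball x r \<subseteq> U" using U by blast
        have xM: "x \<in> ?M" using U x by blast
        define V where "V i = (if i < k then D.mball (x i) (r/2) else mspace D)" for i
        have "openin (mtopology_of D) (V i)" if "i < k" for i
          using that by (simp add: V_def mtopology_of_def)
        moreover have "x \<in> Pi\<^sub>E {..<k} V"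
          using xM r by (auto simp: V_def mspace_power_metric PiE_iff)
        moreover have "Pi\<^sub>E {..<k} V \<subseteq> U"
        proof
          fix y assume y: "y \<in> Pi\<^sub>E {..<k} V"
          then have yM: "y \<in> ?M"
            by (auto simp: V_def mspace_power_metric PiE_iff split: if_splits)
          have "\<forall>i<k. mdist D (x i) (y i) \<le> r/2"
          proof (intro allI impI)
            fix i assume "i < k"
            then have "y i \<in> D.mball (x i) (r/2)"
              using y by (auto simp: V_def PiE_iff split: if_splits)
            then show "mdist D (x i) (y i) \<le> r/2" by simp
          qed
          then have "?d x y \<le> r/2" using dle[OF xM yM, of "r/2"] r(1) by (meson half_gt_zero less_imp_le)
          then have "y \<in> P.mball x r" using r(1) xM yM by simp
          then show "y \<in> U" using r(2) by blast
        qed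
        ultimately show "\<exists>V. finite {i \<in> {..<k}. V i \<noteq> topspace (mtopology_of D)} \<and>
            (\<forall>i\<in>{..<k}. openin (mtopology_of D) (V i)) \<and> x \<in> Pi\<^sub>E {..<k} V \<and> Pi\<^sub>E {..<k} V \<subseteq> U"
          by (intro exI[of _ V]) auto
      qed
    next
      assume L: "openin (product_topology (\<lambda>_. mtopology_of D) {..<k}) U"
      then have UM: "U \<subseteq> ?M"
        using openin_subset by (fastforce simp: mspace_power_metric)
      have "\<exists>r>0. P.mball x r \<subseteq> U" if x: "x \<in> U" for x
      proof -
        have xM: "x \<in> ?M" using UM x by blast
        obtain V where V: "\<And>i. i < k \<Longrightarrow> openin (mtopology_of D) (V i)"
          "x \<in> Pi\<^sub>E {..<k} V" "Pi\<^sub>E {..<k} V \<subseteq> U"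
          using L x unfolding openin_product_topology_alt by (meson lessThan_iff)
        have "\<exists>r>0. D.mball (x i) r \<subseteq> V i" if "i < k" for i
          using V(1)[OF that] V(2) that
          by (auto simp: mtopology_of_def D.openin_mtopology PiE_iff)
        then obtain r where r: "\<And>i. i < k \<Longrightarrow> r i > 0 \<and> D.mball (x i) (r i) \<subseteq> V i"
          by metis
        define e where "e = Min (insert 1 (r ` {..<k}))"
        have e: "e > 0" "\<And>i. i < k \<Longrightarrow> e \<le> r i"
          using r by (auto simp: e_def)
        have "P.mball x (e/2) \<subseteq> U"
        proof
          fix y assume y: "y \<in> P.mball x (e/2)"
          then have yM: "y \<in> ?M" and "?d x y \<le> e/2" by auto
          then have "\<forall>i<k. mdist D (x i) (y i) \<le> e/2" using dle[OF xM yM, of "e/2"] e(1) by (meson half_gt_zero less_imp_le)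
          have yV: "y i \<in> V i" if "i < k" for i
          proof -
            have "mdist D (x i) (y i) < r i"
              using \<open>\<forall>i<k. mdist D (x i) (y i) \<le> e/2\<close> that e(1) e(2)[OF that] by force
            moreover have "x i \<in> mspace D" "y i \<in> mspace D"
              using xM yM that by (auto simp: mspace_power_metric PiE_iff)
            ultimately have "y i \<in> D.mball (x i) (r i)" by simp
            then show ?thesis using r[OF that] by blast
          qed
          then have "y \<in> Pi\<^sub>E {..<k} V"
            using yM by (simp add: mspace_power_metric PiE_iff)
          then show "y \<in> U" using V by blast
        qed
        then show ?thesis using e(1) by (intro exI[of _ "e/2"]) auto
      qed
      with UM show "openin (mtopology_of (power_metric k D)) U"
        by (auto simp: mtopology_of_def P.openin_mtopology)
    qed
  qed
qed

end

theory Submission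
  imports Defs "HOL-Real_Asymp.Real_Asymp"
begin

text \<open>The maps \<open>f\<close> for which, uniformly, any two points at distance at least \<open>1 / (n + 1)\<close> have orbits separated
  by \<open>f\<close> form an open set, so by Baire's theorem one has to show that these sets are dense. Because
  \<open>mdim X < k\<close>, some \<open>L\<close> admits arbitrarily fine covers whose first \<open>L\<close> shifts are also fine and whose
  dimension is less than \<open>k L\<close>. Distributing the colours of such covers (Kolmogorov--Ostrand) over \<open>L\<close> levels
  of towers in \<open>X\<close> and over the \<open>k\<close> coordinates yields, for each coordinate, a finite disjoint family of closed
  sets such that every orbit visits some member \<open>A\<close> at a bounded time \<open>z\<close> for which \<open>A - z\<close> is small. The towers
  come from the level function of a minimal infinite system. Each coordinate of a given map is then perturbed so
  that it takes on each \<open>A\<close> of its family a single value, at an end-point of the dendrite, and takes this value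
  nowhere outside a small neighbourhood of \<open>A\<close>. If the orbits of \<open>x\<close> and \<open>y\<close> have the same image, then
  \<open>x + z \<in> A\<close> forces \<open>y + z\<close> to be near \<open>A\<close>, hence \<open>x\<close> and \<open>y\<close> to be close.\<close>

section \<open>Covers and mean dimension\<close>

text \<open>The space may be connected, so disjoint clopen towers that exhaust it need not exist.
  Towers with closed bases are therefore required to be disjoint only on the levels \<open>S\<close>
  that carry colours, while the larger handles \<open>H\<close> may overlap and only have to reach
  every point. The price is paid in dimension: making all levels in \<open>H\<close> small costs
  \<open>q0\<close> for every interval of length \<open>L\<close> used to cover \<open>H\<close>,
  whereas each level in \<open>S\<close> supplies \<open>k\<close> colours. Since mdim X < k is
  strict, a strip of \<open>L\<close> levels supplies \<open>k * L\<close> colours at a cost of at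
  most \<open>k * L - 1\<close>; the constants are chosen so that the accumulated units of surplus
  pay for the handles. End-points matter because they have small neighbourhoods with a one-point
  boundary: such a neighbourhood can be collapsed to its boundary point, so a map can be pushed off
  an end-point by an arbitrarily small change, and the freed value can mark one closed set. Density
  supplies such values everywhere. Minimality enters through aperiodicity and through bounded return
  times to a ball.\<close>

definition cover_dim_le :: "'a topology \<Rightarrow> ('a set \<Rightarrow> bool) \<Rightarrow> nat \<Rightarrow> bool" where
  "cover_dim_le X R q \<longleftrightarrow> (\<exists>\<V>. finite_open_cover X \<V> \<and> (\<forall>V\<in>\<V>. R V) \<and>
     (\<forall>x\<in>topspace X. card {V\<in>\<V>. x \<in> V} \<le> Suc q))"

lemma cover_dim_le_mono:
  assumes "cover_dim_le X R q" "\<And>V. V \<subseteq> topspace X \<Longrightarrow> R V \<Longrightarrow> R' V" "q \<le> q'"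
  shows "cover_dim_le X R' q'"
proof -
  obtain \<V> where \<V>: "finite_open_cover X \<V>" "\<forall>V\<in>\<V>. R V"
    "\<forall>x\<in>topspace X. card {V\<in>\<V>. x \<in> V} \<le> Suc q"
    using assms(1) unfolding cover_dim_le_def by blast
  have "V \<subseteq> topspace X" if "V \<in> \<V>" for V
    using \<V>(1) that unfolding finite_open_cover_def by blast
  then show ?thesis
    unfolding cover_dim_le_def using \<V> assms(2,3) by (intro exI[of _ \<V>]) fastforce
qed

text \<open>The colour classes below consist of subsets of the cover members, so only properties
  that pass to subsets survive the recolouring.\<close>

definition hereditary :: "('a set \<Rightarrow> bool) \<Rightarrow> bool" where
  "hereditary R \<longleftrightarrow> (\<forall>V W. R V \<longrightarrow> W \<subseteq> V \<longrightarrow> R W)"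

lemma hereditaryD: "hereditary R \<Longrightarrow> R V \<Longrightarrow> W \<subseteq> V \<Longrightarrow> R W"
  unfolding hereditary_def by blast

section \<open>Coloured disjoint families of small sets\<close>

locale compact_metric = Metric_space M d for M :: "'a set" and d +
  assumes compact_space: "compact_space mtopology"
begin

text \<open>A Lebesgue number \<open>l\<close> shrinks all members at once: the points whose
  \<open>l\<close>-ball stays in \<open>V\<close> form a closed set, and every point keeps at least
  one member.\<close>

lemma finite_open_cover_shrink:
  assumes "finite_open_cover mtopology \<V>"
  obtains F where "\<And>V. closedin mtopology (F V)" "\<And>V. F V \<subseteq> V"
    "\<And>x. x \<in> M \<Longrightarrow> \<exists>V\<in>\<V>. x \<in> F V"
proof -
  have "compactin mtopology M" using compact_space by (simp add: compact_space_def)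
  then obtain l where l: "l > 0" "\<forall>x\<in>M. \<exists>V\<in>\<V>. mball x l \<subseteq> V"
    using lebesgue_number[of M \<V>] assms unfolding finite_open_cover_def by auto
  define F where "F V = {x\<in>M. mball x l \<subseteq> V}" for V
  show thesis
  proof (rule that[of F])
    show "closedin mtopology (F V)" for V
      unfolding closedin_metric
    proof (intro conjI allI impI)
      show "F V \<subseteq> M" by (auto simp: F_def)
      fix x assume x: "x \<in> M - F V"
      then have "\<not> mball x l \<subseteq> V" by (simp add: F_def)
      then obtain y where y: "y \<in> mball x l" "y \<notin> V" by blast
      define r where "r = l - d x y"
      have "r > 0" using y by (simp add: r_def)
      moreover have "disjnt (F V) (mball x r)"
      proof (rule ccontr)
        assume "\<not> ?thesis"
        then obtain z where z: "z \<in> F V" "z \<in> mball x r" by (auto simp: disjnt_iff)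
        then have "d z y < l" using y triangle[of z x y] commute[of z x] by (auto simp: r_def)
        then show False using y z by (auto simp: F_def)
      qed
      ultimately show "\<exists>r>0. disjnt (F V) (mball x r)" by blast
    qed
    show "F V \<subseteq> V" for V using l(1) by (auto simp: F_def)
    show "\<exists>V\<in>\<V>. x \<in> F V" if "x \<in> M" for x using l that by (auto simp: F_def)
  qed
qed

text \<open>Urysohn functions for the shrinking. The value 1 attained at every point lies above all
  thresholds of the next lemma, which saves one member in its count.\<close>

lemma cover_functions:
  assumes "finite_open_cover mtopology \<V>"
  obtains f :: "'a set \<Rightarrow> 'a \<Rightarrow> real"
  where "\<And>V. V \<in> \<V> \<Longrightarrow> continuous_map mtopology euclideanreal (f V)"
    "\<And>V x. V \<in> \<V> \<Longrightarrow> x \<in> M - V \<Longrightarrow> f V x = 0"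
    "\<And>x. x \<in> M \<Longrightarrow> \<exists>V\<in>\<V>. f V x = 1"
proof -
  obtain F where F: "\<And>V. closedin mtopology (F V)" "\<And>V. F V \<subseteq> V"
    "\<And>x. x \<in> M \<Longrightarrow> \<exists>V\<in>\<V>. x \<in> F V"
    by (rule finite_open_cover_shrink[OF assms]) (rule that)
  have nrm: "normal_space mtopology"
    by (simp add: metrizable_imp_normal_space metrizable_space_mtopology)
  have "\<exists>g. continuous_map mtopology euclideanreal g \<and> g ` (M - V) \<subseteq> {0} \<and> g ` F V \<subseteq> {1}"
    if "V \<in> \<V>" for V
  proof -
    have "closedin mtopology (M - V)"
      using assms that unfolding finite_open_cover_def by (metis closedin_def closedin_topspace openin_closedin_eq topspace_mtopology)
    moreover have "disjnt (M - V) (F V)" using F(2)[of V] by (auto simp: disjnt_iff)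
    ultimately show ?thesis using Urysohn_lemma_alt[OF nrm _ F(1)] by metis
  qed
  then obtain f where f: "\<And>V. V \<in> \<V> \<Longrightarrow> continuous_map mtopology euclideanreal (f V) \<and> f V ` (M - V) \<subseteq> {0} \<and> f V ` F V \<subseteq> {1::real}"
    by metis
  show thesis
  proof (rule that)
    show "\<And>V. V \<in> \<V> \<Longrightarrow> continuous_map mtopology euclideanreal (f V)" using f by blast
    show "\<And>V x. V \<in> \<V> \<Longrightarrow> x \<in> M - V \<Longrightarrow> f V x = 0" using f by blast
    show "\<exists>V\<in>\<V>. f V x = 1" if "x \<in> M" for x using f F(3)[OF that] by blast
  qed
qed

text \<open>Kolmogorov's form of Ostrand's theorem. The colours are distinct thresholds in \<open>(0,1)\<close>; a point
  is missed by a colour only if some cover function takes exactly the threshold there.\<close>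

lemma coloured_families:
  assumes "cover_dim_le mtopology R q" "hereditary R"
  obtains \<G> :: "nat \<Rightarrow> 'a set set" where
    "\<And>c. finite (\<G> c)" "\<And>c. disjoint (\<G> c)" "\<And>c G. c < K \<Longrightarrow> G \<in> \<G> c \<Longrightarrow> openin mtopology G \<and> R G"
    "\<And>x. x \<in> M \<Longrightarrow> card {c\<in>{..<K}. x \<notin> \<Union>(\<G> c)} \<le> q"
proof -
  obtain \<V> where \<V>: "finite_open_cover mtopology \<V>" "\<forall>V\<in>\<V>. R V"
    "\<forall>x\<in>M. card {V\<in>\<V>. x \<in> V} \<le> Suc q"
    using assms(1) unfolding cover_dim_le_def by auto
  obtain f :: "'a set \<Rightarrow> 'a \<Rightarrow> real"
    where fc: "\<And>V. V \<in> \<V> \<Longrightarrow> continuous_map mtopology euclideanreal (f V)"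
    and f0: "\<And>V x. V \<in> \<V> \<Longrightarrow> x \<in> M - V \<Longrightarrow> f V x = 0"
    and f1: "\<And>x. x \<in> M \<Longrightarrow> \<exists>V\<in>\<V>. f V x = 1"
    by (rule cover_functions[OF \<V>(1)]) (rule that)
  have fin: "finite \<V>" using \<V>(1) by (simp add: finite_open_cover_def)
  define l where "l c = (real c + 1) / (real K + 1)" for c
  have l: "l c > 0" "c < K \<Longrightarrow> l c < 1" for c by (auto simp: l_def)
  \<comment> \<open>For a fixed threshold, \<open>G c S\<close> consists of the points at which
    \<open>S\<close> is exactly the set of functions above it; different \<open>S\<close> hence give
    disjoint sets. The empty \<open>S\<close> is dropped because \<open>G c {}\<close> need not lie
    in a member.\<close>
  define G where "G c S = {x\<in>M. (\<forall>V\<in>S. f V x > l c) \<and> (\<forall>V\<in>\<V>-S. f V x < l c)}" for c S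
  define \<G> where "\<G> c = G c ` (Pow \<V> - {{}})" for c
  have Gop: "openin mtopology (G c S)" if "S \<subseteq> \<V>" for c S
  proof -
    have fS: "finite S" using fin that finite_subset by blast
    define A where "A = M \<inter> (\<Inter>V\<in>S. {x\<in>M. f V x \<in> {l c<..}})"
    have G_eq: "G c S = A \<inter> (\<Inter>V\<in>\<V>-S. {x\<in>M. f V x \<in> {..<l c}})"
      by (auto simp: G_def A_def)
    have up: "openin mtopology {x\<in>M. f V x \<in> {l c<..}}"
      and lo: "openin mtopology {x\<in>M. f V x \<in> {..<l c}}" if "V \<in> \<V>" for V
      using openin_continuous_map_preimage[OF fc[OF that], of "{l c<..}"]
        openin_continuous_map_preimage[OF fc[OF that], of "{..<l c}"] by simp_all
    have A: "openin mtopology A"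
    proof (cases "S = {}")
      case False
      then show ?thesis using up that fS unfolding A_def
        by (intro openin_Int openin_topspace[of mtopology, simplified] openin_Inter) auto
    qed (use openin_topspace[of mtopology] in \<open>simp add: A_def\<close>)
    show ?thesis
    proof (cases "\<V> - S = {}")
      case False
      then show ?thesis unfolding G_eq using A lo that fin
        by (intro openin_Int openin_Inter) auto
    next
      case True
      then show ?thesis unfolding G_eq using A by (simp only: True INT_empty Int_UNIV_right)
    qed
  qed
  show thesis
  proof (rule that[of \<G>])
    show "finite (\<G> c)" for c using fin by (simp add: \<G>_def)
    show "disjoint (\<G> c)" for c
    proof -
      have "G c S \<inter> G c T = {}" if "S \<subseteq> \<V>" "T \<subseteq> \<V>" "S \<noteq> T" for S T
      proof (rule ccontr)
        assume "\<not> ?thesis"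
        then obtain x where x: "x \<in> G c S" "x \<in> G c T" by blast
        from that obtain V where "V \<in> \<V>" "(V \<in> S \<and> V \<notin> T) \<or> (V \<in> T \<and> V \<notin> S)" by blast
        then show False using x unfolding G_def by (smt (verit) DiffI mem_Collect_eq)
      qed
      then show ?thesis unfolding \<G>_def disjoint_def by blast
    qed
    show "openin mtopology A \<and> R A" if "c < K" "A \<in> \<G> c" for c A
    proof -
      from that obtain S where S: "S \<subseteq> \<V>" "S \<noteq> {}" "A = G c S" by (auto simp: \<G>_def)
      then obtain V where V: "V \<in> S" by blast
      have "x \<in> V" if "x \<in> A" for x
        using that S V f0[of V x] l(1)[of c] unfolding G_def by force
      then have "A \<subseteq> V" by blast
      then have "R A" using hereditaryD[OF assms(2)] \<V>(2) S V by blast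
      then show ?thesis using Gop S by blast
    qed
    show "card {c\<in>{..<K}. x \<notin> \<Union>(\<G> c)} \<le> q" if x: "x \<in> M" for x
    proof -
      from f1[OF x] obtain V1 where V1: "V1 \<in> \<V>" "f V1 x = 1" by blast
      define B where "B = {c\<in>{..<K}. x \<notin> \<Union>(\<G> c)}"
      have "\<exists>V\<in>\<V>. f V x = l c" if "c \<in> B" for c
      proof (rule ccontr)
        assume nex: "\<not> ?thesis"
        define S where "S = {V\<in>\<V>. f V x > l c}"
        have "S \<in> Pow \<V> - {{}}" using V1 l(2) that by (auto simp: S_def B_def)
        moreover have "x \<in> G c S" using nex x unfolding G_def S_def by force
        ultimately have "x \<in> \<Union>(\<G> c)" unfolding \<G>_def by blast
        then show False using that by (simp add: B_def)
      qed
      then obtain v where v: "\<And>c. c \<in> B \<Longrightarrow> v c \<in> \<V> \<and> f (v c) x = l c" by metis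
      \<comment> \<open>Distinct colours have distinct thresholds, so each missing colour claims its
        own member around \<open>x\<close>; \<open>V1\<close>, whose function is 1 at
        \<open>x\<close>, is claimed by none. This gives at most \<open>q\<close> instead of
        \<open>q + 1\<close>.\<close>
      have "inj_on v B"
      proof (rule inj_onI)
        fix c c' assume "c \<in> B" "c' \<in> B" "v c = v c'"
        then have "l c = l c'" using v by metis
        then show "c = c'" by (simp add: l_def)
      qed
      moreover have "v ` B \<subseteq> {V\<in>\<V>. x \<in> V} - {V1}"
      proof
        fix V assume "V \<in> v ` B"
        then obtain c where c: "c \<in> B" "V = v c" by blast
        then have "V \<in> \<V>" "f V x = l c" using v by auto
        moreover have "x \<in> V" using f0[of V x] x calculation l(1)[of c] by force
        moreover have "V \<noteq> V1" using V1 calculation l(2)[of c] c(1) by (auto simp: B_def)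
        ultimately show "V \<in> {V\<in>\<V>. x \<in> V} - {V1}" by blast
      qed
      ultimately have "card B \<le> card ({V\<in>\<V>. x \<in> V} - {V1})"
        using fin by (intro card_inj_on_le[of v]) auto
      moreover have "V1 \<in> {V\<in>\<V>. x \<in> V}" using V1 f0[of V1 x] x by force
      moreover have "card {V\<in>\<V>. x \<in> V} \<le> Suc q" using \<V>(3) x by blast
      ultimately show ?thesis unfolding B_def[symmetric] using card_Diff_singleton[of V1 "{V\<in>\<V>. x \<in> V}"]
        by linarith
    qed
  qed
qed

text \<open>Among more than \<open>q\<close> colours at least one does not miss a given point, so
  the coloured families cover. Shrinking makes the members closed and keeps each colour
  disjoint.\<close>

lemma coloured_closed_cover:
  assumes "cover_dim_le mtopology R q" "hereditary R" "q < K"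
  obtains \<F> :: "nat \<Rightarrow> 'a set set" where
    "\<And>c. finite (\<F> c)" "\<And>c. disjoint (\<F> c)" "\<And>c F. c < K \<Longrightarrow> F \<in> \<F> c \<Longrightarrow> closedin mtopology F \<and> R F"
    "\<And>x. x \<in> M \<Longrightarrow> \<exists>c<K. x \<in> \<Union>(\<F> c)"
proof -
  obtain \<G> :: "nat \<Rightarrow> 'a set set" where \<G>:
    "\<And>c. finite (\<G> c)" "\<And>c. disjoint (\<G> c)" "\<And>c G. c < K \<Longrightarrow> G \<in> \<G> c \<Longrightarrow> openin mtopology G \<and> R G"
    "\<And>x. x \<in> M \<Longrightarrow> card {c\<in>{..<K}. x \<notin> \<Union>(\<G> c)} \<le> q"
    by (rule coloured_families[OF assms(1,2), where K=K]) (rule that)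
  have "\<exists>c<K. x \<in> \<Union>(\<G> c)" if "x \<in> M" for x
  proof (rule ccontr)
    assume "\<not> ?thesis"
    then have "{c\<in>{..<K}. x \<notin> \<Union>(\<G> c)} = {..<K}" by blast
    then show False using \<G>(4)[OF that] assms(3) by simp
  qed
  note cov = this
  have "finite_open_cover mtopology (\<Union>c<K. \<G> c)"
    unfolding finite_open_cover_def
  proof (intro conjI)
    show "\<Union> (\<Union>c<K. \<G> c) = topspace mtopology"
      using cov \<G>(3) openin_subset by fastforce
  qed (use \<G> in auto)
  then obtain F where F: "\<And>V. closedin mtopology (F V)" "\<And>V. F V \<subseteq> V"
    "\<And>x. x \<in> M \<Longrightarrow> \<exists>V\<in>(\<Union>c<K. \<G> c). x \<in> F V"
    by (rule finite_open_cover_shrink) (rule that)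
  show thesis
  proof (rule that[of "\<lambda>c. F ` \<G> c"])
    show "finite (F ` \<G> c)" for c using \<G> by simp
    show "disjoint (F ` \<G> c)" for c
    proof (rule disjointI)
      fix A B assume AB: "A \<in> F ` \<G> c" "B \<in> F ` \<G> c" "A \<noteq> B"
      then obtain G H where GH: "G \<in> \<G> c" "H \<in> \<G> c" "A = F G" "B = F H" by blast
      then have "G \<inter> H = {}" using \<G>(2)[of c] AB(3) unfolding disjoint_def by metis
      then show "A \<inter> B = {}" using F(2)[of G] F(2)[of H] GH by blast
    qed
    show "closedin mtopology A \<and> R A" if "c < K" "A \<in> F ` \<G> c" for c A
    proof -
      obtain G where G: "G \<in> \<G> c" "A = F G" using \<open>A \<in> F ` \<G> c\<close> by blast
      then show ?thesis
        using F(1) F(2)[of G] \<G>(3)[OF \<open>c < K\<close> G(1)] hereditaryD[OF assms(2)] by metis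
    qed
    show "\<exists>c<K. x \<in> \<Union>(F ` \<G> c)" if "x \<in> M" for x
      using F(3)[OF that] by blast
  qed
qed

text \<open>With \<open>q + q' + 1\<close> colours, some colour is missed by neither family at a
  given point. Intersecting the families colour by colour therefore gives a cover in which each
  colour contributes at most one member through a point.\<close>

lemma cover_dim_le_Int:
  assumes R: "cover_dim_le mtopology R q" "hereditary R"
    and R': "cover_dim_le mtopology R' q'" "hereditary R'"
  shows "cover_dim_le mtopology (\<lambda>V. R V \<and> R' V) (q + q')"
proof -
  define K where "K = Suc (q + q')"
  obtain \<G> :: "nat \<Rightarrow> 'a set set" where \<G>:
    "\<And>c. finite (\<G> c)" "\<And>c. disjoint (\<G> c)" "\<And>c G. c < K \<Longrightarrow> G \<in> \<G> c \<Longrightarrow> openin mtopology G \<and> R G"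
    "\<And>x. x \<in> M \<Longrightarrow> card {c\<in>{..<K}. x \<notin> \<Union>(\<G> c)} \<le> q"
    by (rule coloured_families[OF R, where K=K]) (rule that)
  obtain \<H> :: "nat \<Rightarrow> 'a set set" where \<H>:
    "\<And>c. finite (\<H> c)" "\<And>c. disjoint (\<H> c)" "\<And>c G. c < K \<Longrightarrow> G \<in> \<H> c \<Longrightarrow> openin mtopology G \<and> R' G"
    "\<And>x. x \<in> M \<Longrightarrow> card {c\<in>{..<K}. x \<notin> \<Union>(\<H> c)} \<le> q'"
    by (rule coloured_families[OF R', where K=K]) (rule that)
  define \<V> where "\<V> = (\<Union>c<K. (\<lambda>(G,H). G \<inter> H) ` (\<G> c \<times> \<H> c))"
  have cov: "\<exists>c<K. x \<in> \<Union>(\<G> c) \<and> x \<in> \<Union>(\<H> c)" if "x \<in> M" for x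
  proof (rule ccontr)
    assume "\<not> ?thesis"
    then have "{..<K} \<subseteq> {c\<in>{..<K}. x \<notin> \<Union>(\<G> c)} \<union> {c\<in>{..<K}. x \<notin> \<Union>(\<H> c)}" by blast
    then have "card {..<K} \<le> card ({c\<in>{..<K}. x \<notin> \<Union>(\<G> c)} \<union> {c\<in>{..<K}. x \<notin> \<Union>(\<H> c)})"
      by (intro card_mono) auto
    also have "\<dots> \<le> q + q'"
      using \<G>(4)[OF that] \<H>(4)[OF that] card_Un_le[of "{c\<in>{..<K}. x \<notin> \<Union>(\<G> c)}" "{c\<in>{..<K}. x \<notin> \<Union>(\<H> c)}"] by linarith
    finally show False by (simp add: K_def)
  qed
  have VD: "openin mtopology V \<and> R V \<and> R' V" if V: "V \<in> \<V>" for V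
  proof -
    obtain c G H where c: "c < K" "G \<in> \<G> c" "H \<in> \<H> c" "V = G \<inter> H"
      using V unfolding \<V>_def by auto
    then show ?thesis
      using \<G>(3)[OF c(1,2)] \<H>(3)[OF c(1,3)] hereditaryD[OF R(2), of G V] hereditaryD[OF R'(2), of H V]
      by auto
  qed
  have "finite_open_cover mtopology \<V>"
    unfolding finite_open_cover_def
  proof (intro conjI)
    show "finite \<V>" using \<G> \<H> by (auto simp: \<V>_def)
    show "\<forall>V\<in>\<V>. openin mtopology V" using VD by blast
    show "\<Union> \<V> = topspace mtopology"
    proof
      show "\<Union> \<V> \<subseteq> topspace mtopology" using VD openin_subset by blast
      show "topspace mtopology \<subseteq> \<Union> \<V>"
        using cov unfolding \<V>_def by fastforce
    qed
  qed
  moreover have "card {V\<in>\<V>. x \<in> V} \<le> Suc (q + q')" if "x \<in> M" for x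
  proof -
    \<comment> \<open>In a disjoint family the union of the members through \<open>x\<close> is the
      only such member; this expresses it as a function of the colour.\<close>
    have un: "\<Union>{G\<in>\<A>. x \<in> G} = A" if "disjoint \<A>" "A \<in> \<A>" "x \<in> A" for \<A> A
      using that unfolding disjoint_def by blast
    have "{V\<in>\<V>. x \<in> V} \<subseteq> (\<lambda>c. \<Union>{G\<in>\<G> c. x \<in> G} \<inter> \<Union>{G\<in>\<H> c. x \<in> G}) ` {..<K}"
    proof
      fix V assume "V \<in> {V\<in>\<V>. x \<in> V}"
      then obtain c G H where "c < K" "G \<in> \<G> c" "H \<in> \<H> c" "V = G \<inter> H" "x \<in> G" "x \<in> H"
        by (auto simp: \<V>_def)
      then have "V = \<Union>{G\<in>\<G> c. x \<in> G} \<inter> \<Union>{G\<in>\<H> c. x \<in> G}"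
        using un[OF \<G>(2)] un[OF \<H>(2)] by presburger
      then show "V \<in> (\<lambda>c. \<Union>{G\<in>\<G> c. x \<in> G} \<inter> \<Union>{G\<in>\<H> c. x \<in> G}) ` {..<K}" using \<open>c < K\<close> by blast
    qed
    then show ?thesis using surj_card_le[of "{..<K}"] by (simp add: K_def)
  qed
  ultimately show ?thesis unfolding cover_dim_le_def using VD by auto
qed

end

text \<open>Fekete's lemma. \<open>mdim\<close> is written with \<open>lim\<close>, which determines
  nothing until convergence is known.\<close>

lemma subadditive_ratio_convergent:
  fixes a :: "nat \<Rightarrow> nat"
  assumes sub: "\<And>m n. a (m + n) \<le> a m + a n"
  shows "convergent (\<lambda>n. real (a n) / real n)"
proof -
  define L where "L = (INF n\<in>{1..}. real (a n) / real n)"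
  have bdd: "bdd_below ((\<lambda>n. real (a n) / real n) ` {1..})"
    by (intro bdd_belowI[of _ 0]) auto
  have low: "L \<le> real (a n) / real n" if "n \<ge> 1" for n
    unfolding L_def using that by (intro cINF_lower[OF bdd]) auto
  have mult: "a (q * m + r) \<le> q * a m + a r" for q m r
  proof (induction q)
    case (Suc q)
    have "a (Suc q * m + r) \<le> a m + a (q * m + r)" using sub[of m "q * m + r"] by (simp add: add.assoc)
    then show ?case using Suc by simp
  qed simp
  have "(\<lambda>n. real (a n) / real n) \<longlonglongrightarrow> L"
  proof (rule LIMSEQ_I)
    fix e :: real assume e: "e > 0"
    have "\<exists>m\<in>{1..}. real (a m) / real m < L + e / 2"
      using cINF_less_iff[OF _ bdd, of "L + e/2"] e unfolding L_def[symmetric] by auto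
    then obtain m where m: "m \<ge> 1" "real (a m) / real m < L + e / 2" by auto
    \<comment> \<open>Bounds the contribution of every remainder modulo \<open>m\<close>.\<close>
    define C where "C = (\<Sum>r<m. a r)"
    obtain n0 :: nat where n0: "real C / (e / 2) < real n0" using reals_Archimedean2 by blast
    show "\<exists>no. \<forall>n\<ge>no. norm (real (a n) / real n - L) < e"
    proof (intro exI allI impI)
      fix n assume n: "n \<ge> Suc n0"
      have "a n \<le> (n div m) * a m + a (n mod m)" using mult[of "n div m" m "n mod m"] by simp
      also have "a (n mod m) \<le> C" unfolding C_def using m(1) by (intro member_le_sum) auto
      finally have "real (a n) \<le> real (n div m) * real (a m) + real C"
        by (metis add_left_mono le_trans of_nat_add of_nat_le_iff of_nat_mult)
      also have "real (n div m) * real (a m) \<le> real n * (real (a m) / real m)"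
      proof -
        have "real (n div m) * real m \<le> real n"
          by (metis div_times_less_eq_dividend of_nat_le_iff of_nat_mult)
        then have "real (n div m) \<le> real n / real m" using m(1) by (simp add: field_simps)
        then have "real (n div m) * real (a m) \<le> (real n / real m) * real (a m)" by (intro mult_right_mono) auto
        then show ?thesis by simp
      qed
      finally have "real (a n) \<le> real n * (real (a m) / real m) + real C" by simp
      then have "real (a n) / real n \<le> real (a m) / real m + real C / real n"
        using n by (simp add: field_simps)
      moreover have "real C / real n < e / 2"
      proof -
        have "real C < real n0 * (e/2)" using n0 e by (simp add: field_simps)
        also have "\<dots> \<le> real n * (e/2)" using n e by (intro mult_right_mono) auto
        finally show ?thesis using n by (simp add: field_simps)
      qed
      ultimately show "norm (real (a n) / real n - L) < e"
        using low[of n] m(2) n unfolding real_norm_def abs_less_iff by linarith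
    qed
  qed
  then show ?thesis by (rule convergentI)
qed

definition small_on :: "('a \<Rightarrow> int \<Rightarrow> 'a) \<Rightarrow> 'a set set \<Rightarrow> int set \<Rightarrow> 'a set \<Rightarrow> bool" where
  "small_on act \<U> T V \<longleftrightarrow> (\<forall>z\<in>T. \<exists>U\<in>\<U>. \<forall>x\<in>V. act x z \<in> U)"

lemma hereditary_small_on: "hereditary (small_on act \<U> T)"
  unfolding hereditary_def small_on_def by (meson subsetD)

lemma small_on_Un: "small_on act \<U> (S \<union> T) V \<longleftrightarrow> small_on act \<U> S V \<and> small_on act \<U> T V"
  unfolding small_on_def by blast

lemma small_on_subset: "small_on act \<U> T V \<Longrightarrow> S \<subseteq> T \<Longrightarrow> small_on act \<U> S V"
  unfolding small_on_def by blast

lemma finite_open_cover_ord: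
  assumes "finite_open_cover X \<V>" "topspace X \<noteq> {}"
  shows "cover_ord X \<V> - 1 \<le> q \<longleftrightarrow> (\<forall>x\<in>topspace X. card {V\<in>\<V>. x \<in> V} \<le> Suc q)"
proof -
  have fin: "finite \<V>" using assms(1) by (simp add: finite_open_cover_def)
  have "bdd_above ((\<lambda>x. card {V\<in>\<V>. x \<in> V}) ` topspace X)"
    by (intro bdd_aboveI[of _ "card \<V>"]) (auto intro!: card_mono fin)
  then have "cover_ord X \<V> \<le> Suc q \<longleftrightarrow> (\<forall>x\<in>topspace X. card {V\<in>\<V>. x \<in> V} \<le> Suc q)"
    unfolding cover_ord_def using assms(2) by (intro cSUP_le_iff) auto
  then show ?thesis by auto
qed

section \<open>Dimension of orbit covers and its link with mean dimension\<close>

locale compact_dynamics = compact_metric M d for M :: "'a set" and d +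
  fixes act :: "'a \<Rightarrow> int \<Rightarrow> 'a"
  assumes dynamics: "dynamical_system mtopology act"
begin

lemma act_0 [simp]: "x \<in> M \<Longrightarrow> act x 0 = x"
  using dynamics by (simp add: dynamical_system_def)

lemma act_act [simp]: "x \<in> M \<Longrightarrow> act (act x z) z' = act x (z + z')"
  using dynamics by (simp add: dynamical_system_def)

lemma continuous_act: "continuous_map mtopology mtopology (\<lambda>x. act x z)"
  using dynamical_system_homeomorphic_map[OF dynamics] homeomorphic_imp_continuous_map by blast

lemma act_in [simp, intro]: "x \<in> M \<Longrightarrow> act x z \<in> M"
  using continuous_map_image_subset_topspace[OF continuous_act] by force

lemma openin_act_preimage: "openin mtopology U \<Longrightarrow> openin mtopology {x\<in>M. act x z \<in> U}"
  using openin_continuous_map_preimage[OF continuous_act] by simp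

lemma closedin_act_preimage: "closedin mtopology U \<Longrightarrow> closedin mtopology {x\<in>M. act x z \<in> U}"
  using closedin_continuous_map_preimage[OF continuous_act] by simp

text \<open>Pulling the cover back along the translation by \<open>a\<close> moves the set of times
  by \<open>a\<close> and does not increase the order.\<close>

lemma cover_dim_le_shift:
  assumes "cover_dim_le mtopology (small_on act \<U> T) q"
  shows "cover_dim_le mtopology (small_on act \<U> ((+) a ` T)) q"
proof -
  obtain \<V> where \<V>: "finite_open_cover mtopology \<V>" "\<forall>V\<in>\<V>. small_on act \<U> T V"
    "\<forall>x\<in>M. card {V\<in>\<V>. x \<in> V} \<le> Suc q"
    using assms unfolding cover_dim_le_def by auto
  define p where "p V = {x\<in>M. act x a \<in> V}" for V
  have fin: "finite \<V>" using \<V>(1) by (simp add: finite_open_cover_def)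
  have "finite_open_cover mtopology (p ` \<V>)"
    unfolding finite_open_cover_def
  proof (intro conjI)
    show "\<forall>U\<in>p ` \<V>. openin mtopology U"
      using \<V>(1) openin_act_preimage unfolding finite_open_cover_def p_def by blast
    have "\<Union>\<V> = M" using \<V>(1) unfolding finite_open_cover_def by simp
    moreover have "\<Union> (p ` \<V>) = {x\<in>M. act x a \<in> \<Union>\<V>}" by (auto simp: p_def)
    moreover have "{x\<in>M. act x a \<in> M} = M" by auto
    ultimately show "\<Union> (p ` \<V>) = topspace mtopology" by simp
  qed (use fin in auto)
  moreover have "small_on act \<U> ((+) a ` T) (p V)" if "V \<in> \<V>" for V
    unfolding small_on_def
  proof (intro ballI)
    fix z assume "z \<in> (+) a ` T"
    then obtain t where t: "t \<in> T" "z = a + t" by blast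
    have "small_on act \<U> T V" using \<V>(2) that by blast
    then obtain U where U: "U \<in> \<U>" "\<forall>x\<in>V. act x t \<in> U" using t(1) unfolding small_on_def by blast
    have "act x z \<in> U" if "x \<in> p V" for x
    proof -
      have "x \<in> M" "act x a \<in> V" using that by (auto simp: p_def)
      then show ?thesis using U(2) t(2) act_act[of x a t] by auto
    qed
    then show "\<exists>U\<in>\<U>. \<forall>x\<in>p V. act x z \<in> U" using U(1) by blast
  qed
  moreover have "card {W\<in>p ` \<V>. x \<in> W} \<le> Suc q" if "x \<in> M" for x
  proof -
    have "{W\<in>p ` \<V>. x \<in> W} \<subseteq> p ` {V\<in>\<V>. act x a \<in> V}" by (auto simp: p_def)
    then have "card {W\<in>p ` \<V>. x \<in> W} \<le> card {V\<in>\<V>. act x a \<in> V}"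
      using fin by (intro surj_card_le) auto
    also have "\<dots> \<le> Suc q" using \<V>(3) that by auto
    finally show ?thesis .
  qed
  ultimately show ?thesis unfolding cover_dim_le_def by auto
qed

lemma cover_dim_le_union:
  assumes "cover_dim_le mtopology (small_on act \<U> S) p" "cover_dim_le mtopology (small_on act \<U> T) q"
  shows "cover_dim_le mtopology (small_on act \<U> (S \<union> T)) (p + q)"
  using cover_dim_le_Int[OF assms(1) hereditary_small_on assms(2) hereditary_small_on]
  by (rule cover_dim_le_mono) (auto simp: small_on_Un)

text \<open>Each translate of \<open>T\<close> costs \<open>q\<close>, by translation and
  subadditivity. This is the price list for the handles of the towers.\<close>

lemma cover_dim_le_shifts:
  assumes "cover_dim_le mtopology (small_on act \<U> T) q" "finite I"
  shows "cover_dim_le mtopology (small_on act \<U> (\<Union>r\<in>I. (+) r ` T)) (card I * q)"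
  using assms(2)
proof (induction I)
  case empty
  have "finite_open_cover mtopology {M}"
    using openin_topspace[of mtopology] by (simp add: finite_open_cover_def)
  moreover have "card {V\<in>{M}. x \<in> V} \<le> Suc 0" for x
    using card_mono[of "{M}" "{V\<in>{M}. x \<in> V}"] by auto
  ultimately show ?case
    unfolding cover_dim_le_def small_on_def by (intro exI[of _ "{M}"]) auto
next
  case (insert r I)
  show ?case
    using cover_dim_le_union[OF cover_dim_le_shift[OF assms(1), of r] insert.IH] insert.hyps by simp
qed

text \<open>Keeps the infimum in \<open>cover_dim\<close> from ranging over the empty set, where it
  would be a default value.\<close>

lemma cover_dim_le_interval_exists:
  assumes "finite_open_cover mtopology \<U>"
  shows "\<exists>q. cover_dim_le mtopology (small_on act \<U> {0..<int n}) q"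
proof -
  have fin: "finite \<U>" and un: "\<Union>\<U> = M" using assms by (auto simp: finite_open_cover_def)
  have "card {U\<in>\<U>. x \<in> U} \<le> Suc (card \<U>)" for x
    using fin card_mono[of \<U> "{U\<in>\<U>. x \<in> U}"] by auto
  moreover have "small_on act \<U> {0} U" if "U \<in> \<U>" for U
  proof -
    have "act x 0 \<in> U" if "x \<in> U" for x
      using that \<open>U \<in> \<U>\<close> un act_0[of x] by fastforce
    then show ?thesis using that unfolding small_on_def by blast
  qed
  ultimately have "cover_dim_le mtopology (small_on act \<U> {0}) (card \<U>)"
    using assms unfolding cover_dim_le_def by auto
  from cover_dim_le_shifts[OF this, of "{0..<int n}"] show ?thesis by auto
qed

lemma small_on_iff_iterated_cover:
  assumes "finite_open_cover mtopology \<U>" "V \<subseteq> M"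
  shows "small_on act \<U> {0..<int n} V \<longleftrightarrow> (\<exists>W\<in>iterated_cover act \<U> n. V \<subseteq> W)"
proof -
  have un: "\<Union>\<U> = M" using assms(1) by (simp add: finite_open_cover_def)
  \<comment> \<open>On points of the space, the image under the inverse translation used in
    \<open>iterated_cover\<close> is the preimage under the translation.\<close>
  have im: "x \<in> (\<lambda>x. act x (- z)) ` U \<longleftrightarrow> act x z \<in> U" if "U \<in> \<U>" "x \<in> M" for x z U
  proof
    assume "x \<in> (\<lambda>x. act x (- z)) ` U"
    then obtain u where u: "u \<in> U" "x = act u (- z)" by blast
    moreover have "u \<in> M" using un that(1) u(1) by blast
    ultimately show "act x z \<in> U" by simp
  next
    assume "act x z \<in> U"
    moreover have "x = act (act x z) (- z)" using that by simp
    ultimately show "x \<in> (\<lambda>x. act x (- z)) ` U" by blast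
  qed
  show ?thesis
  proof
    assume L: "small_on act \<U> {0..<int n} V"
    have "\<exists>U\<in>\<U>. \<forall>x\<in>V. act x (int z) \<in> U" if "z < n" for z
    proof -
      have "int z \<in> {0..<int n}" using that by simp
      then show ?thesis using L unfolding small_on_def by blast
    qed
    then obtain W where W: "\<And>z. z < n \<Longrightarrow> W z \<in> \<U> \<and> (\<forall>x\<in>V. act x (int z) \<in> W z)" by metis
    define W' where "W' = restrict W {..<n}"
    have "W' \<in> {..<n} \<rightarrow>\<^sub>E \<U>" using W by (auto simp: W'_def)
    moreover have "V \<subseteq> (\<Inter>z<n. (\<lambda>x. act x (- int z)) ` W' z)"
    proof (intro INT_greatest subsetI)
      fix z x assume z: "z \<in> {..<n}" and x: "x \<in> V"
      then show "x \<in> (\<lambda>x. act x (- int z)) ` W' z"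
        using W[of z] im[of "W z" x "int z"] assms(2) by (auto simp: W'_def)
    qed
    ultimately show "\<exists>W\<in>iterated_cover act \<U> n. V \<subseteq> W" unfolding iterated_cover_def by blast
  next
    assume "\<exists>W\<in>iterated_cover act \<U> n. V \<subseteq> W"
    then obtain W where W: "W \<in> {..<n} \<rightarrow>\<^sub>E \<U>" "V \<subseteq> (\<Inter>z<n. (\<lambda>x. act x (- int z)) ` W z)"
      unfolding iterated_cover_def by blast
    show "small_on act \<U> {0..<int n} V"
      unfolding small_on_def
    proof (intro ballI)
      fix z assume z: "z \<in> {0..<int n}"
      then have zn: "nat z < n" "int (nat z) = z" by auto
      then have "W (nat z) \<in> \<U>" using W(1) by blast
      moreover have "act x z \<in> W (nat z)" if "x \<in> V" for x
      proof -
        have "x \<in> (\<lambda>x. act x (- int (nat z))) ` W (nat z)" using that W(2) zn(1) by blast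
        then show ?thesis using im[OF calculation, of x z] that assms(2) zn(2) by auto
      qed
      ultimately show "\<exists>U\<in>\<U>. \<forall>x\<in>V. act x z \<in> U" by blast
    qed
  qed
qed

lemma cover_dim_iterated_cover_le_iff:
  assumes "finite_open_cover mtopology \<U>" "M \<noteq> {}"
  shows "cover_dim mtopology (iterated_cover act \<U> n) \<le> q \<longleftrightarrow>
    cover_dim_le mtopology (small_on act \<U> {0..<int n}) q"
proof -
  define \<C> where "\<C> = {\<V>. finite_open_cover mtopology \<V> \<and> refines \<V> (iterated_cover act \<U> n)}"
  have ref: "refines \<V> (iterated_cover act \<U> n) \<longleftrightarrow> (\<forall>V\<in>\<V>. small_on act \<U> {0..<int n} V)"
    if "finite_open_cover mtopology \<V>" for \<V>
  proof -
    have "V \<subseteq> M" if "V \<in> \<V>" for V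
      using that \<open>finite_open_cover mtopology \<V>\<close> by (auto simp: finite_open_cover_def)
    then show ?thesis
      unfolding refines_def using small_on_iff_iterated_cover[OF assms(1)] by (intro ball_cong refl) simp
  qed
  have iff: "cover_dim_le mtopology (small_on act \<U> {0..<int n}) p \<longleftrightarrow> (\<exists>\<V>\<in>\<C>. cover_ord mtopology \<V> - 1 \<le> p)" for p
    unfolding cover_dim_le_def \<C>_def using ref finite_open_cover_ord[of mtopology _ p] assms(2)
    by (auto 0 4)
  have ne: "\<C> \<noteq> {}" using cover_dim_le_interval_exists[OF assms(1), of n] iff by blast
  have cd: "cover_dim mtopology (iterated_cover act \<U> n) = (INF \<V>\<in>\<C>. cover_ord mtopology \<V> - 1)"
    by (simp add: cover_dim_def \<C>_def)
  show ?thesis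
  proof
    assume le: "cover_dim mtopology (iterated_cover act \<U> n) \<le> q"
    have "(INF \<V>\<in>\<C>. cover_ord mtopology \<V> - 1) \<in> (\<lambda>\<V>. cover_ord mtopology \<V> - 1) ` \<C>"
      using ne by (intro Inf_nat_def1) auto
    then show "cover_dim_le mtopology (small_on act \<U> {0..<int n}) q"
      using le iff[of q] cd by auto
  next
    assume "cover_dim_le mtopology (small_on act \<U> {0..<int n}) q"
    then obtain \<V> where "\<V> \<in> \<C>" "cover_ord mtopology \<V> - 1 \<le> q" using iff by blast
    then show "cover_dim mtopology (iterated_cover act \<U> n) \<le> q"
      unfolding cd by (intro order_trans[OF cINF_lower]) auto
  qed
qed

text \<open>Since \<open>q\<close> and \<open>k * L\<close> are integers, the strict inequality
  leaves at least one spare unit of dimension per window of length \<open>L\<close>. The tower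
  construction lives on this unit.\<close>

lemma mdim_less_imp_cover_dim_le:
  assumes "mdim mtopology act < ereal (real k)" "M \<noteq> {}" and \<U>: "finite_open_cover mtopology \<U>"
  obtains L q where "L \<ge> 1" "q < k * L" "cover_dim_le mtopology (small_on act \<U> {0..<int L}) q"
proof -
  define a where "a n = cover_dim mtopology (iterated_cover act \<U> n)" for n
  have dim: "cover_dim_le mtopology (small_on act \<U> {0..<int n}) (a n)" for n
    unfolding a_def by (rule cover_dim_iterated_cover_le_iff[OF \<U> assms(2), THEN iffD1, OF order_refl])
  have "a (m + n) \<le> a m + a n" for m n
  proof -
    have "{0..<int (m + n)} \<subseteq> {0..<int m} \<union> (+) (int m) ` {0..<int n}" by auto
    then have "cover_dim_le mtopology (small_on act \<U> {0..<int (m + n)}) (a m + a n)"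
      by (intro cover_dim_le_mono[OF cover_dim_le_union[OF dim[of m] cover_dim_le_shift[OF dim[of n], of "int m"]]])
        (auto elim: small_on_subset)
    then show ?thesis using cover_dim_iterated_cover_le_iff[OF \<U> assms(2)] by (simp add: a_def)
  qed
  then have "convergent (\<lambda>n. real (a n) / real n)" by (rule subadditive_ratio_convergent)
  then obtain l where l: "(\<lambda>n. real (a n) / real n) \<longlonglongrightarrow> l" by (auto simp: convergent_def)
  then have "lim (\<lambda>n. ereal (real (a n) / real n)) = ereal l" by (intro limI) simp
  moreover have "lim (\<lambda>n. ereal (real (a n) / real n)) \<le> mdim mtopology act"
    unfolding mdim_def a_def using \<U> by (intro SUP_upper) simp
  ultimately have "l < real k" using assms(1) by (metis ereal_less_eq(3) le_less_trans not_le)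
  then have "eventually (\<lambda>n. real (a n) / real n < real k) sequentially"
    using l by (intro order_tendstoD)
  then have "eventually (\<lambda>n. real (a n) / real n < real k \<and> n \<ge> 1) sequentially"
    using eventually_ge_at_top[of 1] by (rule eventually_conj)
  then obtain n where n: "real (a n) / real n < real k" "n \<ge> 1"
    using eventually_happens'[OF sequentially_bot] by blast
  then have "real (a n) < real (k * n)" by (simp add: field_simps)
  then have "a n < k * n" using of_nat_less_iff by blast
  then show thesis using that[OF n(2) _ dim] by blast
qed


section \<open>Towers\<close>

text \<open>A tower \<open>t\<close> has base \<open>Q t\<close> and uses the levels \<open>S t\<close>; every point lies on a level \<open>j \<in> H t\<close> over some
  base. A coordinate \<open>i < k\<close> at a level \<open>s \<in> S t\<close> serves as one colour for a cover of the base.\<close>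

lemma coloured_towers:
  fixes Q :: "'t \<Rightarrow> 'a set" and S H :: "'t \<Rightarrow> int set" and q :: "'t \<Rightarrow> nat"
  assumes T: "finite T" and Q: "\<And>t. t \<in> T \<Longrightarrow> closedin mtopology (Q t)"
    and S: "\<And>t. t \<in> T \<Longrightarrow> finite (S t) \<and> S t \<subseteq> H t" and H: "\<And>t. t \<in> T \<Longrightarrow> finite (H t)"
    and dim: "\<And>t. t \<in> T \<Longrightarrow> cover_dim_le mtopology (small_on act \<U> (H t)) (q t)"
    and card: "\<And>t. t \<in> T \<Longrightarrow> q t < k * card (S t)"
    and disj: "\<And>t t' s s' x y. t \<in> T \<Longrightarrow> t' \<in> T \<Longrightarrow> s \<in> S t \<Longrightarrow> s' \<in> S t' \<Longrightarrow> x \<in> Q t \<Longrightarrow> y \<in> Q t' \<Longrightarrow>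
      act x s = act y s' \<Longrightarrow> t = t' \<and> s = s'"
    and cov: "\<And>x. x \<in> M \<Longrightarrow> \<exists>t\<in>T. \<exists>j\<in>H t. act x (- j) \<in> Q t"
  obtains \<A> :: "nat \<Rightarrow> 'a set set" and J :: "int set" where "finite J"
    "\<And>i. finite (\<A> i)" "\<And>i. disjoint (\<A> i)" "\<And>i. {} \<notin> \<A> i"
    "\<And>i A. i < k \<Longrightarrow> A \<in> \<A> i \<Longrightarrow> closedin mtopology A \<and> (\<exists>U\<in>\<U>. A \<subseteq> U)"
    "\<And>x. x \<in> M \<Longrightarrow> \<exists>i<k. \<exists>A\<in>\<A> i. \<exists>z\<in>J. act x z \<in> A \<and> small_on act \<U> {- z} A"
proof -
  define good where "good t \<F> \<longleftrightarrow> (\<forall>c. finite (\<F> c) \<and> disjoint (\<F> c)) \<and>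
      (\<forall>c F. c < k * card (S t) \<longrightarrow> F \<in> \<F> c \<longrightarrow> closedin mtopology F \<and> small_on act \<U> (H t) F) \<and>
      (\<forall>x\<in>M. \<exists>c<k * card (S t). x \<in> \<Union>(\<F> c))" for t and \<F> :: "nat \<Rightarrow> 'a set set"
  have "\<exists>\<F>. good t \<F>" if t: "t \<in> T" for t
  proof -
    obtain \<F> :: "nat \<Rightarrow> 'a set set" where
      "\<And>c. finite (\<F> c)" "\<And>c. disjoint (\<F> c)"
      "\<And>c F. c < k * card (S t) \<Longrightarrow> F \<in> \<F> c \<Longrightarrow> closedin mtopology F \<and> small_on act \<U> (H t) F"
      "\<And>x. x \<in> M \<Longrightarrow> \<exists>c<k * card (S t). x \<in> \<Union>(\<F> c)"
      by (rule coloured_closed_cover[OF dim[OF t] hereditary_small_on card[OF t]]) (rule that)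
    then show ?thesis by (intro exI[of _ \<F>]) (simp add: good_def)
  qed
  then obtain \<F> where "\<And>t. t \<in> T \<Longrightarrow> good t (\<F> t)" by metis
  note \<F> = this[unfolded good_def]
  have F1: "finite (\<F> t c)" "disjoint (\<F> t c)" if "t \<in> T" for t c using \<F>[OF that] by simp_all
  have F2: "closedin mtopology F" "small_on act \<U> (H t) F" if "t \<in> T" "c < k * card (S t)" "F \<in> \<F> t c" for t c F
    using \<F>[OF that(1)] that(2,3) by simp_all
  have F3: "\<exists>c<k * card (S t). \<exists>F\<in>\<F> t c. x \<in> F" if "t \<in> T" "x \<in> M" for t x
  proof -
    have "\<exists>c<k * card (S t). x \<in> \<Union>(\<F> t c)" using \<F>[OF that(1)] that(2) by simp
    then show ?thesis by simp
  qed
  have "\<exists>f. bij_betw f {0..<card (S t)} (S t)" if "t \<in> T" for t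
    using S[OF that] by (intro ex_bij_betw_nat_finite) simp
  then obtain f where f: "\<And>t. t \<in> T \<Longrightarrow> bij_betw (f t) {0..<card (S t)} (S t)" by metis
  define E where "E t s F = {x\<in>M. act x (- s) \<in> F \<inter> Q t}" for t s F
  \<comment> \<open>Coordinate \<open>i\<close> and level number \<open>r\<close> together form the
    colour \<open>i * card (S t) + r\<close>; the members of that colour, cut down to the base, are
    lifted to level \<open>f t r\<close>. Empty sets are removed because the perturbation lemma
    takes non-empty ones.\<close>
  define \<A> where "\<A> i = (\<Union>t\<in>T. \<Union>r\<in>{0..<card (S t)}. E t (f t r) ` \<F> t (i * card (S t) + r)) - {{}}" for i
  have fS: "f t r \<in> S t" if "t \<in> T" "r < card (S t)" for t r
    using bij_betwE[OF f[OF that(1)]] that(2) by simp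
  have A_elim: "\<exists>t r F. t \<in> T \<and> r < card (S t) \<and> F \<in> \<F> t (i * card (S t) + r) \<and> A = E t (f t r) F"
    if "A \<in> \<A> i" for A i
  proof -
    have "A \<in> (\<Union>t\<in>T. \<Union>r\<in>{0..<card (S t)}. E t (f t r) ` \<F> t (i * card (S t) + r))"
      using that unfolding \<A>_def by (rule DiffD1)
    then obtain t r where "t \<in> T" "r \<in> {0..<card (S t)}" "A \<in> E t (f t r) ` \<F> t (i * card (S t) + r)"
      by (elim UN_E) (rule that)
    then show ?thesis by (metis atLeastLessThan_iff imageE)
  qed
  have idx: "i * card (S t) + r < k * card (S t)" if "i < k" "r < card (S t)" for i t r
  proof -
    have "i * card (S t) + r < Suc i * card (S t)" using that by simp
    also have "\<dots> \<le> k * card (S t)" using that by (intro mult_le_mono1) simp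
    finally show ?thesis .
  qed
  \<comment> \<open>From level \<open>s\<close>, going back by \<open>s\<close> and forward by
    \<open>j\<close> passes through the base and ends at level \<open>j\<close>, where
    \<open>F\<close> is small.\<close>
  have smallE: "small_on act \<U> {j - s} (E t s F)" if "t \<in> T" "j \<in> H t" "small_on act \<U> (H t) F" for t j s F
  proof -
    from that(2,3) obtain U where U: "U \<in> \<U>" "\<forall>x\<in>F. act x j \<in> U" unfolding small_on_def by metis
    have "act x (j - s) \<in> U" if "x \<in> E t s F" for x
    proof -
      have "x \<in> M" "act x (- s) \<in> F" using that by (auto simp: E_def)
      then show ?thesis using U(2) act_act[of x "- s" j] by auto
    qed
    then show ?thesis using U(1) by (auto simp: small_on_def)
  qed
  define J where "J = (\<Union>t\<in>T. (\<lambda>(s, j). s - j) ` (S t \<times> H t))"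
  show thesis
  proof (rule that[of J \<A>])
    show "finite J" unfolding J_def using T S H by auto
    show "finite (\<A> i)" for i unfolding \<A>_def using T F1 by auto
    show "{} \<notin> \<A> i" for i by (simp add: \<A>_def)
    show "disjoint (\<A> i)" for i
    proof (rule disjointI, rule ccontr)
      fix A A' assume A: "A \<in> \<A> i" "A' \<in> \<A> i" "A \<noteq> A'" and ne: "A \<inter> A' \<noteq> {}"
      obtain t r F where t: "t \<in> T" "r < card (S t)" "F \<in> \<F> t (i * card (S t) + r)" "A = E t (f t r) F"
        using A_elim[OF A(1)] by metis
      obtain t' r' F' where t': "t' \<in> T" "r' < card (S t')" "F' \<in> \<F> t' (i * card (S t') + r')" "A' = E t' (f t' r') F'"
        using A_elim[OF A(2)] by metis
      obtain x where x: "x \<in> A" "x \<in> A'" using ne by blast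
      then have xM: "x \<in> M" and xF: "act x (- f t r) \<in> F" "act x (- f t r) \<in> Q t"
        "act x (- f t' r') \<in> F'" "act x (- f t' r') \<in> Q t'"
        using t(4) t'(4) by (auto simp: E_def)
      \<comment> \<open>A common point forces the same tower and the same level, hence the same
        colour for the fixed coordinate \<open>i\<close>; within one colour the sets are
        disjoint.\<close>
      have "t = t' \<and> f t r = f t' r'"
        by (rule disj[OF t(1) t'(1) fS[OF t(1,2)] fS[OF t'(1,2)] xF(2,4)]) (simp add: xM)
      then have tt: "t' = t" and ff: "f t r = f t r'" by auto
      have "r = r'"
        using inj_onD[OF bij_betw_imp_inj_on[OF f[OF t(1)]]] ff t(2) t'(2) by (simp add: tt)
      then have "F \<inter> F' \<noteq> {}" using xF ff tt by auto
      then have "F = F'" using F1(2)[OF t(1)] t(3) t'(3) \<open>r = r'\<close> tt unfolding disjoint_def by metis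
      then show False using A(3) t(4) t'(4) tt \<open>r = r'\<close> by simp
    qed
    show "closedin mtopology A \<and> (\<exists>U\<in>\<U>. A \<subseteq> U)" if i: "i < k" and A: "A \<in> \<A> i" for i A
    proof
      obtain t r F where t: "t \<in> T" "r < card (S t)" "F \<in> \<F> t (i * card (S t) + r)" "A = E t (f t r) F"
        using A_elim[OF A] by metis
      note F = F2[OF t(1) idx[OF i t(2)] t(3)]
      show "closedin mtopology A"
        unfolding t(4) E_def using F(1) Q[OF t(1)] by (intro closedin_act_preimage closedin_Int)
      \<comment> \<open>The level itself belongs to the handle, so \<open>A\<close> is small at time
        0: a map that varies little on the members of \<open>\<U>\<close> can then be made constant
        on \<open>A\<close>.\<close>
      have "small_on act \<U> {f t r - f t r} A"
        unfolding t(4) using smallE[OF t(1) _ F(2)] S[OF t(1)] fS[OF t(1,2)] by blast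
      then obtain U where U: "U \<in> \<U>" "\<forall>x\<in>A. act x 0 \<in> U" unfolding small_on_def by auto
      have "A \<subseteq> U"
      proof
        fix x assume x: "x \<in> A"
        then have "x \<in> M" by (auto simp: t(4) E_def)
        then show "x \<in> U" using U(2) x act_0 by metis
      qed
      then show "\<exists>U\<in>\<U>. A \<subseteq> U" using U(1) by blast
    qed
    show "\<exists>i<k. \<exists>A\<in>\<A> i. \<exists>z\<in>J. act x z \<in> A \<and> small_on act \<U> {- z} A" if x: "x \<in> M" for x
    proof -
      obtain t j where t: "t \<in> T" "j \<in> H t" "act x (- j) \<in> Q t" using cov[OF x] by metis
      define y where "y = act x (- j)"
      have y: "y \<in> M" "act y j = x" using x by (auto simp: y_def)
      obtain c F where c: "c < k * card (S t)" "F \<in> \<F> t c" "y \<in> F" using F3[OF t(1) y(1)] by metis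
      \<comment> \<open>Decodes the colour \<open>c\<close> of the base point \<open>y\<close> into
        a coordinate and a level. Translating \<open>x\<close> from its own level \<open>j\<close>
        to level \<open>s\<close> takes time \<open>s - j\<close>; the way back ends at level
        \<open>j\<close>, where smallness holds because \<open>j\<close> is in the handle.\<close>
      define i r where "i = c div card (S t)" and "r = c mod card (S t)"
      have "card (S t) > 0" using c(1) by (cases "card (S t)") auto
      then have ir: "r < card (S t)" "i < k" "i * card (S t) + r = c"
        using c(1) by (auto simp: i_def r_def less_mult_imp_div_less)
      define s where "s = f t r"
      have sS: "s \<in> S t" unfolding s_def using fS[OF t(1) ir(1)] .
      have yE: "act y s \<in> E t s F" using y c(3) t(3) by (auto simp: E_def y_def)
      have "E t s F \<in> E t (f t r) ` \<F> t (i * card (S t) + r)"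
        using c(2) unfolding s_def ir(3) by (rule imageI)
      then have "E t s F \<in> (\<Union>t\<in>T. \<Union>r\<in>{0..<card (S t)}. E t (f t r) ` \<F> t (i * card (S t) + r))"
        using t(1) ir(1) by (intro UN_I) auto
      then have "E t s F \<in> \<A> i"
        unfolding \<A>_def using yE by blast
      moreover have "act x (s - j) \<in> E t s F" using yE y x by (simp add: y_def)
      moreover have "s - j \<in> J" unfolding J_def using t(1,2) sS by force
      moreover have "small_on act \<U> {- (s - j)} (E t s F)"
        using smallE[OF t(1,2) F2(2)[OF t(1) c(1,2)], of s] by simp
      ultimately show ?thesis using ir(2) by blast
    qed
  qed
qed

section \<open>Aperiodicity and the level function\<close>

lemma minimal_infinite_aperiodic:
  assumes min: "minimal_system mtopology act" and inf: "infinite M" and x: "x \<in> M" and s: "s > 0"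
  shows "act x s \<noteq> x"
proof
  assume per: "act x s = x"
  have pos: "act x (s * int j) = x" for j
  proof (induction j)
    case (Suc j)
    have "act x (s * int (Suc j)) = act (act x (s * int j)) s" using x by (simp add: algebra_simps)
    then show ?case using Suc per by simp
  qed (use x in simp)
  have all: "act x (s * j) = x" for j
  proof (cases "j \<ge> 0")
    case True
    then show ?thesis using pos[of "nat j"] by simp
  next
    case False
    have "act (act x (s * (- j))) (s * j) = x" using x by simp
    then show ?thesis using pos[of "nat (- j)"] False by simp
  qed
  have "range (act x) \<subseteq> act x ` {0..<s}"
  proof
    fix y assume "y \<in> range (act x)"
    then obtain z where "y = act x z" by blast
    also have "\<dots> = act (act x (s * (z div s))) (z mod s)" using x by simp
    finally have "y = act x (z mod s)" using all by simp
    then show "y \<in> act x ` {0..<s}" using s by auto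
  qed
  then have fin: "finite (range (act x))" by (meson finite_atLeastLessThan_int finite_imageI finite_subset)
  \<comment> \<open>A finite orbit is closed, and density makes it the whole space.\<close>
  have "closedin mtopology (range (act x))"
    using fin x by (intro closedin_Hausdorff_finite Hausdorff_space_mtopology) auto
  then have "mtopology closure_of (range (act x)) = range (act x)" by (simp add: closure_of_closedin)
  then show False using min x fin inf by (simp add: minimal_system_def)
qed

text \<open>Lindenstrauss' level function: \<open>\<xi> x\<close> is the expected time of the random walk which goes backwards from
  \<open>x\<close> and stops at \<open>y\<close> with probability \<open>\<phi> y\<close>.\<close>

lemma level_function:
  fixes m :: int
  assumes min: "minimal_system mtopology act" and inf: "infinite M"
  obtains W Q0 and \<xi> :: "'a \<Rightarrow> real" and \<Xi> :: real where
    "closedin mtopology W" "openin mtopology Q0" "Q0 \<subseteq> W"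
    "\<And>x s. x \<in> W \<Longrightarrow> 0 < s \<Longrightarrow> s < m \<Longrightarrow> act x s \<notin> W"
    "continuous_map mtopology euclideanreal \<xi>" "\<And>x. x \<in> M \<Longrightarrow> 0 \<le> \<xi> x \<and> \<xi> x \<le> \<Xi>"
    "\<And>x. x \<in> M \<Longrightarrow> act x 1 \<notin> Q0 \<Longrightarrow> \<xi> (act x 1) = \<xi> x + 1"
proof -
  obtain x0 where x0: "x0 \<in> M" using min by (auto simp: minimal_system_def)
  \<comment> \<open>By aperiodicity \<open>x0\<close> and its translate by \<open>s\<close> are
    distinct. A point of \<open>V s\<close> and its translate stay within half their distance of
    \<open>x0\<close> and of the translate of \<open>x0\<close>, respectively, so no point of
    \<open>V s\<close> is carried into \<open>V s\<close> by \<open>s\<close>.\<close>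
  define V where "V s = mball x0 (d x0 (act x0 s) / 2) \<inter> {x\<in>M. act x s \<in> mball (act x0 s) (d x0 (act x0 s) / 2)}" for s
  have V: "openin mtopology (V s) \<and> x0 \<in> V s" if "s \<in> {0<..<m}" for s
  proof -
    have "d x0 (act x0 s) > 0" using minimal_infinite_aperiodic[OF min inf x0, of s] that x0 by auto
    then have "x0 \<in> V s" using x0 by (simp add: V_def)
    moreover have "openin mtopology (V s)"
      unfolding V_def by (intro openin_Int openin_act_preimage openin_mball)
    ultimately show ?thesis by simp
  qed
  have Vd: "act x s \<notin> V s" if x: "x \<in> V s" for x s
  proof
    assume "act x s \<in> V s"
    then have "d x0 (act x s) < d x0 (act x0 s) / 2" "d (act x0 s) (act x s) < d x0 (act x0 s) / 2" "act x s \<in> M"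
      using x by (auto simp: V_def)
    then show False using triangle'[of x0 "act x s" "act x0 s"] x0 by auto
  qed
  have "openin mtopology (M \<inter> \<Inter>(V ` {0<..<m}))"
  proof (cases "{0<..<m} = {}")
    case False
    then show ?thesis using V openin_topspace[of mtopology] by (intro openin_Int openin_Inter) auto
  qed (use openin_topspace[of mtopology] in auto)
  moreover have "x0 \<in> M \<inter> \<Inter>(V ` {0<..<m})" using V x0 by blast
  ultimately obtain r where r: "r > 0" "mcball x0 r \<subseteq> M \<inter> \<Inter>(V ` {0<..<m})"
    unfolding openin_mtopology_mcball by blast
  have "disjnt (M - mball x0 r) (mcball x0 (r/2))" using r(1) by (auto simp: disjnt_iff)
  moreover have "closedin mtopology (M - mball x0 r)" using closedin_topspace[of mtopology]
    by (intro closedin_diff) auto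
  moreover have "normal_space mtopology" by (simp add: metrizable_imp_normal_space metrizable_space_mtopology)
  ultimately obtain \<phi> where \<phi>: "continuous_map mtopology (top_of_set {0..1::real}) \<phi>"
    "\<phi> ` (M - mball x0 r) \<subseteq> {0}" "\<phi> ` mcball x0 (r/2) \<subseteq> {1}"
    using Urysohn_lemma[of mtopology "M - mball x0 r" "mcball x0 (r/2)" 0 1] by auto
  have \<phi>c: "continuous_map mtopology euclideanreal \<phi>" and \<phi>01: "\<And>x. x \<in> M \<Longrightarrow> 0 \<le> \<phi> x \<and> \<phi> x \<le> 1"
    using \<phi>(1) by (auto simp: continuous_map_in_subtopology)
  \<comment> \<open>Minimality brings every point into the half-size ball, where
    \<open>\<phi>\<close> is 1; compactness bounds the time this takes.\<close>
  define C where "C z = {x\<in>M. act x z \<in> mball x0 (r/2)}" for z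
  have "\<exists>z. x \<in> C z" if x: "x \<in> M" for x
  proof -
    have "x0 \<in> mtopology closure_of (range (act x))" using min x x0 by (simp add: minimal_system_def)
    then have "\<forall>T. x0 \<in> T \<and> openin mtopology T \<longrightarrow> (\<exists>y. y \<in> range (act x) \<and> y \<in> T)"
      unfolding in_closure_of by (rule conjunct2)
    moreover have "x0 \<in> mball x0 (r/2)" "openin mtopology (mball x0 (r/2))" using x0 r(1) by auto
    ultimately obtain y where "y \<in> range (act x)" "y \<in> mball x0 (r/2)" by metis
    then show ?thesis using x by (auto simp: C_def)
  qed
  then have "M \<subseteq> \<Union>(range C)" by blast
  moreover have "openin mtopology U" if "U \<in> range C" for U
  proof -
    obtain z where "U = C z" using \<open>U \<in> range C\<close> by blast
    then show ?thesis unfolding C_def by (simp only:) (intro openin_act_preimage openin_mball)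
  qed
  moreover have "compactin mtopology M" using compact_space by (simp add: compact_space_def)
  ultimately obtain \<G> where \<G>: "finite \<G>" "\<G> \<subseteq> range C" "M \<subseteq> \<Union>\<G>" unfolding compactin_def by meson
  then obtain Z where Z: "finite Z" "\<G> = C ` Z" using finite_subset_image by metis
  define b where "b = Max (insert 0 (abs ` Z))"
  have b: "\<bar>z\<bar> \<le> b" if "z \<in> Z" for z unfolding b_def using Z(1) that by (intro Max_ge) auto
  \<comment> \<open>The point \<open>act x (- b)\<close> is in the ball at some time
    \<open>z\<close> of absolute value at most \<open>b\<close>; seen from \<open>x\<close> this is
    time \<open>z - b\<close>, between \<open>- 2 * b\<close> and 0. So the backward walk surely
    stops within \<open>n\<close> steps.\<close>
  define n where "n = Suc (nat (2 * b))"
  have hit: "\<exists>i<n. \<phi> (act x (- int i)) = 1" if x: "x \<in> M" for x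
  proof -
    have "act x (- b) \<in> M" using x by simp
    then obtain z where z: "z \<in> Z" "act x (- b) \<in> C z" using \<G>(3) Z(2) by blast
    then have "act x (z - b) \<in> mball x0 (r/2)" using x by (simp add: C_def)
    then have "act x (z - b) \<in> mcball x0 (r/2)" using mball_subset_mcball by blast
    then have "\<phi> (act x (z - b)) = 1" using \<phi>(3) by blast
    moreover have "z - b = - int (nat (b - z))" "nat (b - z) < n" using b[OF z(1)] by (auto simp: n_def)
    ultimately show ?thesis by metis
  qed
  \<comment> \<open>\<open>p j x\<close> is the probability that the walk has not stopped at any of
    its first \<open>j\<close> positions. The expectation \<open>\<xi>\<close> is the sum of these
    tail probabilities, cut at \<open>n\<close> because the later ones vanish.\<close>
  define p where "p j x = (\<Prod>i<j. 1 - \<phi> (act x (- int i)))" for j x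
  define \<xi> where "\<xi> x = (\<Sum>j<n. p (Suc j) x)" for x
  have p01: "0 \<le> p j x \<and> p j x \<le> 1" if "x \<in> M" for j x
    unfolding p_def using \<phi>01 that by (auto intro!: prod_nonneg prod_le_1)
  have pn: "p n x = 0" if "x \<in> M" for x using hit[OF that] by (auto simp: p_def)
  show thesis
  proof (rule that[of "mcball x0 r" "mball x0 r" \<xi> "real n"])
    show "act x s \<notin> mcball x0 r" if "x \<in> mcball x0 r" "0 < s" "s < m" for x s
    proof -
      have "s \<in> {0<..<m}" using that by simp
      then show ?thesis using r(2) that(1) Vd by blast
    qed
    have "continuous_map mtopology euclideanreal (\<lambda>x. \<phi> (act x z))" for z
      using continuous_map_compose[OF continuous_act \<phi>c] by (simp add: o_def)
    then show "continuous_map mtopology euclideanreal \<xi>"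
      unfolding \<xi>_def p_def by (intro continuous_map_sum continuous_map_prod continuous_map_diff) auto
    show "0 \<le> \<xi> x \<and> \<xi> x \<le> real n" if x: "x \<in> M" for x
    proof
      show "0 \<le> \<xi> x" unfolding \<xi>_def using p01[OF x] by (intro sum_nonneg) simp
      have "\<xi> x \<le> real (card {..<n}) * 1" unfolding \<xi>_def using p01[OF x] by (intro sum_bounded_above) simp
      then show "\<xi> x \<le> real n" by simp
    qed
    show "\<xi> (act x 1) = \<xi> x + 1" if x: "x \<in> M" "act x 1 \<notin> mball x0 r" for x
    proof -
      have "act x 1 \<in> M - mball x0 r" using x by simp
      then have z: "\<phi> (act x 1) = 0" using \<phi>(2) by blast
      have sh: "p (Suc j) (act x 1) = p j x" for j
      proof -
        have "p (Suc j) (act x 1) = (1 - \<phi> (act x 1)) * (\<Prod>i<j. 1 - \<phi> (act (act x 1) (- int (Suc i))))"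
          unfolding p_def prod.lessThan_Suc_shift using x by simp
        also have "\<dots> = p j x" using z x by (simp add: p_def)
        finally show ?thesis .
      qed
      have "\<xi> (act x 1) = (\<Sum>j<n. p j x)" by (simp add: \<xi>_def sh)
      \<comment> \<open>Since the walk cannot stop at \<open>act x 1\<close>, its tail probabilities
        are those of \<open>x\<close> with the index lowered by one. Adding the vanishing term
        \<open>p n x\<close> makes room to split off \<open>p 0 x = 1\<close>, the
        increment.\<close>
      also have "\<dots> = (\<Sum>j<Suc n. p j x)" using pn[OF x(1)] by simp
      also have "\<dots> = p 0 x + \<xi> x" unfolding \<xi>_def by (rule sum.lessThan_Suc_shift)
      finally show ?thesis by (simp add: p_def)
    qed
  qed (auto intro: mball_subset_mcball)
qed

end

section \<open>Counting levels and the arithmetic of blocks\<close>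

lemma card_separated_shifts:
  fixes f :: "nat \<Rightarrow> int"
  assumes "finite E" "A \<subseteq> {0..<p}" "\<And>e e'. e \<in> E \<Longrightarrow> e' \<in> E \<Longrightarrow> e < e' \<Longrightarrow> f e + p \<le> f e'"
  shows "card (\<Union>e\<in>E. (+) (f e) ` A) = card E * card A"
proof -
  have fin: "finite A" using assms(2) finite_subset by blast
  have "(+) (f e) ` A \<inter> (+) (f e') ` A = {}" if "e \<in> E" "e' \<in> E" "e \<noteq> e'" for e e'
  proof -
    have False if "x \<in> A" "y \<in> A" "f e + x = f e' + y" for x y
    proof -
      have "0 \<le> x" "x < p" "0 \<le> y" "y < p" using assms(2) that by auto
      moreover have "f e + p \<le> f e' \<or> f e' + p \<le> f e" using assms(3) \<open>e \<in> E\<close> \<open>e' \<in> E\<close> \<open>e \<noteq> e'\<close> by (metis linorder_neqE_nat)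
      ultimately show False using that(3) by linarith
    qed
    then show ?thesis by fastforce
  qed
  then have "card (\<Union>e\<in>E. (+) (f e) ` A) = (\<Sum>e\<in>E. card ((+) (f e) ` A))"
    using assms(1) fin by (intro card_UN_disjoint) auto
  also have "\<dots> = (\<Sum>e\<in>E. card A)" by (intro sum.cong refl card_image) (auto simp: inj_on_def)
  finally show ?thesis by simp
qed

text \<open>\<open>G\<close> strips supply \<open>c\<close> colours each and cost at most
  \<open>c - 1\<close>, so they leave a surplus of at least \<open>G\<close>. It pays for
  \<open>X\<close> further translates, which supply nothing and cost at most \<open>c - 1\<close>
  each; the second assumption says \<open>X * (c - 1) < G\<close> without a subtraction.\<close>

lemma spare_levels:
  fixes X G q c :: nat
  assumes "q < c" "X * c < X + G"
  shows "(X + G) * q < c * G"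
proof -
  have "(X + G) * Suc q \<le> (X + G) * c" using assms(1) by (intro mult_le_mono2) simp
  then have "(X + G) * q + X + G \<le> X * c + c * G" by (simp add: algebra_simps)
  then show ?thesis using assms(2) by linarith
qed

text \<open>Blocks start when the level function passes \<open>u b = b (n + 1 / B)\<close>. The fractional parts of the \<open>u b\<close>
  drift, so that an orbit passes within \<open>\<theta>\<close> of the gap between consecutive unit windows at most once in \<open>B\<close>
  consecutive blocks.\<close>

lemma block_after_visit:
  fixes n B :: nat and v \<theta> :: real
  defines "u \<equiv> \<lambda>b::nat. real b * (real n + 1 / real B)"
  assumes B: "B \<ge> 2" and n: "n \<ge> 1" and v: "v \<ge> 0" and \<theta>: "\<theta> = 1 / (2 * real B)"
  shows "\<exists>j::int. \<exists>b. 1 \<le> j \<and> j \<le> 3 * int (B * n + 1) \<and> u b \<le> v + real_of_int j \<and> v + \<theta> + real_of_int j \<le> u b + 1 - \<theta>"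
proof -
  \<comment> \<open>The advance of \<open>u\<close> over \<open>B\<close> consecutive blocks, an
    integer: \<open>u (b + B) = u b + N\<close>.\<close>
  define N where "N = real (B * n + 1)"
  have N: "N \<ge> 3" "N = real B * real n + 1"
  proof -
    have "2 * 1 \<le> B * n" using B n by (intro mult_le_mono) auto
    then show "N \<ge> 3" unfolding N_def by linarith
  qed (simp add: N_def)
  \<comment> \<open>\<open>B * E\<close> is the first multiple of \<open>B\<close> whose value under
    \<open>u\<close> lies beyond \<open>v\<close>; \<open>D\<close> is the distance still to
    go.\<close>
  define E where "E = nat (\<lfloor>v / N\<rfloor> + 1)"
  have "0 \<le> \<lfloor>v / N\<rfloor>" using v N by simp
  then have Er: "real E = of_int \<lfloor>v / N\<rfloor> + 1" by (simp add: E_def)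
  have "v / N < real E" "real E \<le> v / N + 1" unfolding Er by linarith+
  then have E: "v < real E * N" "real E * N \<le> v + N" using N by (auto simp: field_simps)
  have B0: "real B > 0" using B by simp
  have uB: "u (B * E + r) = real E * N + real r * (real n + 1 / real B)" for r
    unfolding u_def N(2) using B0 by (simp add: field_simps)
  define D where "D = real E * N - v"
  have D: "D > 0" "D \<le> N" using E by (auto simp: D_def)
  have nN: "real n + 1 \<le> N"
  proof -
    have "1 * n \<le> B * n" using B by (intro mult_le_mono1) simp
    then have "real n \<le> real (B * n)" by linarith
    then show ?thesis by (simp add: N_def)
  qed
  have iB: "1 / real B \<le> 1 / 2" "1 / real B > 0" using B by (auto simp: field_simps)
  have th: "2 * \<theta> = 1 / real B" using B0 by (simp add: \<theta>)
  have Nint: "real_of_int (3 * int (B * n + 1)) = 3 * N" by (simp add: N_def)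
  show ?thesis
  \<comment> \<open>After \<open>\<lceil>D\<rceil>\<close> steps the interval starts at offset
    \<open>\<lceil>D\<rceil> - D\<close> in the window, which has length \<open>1 - \<theta>\<close>
    and must hold an interval of length \<open>\<theta>\<close>. If the offset exceeds
    \<open>1 - 2 * \<theta>\<close>, the next block, which comes \<open>n + 1 / B\<close> later,
    lowers it by \<open>1 / B\<close> at the cost of \<open>n\<close> more steps.\<close>
  proof (cases "of_int \<lceil>D\<rceil> - D \<le> 1 - 1 / real B")
    case True
    have "1 \<le> \<lceil>D\<rceil>" using D(1) by linarith
    moreover have "of_int \<lceil>D\<rceil> \<le> 3 * N" using D N by linarith
    then have "\<lceil>D\<rceil> \<le> 3 * int (B * n + 1)" unfolding Nint[symmetric] by linarith
    moreover have "u (B * E + 0) = v + D" unfolding uB D_def by simp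
    moreover have "D \<le> of_int \<lceil>D\<rceil>" by linarith
    ultimately show ?thesis using True th by (intro exI[of _ "\<lceil>D\<rceil>"] exI[of _ "B * E + 0"]) linarith
  next
    case False
    define j where "j = \<lceil>D\<rceil> + int n"
    have jr: "of_int j = of_int \<lceil>D\<rceil> + real n" by (simp add: j_def)
    have "of_int \<lceil>D\<rceil> < D + 1" by linarith
    have "1 \<le> j" using D(1) unfolding j_def by linarith
    moreover have "of_int j \<le> 3 * N" using D N nN jr by linarith
    then have "j \<le> 3 * int (B * n + 1)" unfolding Nint[symmetric] by linarith
    moreover have "u (B * E + 1) = v + D + real n + 1 / real B" unfolding uB D_def by simp
    ultimately show ?thesis using False iB th jr \<open>of_int \<lceil>D\<rceil> < D + 1\<close>
      by (intro exI[of _ j] exI[of _ "B * E + 1"]) linarith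
  qed
qed

context compact_dynamics
begin

text \<open>A point of \<open>P\<close> starts a block of length \<open>n\<close>. Tower \<open>0\<close> has base \<open>P\<close> and uses the whole block except for
  three strips of length \<open>L\<close> at its end, which are left for the exceptional points. Tower \<open>1\<close> has as base the
  points in the gap between consecutive windows of the level function; it uses strip \<open>1\<close> of the next \<open>B - 1\<close>
  blocks. The towers \<open>i + 2\<close> start at the visits to \<open>W\<close>, sorted by the value of the level function so that the
  later blocks come at fixed times; they use strip \<open>2\<close> or \<open>3\<close> of \<open>g\<close> such blocks according to the parity of
  \<open>i\<close>, because neighbouring bases \<open>Wi i\<close> overlap. Since \<open>g\<close> and \<open>B\<close> are large, a surplus of levels remains
  although the handles are longer than the strips.\<close>

lemma coloured_towers_infinite:
  assumes min: "minimal_system mtopology act" and inf: "infinite M"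
    and q0: "q0 < k * L" and dim0: "cover_dim_le mtopology (small_on act \<U> {0..<int L}) q0"
  obtains \<A> :: "nat \<Rightarrow> 'a set set" and J :: "int set" where "finite J"
    "\<And>i. finite (\<A> i)" "\<And>i. disjoint (\<A> i)" "\<And>i. {} \<notin> \<A> i"
    "\<And>i A. i < k \<Longrightarrow> A \<in> \<A> i \<Longrightarrow> closedin mtopology A \<and> (\<exists>U\<in>\<U>. A \<subseteq> U)"
    "\<And>x. x \<in> M \<Longrightarrow> \<exists>i<k. \<exists>A\<in>\<A> i. \<exists>z\<in>J. act x z \<in> A \<and> small_on act \<U> {- z} A"
proof -
  define c where "c = k * L"
  \<comment> \<open>\<open>a\<close> counts the strips of length \<open>L\<close> in a block. The
    constants satisfy the surplus condition of \<open>spare_levels\<close> for the three types of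
    towers: \<open>X = 4\<close> and \<open>G = a - 3\<close> for tower 0, \<open>X = a + 1\<close>
    and \<open>G = B - 1\<close> for tower 1, \<open>X = B * a + a + 1\<close> and
    \<open>G = g\<close> for the others. Finally \<open>m\<close> exceeds every time used after a
    visit to \<open>W\<close>, including the block that starts then.\<close>
  define a where "a = 4 * c"
  define n where "n = a * L"
  define B where "B = (a + 1) * c + 1"
  define N where "N = B * n + 1"
  define g where "g = (B * a + a + 1) * c + 1"
  define m where "m = int (g * N + 4 * N + n + 2)"
  define \<theta> where "\<theta> = 1 / (2 * real B)"
  define u where "u b = real b * (real n + 1 / real B)" for b :: nat
  have "0 < k * L" using q0 by linarith
  then have c1: "c \<ge> 1" and L1: "L \<ge> 1" by (auto simp: c_def)
  have a4: "a \<ge> 4" using c1 by (simp add: a_def)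
  have an: "a \<le> n" unfolding n_def using L1 by simp
  have n1: "n \<ge> 1" using an a4 by simp
  have B2: "B \<ge> 2" unfolding B_def using c1 by simp
  have Br: "real B > 0" "1 / real B \<le> 1/2" "1 / real B > 0" using B2 by (auto simp: field_simps)
  have \<theta>: "\<theta> > 0" "2 * \<theta> = 1 / real B" "\<theta> \<le> 1/4" using Br by (auto simp: \<theta>_def field_simps)
  have u_add: "u (b + d) = u b + real d * real n + real d / real B" for b d
    unfolding u_def using Br(1) by (simp add: field_simps)
  have u_mono: "u b \<le> u b'" if "b \<le> b'" for b b' unfolding u_def using that by (intro mult_right_mono) auto
  have uB: "u (b + B * e) = u b + real (e * N)" for b e
    unfolding u_def N_def using Br(1) by (simp add: field_simps)
  have u_ge: "real b \<le> u b" for b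
  proof -
    have "1 \<le> real n + 1 / real B" using n1 Br(3) by linarith
    then have "real b * 1 \<le> u b" unfolding u_def by (intro mult_left_mono) auto
    then show ?thesis by simp
  qed
  obtain W Q0 and \<xi> :: "'a \<Rightarrow> real" and \<Xi> :: real where
    W: "closedin mtopology W" and Q0: "openin mtopology Q0" "Q0 \<subseteq> W"
    and Wm: "\<And>x s. x \<in> W \<Longrightarrow> 0 < s \<Longrightarrow> s < m \<Longrightarrow> act x s \<notin> W"
    and \<xi>c: "continuous_map mtopology euclideanreal \<xi>" and \<xi>b: "\<And>x. x \<in> M \<Longrightarrow> 0 \<le> \<xi> x \<and> \<xi> x \<le> \<Xi>"
    and \<xi>1: "\<And>x. x \<in> M \<Longrightarrow> act x 1 \<notin> Q0 \<Longrightarrow> \<xi> (act x 1) = \<xi> x + 1"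
    by (rule level_function[OF min inf, of m]) (rule that)
  have run: "\<xi> (act x (int j)) = \<xi> x + real j" if x: "x \<in> M" and free: "\<And>i. 1 \<le> i \<Longrightarrow> i \<le> int j \<Longrightarrow> act x i \<notin> Q0" for x j
    using free
  proof (induction j)
    case (Suc j)
    have "act (act x (int j)) 1 = act x (int (Suc j))" using x by (simp add: add.commute)
    moreover have "act x (int (Suc j)) \<notin> Q0" using Suc.prems[of "int (Suc j)"] by simp
    ultimately have "\<xi> (act x (int (Suc j))) = \<xi> (act x (int j)) + 1" using \<xi>1[of "act x (int j)"] x by simp
    also have "\<xi> (act x (int j)) = \<xi> x + real j" using Suc by simp
    finally show ?case by simp
  qed (use x in simp)
  have transfer: "y = act x (s - s')" if "x \<in> M" "y \<in> M" "act x s = act y s'" for x y s s'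
  proof -
    have "act (act x s) (- s') = act (act y s') (- s')" using that(3) by simp
    then show ?thesis using that(1,2) by simp
  qed
  \<comment> \<open>Freeness is a closed condition because \<open>Q0\<close> is open, while the
    bases over visits use the larger closed set \<open>W\<close>; in this way all bases are
    closed.\<close>
  define free where "free l = {x\<in>M. \<forall>i\<in>{1..l}. act x i \<notin> Q0}" for l :: int
  define P where "P = {x\<in>M. \<exists>b. u b \<le> \<xi> x \<and> \<xi> x \<le> u b + 1 - \<theta>} \<inter> free (int n)"
  define P1 where "P1 = {x\<in>M. \<exists>b. u b + 1 - \<theta> \<le> \<xi> x \<and> \<xi> x \<le> u b + 1} \<inter> free (int (B * n))"
  have PM: "x \<in> M" if "x \<in> P" for x using that by (simp add: P_def)
  have P1M: "x \<in> M" if "x \<in> P1" for x using that by (simp add: P1_def)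
  have cl_int: "closedin mtopology {x\<in>M. \<xi> x \<in> {l..h}}" for l h
    using closedin_continuous_map_preimage[OF \<xi>c, of "{l..h}"] by simp
  have cl_free: "closedin mtopology (free l)" for l
  proof -
    have "free l = M - (\<Union>i\<in>{1..l}. {x\<in>M. act x i \<in> Q0})" by (auto simp: free_def)
    moreover have "closedin mtopology (M - (\<Union>i\<in>{1..l}. {x\<in>M. act x i \<in> Q0}))"
      using closedin_topspace[of mtopology] openin_act_preimage[OF Q0(1)] by (intro closedin_diff openin_Union) auto
    ultimately show ?thesis by simp
  qed
  \<comment> \<open>Only finitely many \<open>b\<close> matter, since \<open>b \<le> u b\<close> and
    \<open>\<xi>\<close> is bounded; hence the union of the windows gives a closed set.\<close>
  have cl_ex: "closedin mtopology {x\<in>M. \<exists>b. u b + r \<le> \<xi> x \<and> \<xi> x \<le> u b + r'}" if "r \<ge> 0" for r r'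
  proof -
    have "{x\<in>M. \<exists>b. u b + r \<le> \<xi> x \<and> \<xi> x \<le> u b + r'} = (\<Union>b\<le>nat \<lceil>\<Xi>\<rceil>. {x\<in>M. \<xi> x \<in> {u b + r..u b + r'}})"
    proof (intro equalityI subsetI)
      fix x assume "x \<in> {x\<in>M. \<exists>b. u b + r \<le> \<xi> x \<and> \<xi> x \<le> u b + r'}"
      then obtain b where b: "x \<in> M" "u b + r \<le> \<xi> x" "\<xi> x \<le> u b + r'" by auto
      have "real b \<le> \<Xi>" using u_ge[of b] b(2) \<xi>b[OF b(1)] that by linarith
      then have "b \<le> nat \<lceil>\<Xi>\<rceil>" by linarith
      then show "x \<in> (\<Union>b\<le>nat \<lceil>\<Xi>\<rceil>. {x\<in>M. \<xi> x \<in> {u b + r..u b + r'}})" using b by auto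
    qed auto
    moreover have "closedin mtopology (\<Union>b\<le>nat \<lceil>\<Xi>\<rceil>. {x\<in>M. \<xi> x \<in> {u b + r..u b + r'}})"
      using cl_int by (intro closedin_Union) auto
    ultimately show ?thesis by simp
  qed
  have clP: "closedin mtopology P"
    unfolding P_def using cl_ex[of 0 "1 - \<theta>"] cl_free by (intro closedin_Int) (auto simp: algebra_simps)
  have clP1: "closedin mtopology P1"
    unfolding P1_def using cl_ex[of "1 - \<theta>" 1] \<theta>(3) cl_free by (intro closedin_Int) (auto simp: algebra_simps)
  \<comment> \<open>Blocks do not overlap. Two visits in one window would differ by a positive
    integer below 1; reaching a later window takes at least
    \<open>n + 1 / B - (1 - \<theta>)\<close>, which exceeds \<open>n - 1\<close>.\<close>
  have P_gap: False if x: "x \<in> P" and y: "act x s \<in> P" and s: "0 < s" "s < int n" for x s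
  proof -
    obtain b where b: "u b \<le> \<xi> x" "\<xi> x \<le> u b + 1 - \<theta>" using x by (auto simp: P_def)
    obtain b' where b': "u b' \<le> \<xi> (act x s)" "\<xi> (act x s) \<le> u b' + 1 - \<theta>" using y by (auto simp: P_def)
    have "\<xi> (act x (int (nat s))) = \<xi> x + real (nat s)"
      using x s by (intro run) (auto simp: P_def free_def)
    then have \<xi>s: "\<xi> (act x s) = \<xi> x + of_int s" using s by simp
    have "real_of_int s \<le> real_of_int (int n - 1)" using s unfolding of_int_le_iff by simp
    then have s1: "1 \<le> real_of_int s" "real_of_int s \<le> real n - 1" using s by simp_all
    show False
    proof (cases "b' \<le> b")
      case True
      then show ?thesis using u_mono[OF True] b b' \<xi>s s1 \<theta> by linarith
    next
      case False
      then have "u (b + 1) \<le> u b'" by (intro u_mono) simp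
      then have "u b + real n + 1 / real B \<le> u b'" using u_add[of b 1] by simp
      then show ?thesis using b b' \<xi>s s1 \<theta> Br by linarith
    qed
  qed
  \<comment> \<open>Starting in the gap, the position relative to the window of block
    \<open>b + d\<close> is lowered by \<open>d / B\<close>. For \<open>0 < d < B\<close> this lies
    between \<open>2 * \<theta>\<close> and \<open>1 - 2 * \<theta>\<close>: enough to leave the
    gap, too little to fall below the window.\<close>
  have P1_next: "act x (int (d * n)) \<in> P" if x: "x \<in> P1" and d: "1 \<le> d" "d < B" for x d
  proof -
    have "d * n + n \<le> B * n" using d by (metis add.commute mult_Suc mult_le_mono1 Suc_leI)
    then have dn: "int (d * n) + int n \<le> int (B * n)" by linarith
    have fr: "act x i \<notin> Q0" if "1 \<le> i" "i \<le> int (B * n)" for i using x that by (simp add: P1_def free_def)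
    obtain b where b: "u b + 1 - \<theta> \<le> \<xi> x" "\<xi> x \<le> u b + 1" using x by (auto simp: P1_def)
    have \<xi>d: "\<xi> (act x (int (d * n))) = \<xi> x + real (d * n)"
    proof (rule run[OF P1M[OF x]])
      fix i assume "1 \<le> i" "i \<le> int (d * n)"
      then show "act x i \<notin> Q0" using dn by (intro fr) linarith+
    qed
    have "real d + 1 \<le> real B" using d(2) by linarith
    then have "(real d + 1) / real B \<le> 1" using Br(1) by simp
    then have dB: "real d / real B + 2 * \<theta> \<le> 1" unfolding \<theta>(2) by (simp add: add_divide_distrib)
    have "1 / real B \<le> real d / real B" using d(1) by (intro divide_right_mono) auto
    then have "u (b + d) \<le> \<xi> (act x (int (d * n)))" "\<xi> (act x (int (d * n))) \<le> u (b + d) + 1 - \<theta>"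
      using dB b \<theta> unfolding \<xi>d u_add by (simp_all add: )
    moreover have "act x (int (d * n)) \<in> free (int n)"
    proof -
      have "act (act x (int (d * n))) i \<notin> Q0" if "i \<in> {1..int n}" for i
      proof -
        have "1 \<le> i" "i \<le> int n" using that by auto
        then have "1 \<le> int (d * n) + i" "int (d * n) + i \<le> int (B * n)" using dn by linarith+
        then show ?thesis unfolding act_act[OF P1M[OF x]] by (rule fr)
      qed
      then show ?thesis unfolding free_def using P1M[OF x] by simp
    qed
    ultimately show ?thesis unfolding P_def using P1M[OF x] by auto
  qed
  \<comment> \<open>Gaps recur only after \<open>B\<close> blocks: for \<open>0 < d < B\<close> the
    travelling time minus \<open>d * n\<close> would be an integer strictly between 0 and 1.\<close>
  have P1_gap: False if x: "x \<in> P1" and y: "act x s \<in> P1" and s: "0 < s" "s < int (B * n)" for x s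
  proof -
    obtain b where b: "u b + 1 - \<theta> \<le> \<xi> x" "\<xi> x \<le> u b + 1" using x by (auto simp: P1_def)
    obtain b' where b': "u b' + 1 - \<theta> \<le> \<xi> (act x s)" "\<xi> (act x s) \<le> u b' + 1" using y by (auto simp: P1_def)
    have "\<xi> (act x (int (nat s))) = \<xi> x + real (nat s)"
      using x s by (intro run) (auto simp: P1_def free_def)
    then have \<xi>s: "\<xi> (act x s) = \<xi> x + of_int s" using s by simp
    have "real_of_int s \<le> real_of_int (int (B * n))" using s unfolding of_int_le_iff by simp
    then have s1: "1 \<le> real_of_int s" "real_of_int s \<le> real (B * n)" using s by simp_all
    consider "b' \<le> b" | "b + B \<le> b'" | d where "b' = b + d" "1 \<le> d" "d < B"
    proof -
      have "b' \<le> b \<or> b + B \<le> b' \<or> (b' = b + (b' - b) \<and> 1 \<le> b' - b \<and> b' - b < B)" by linarith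
      then show thesis using that by metis
    qed
    then show False
    proof cases
      case 1
      then show ?thesis using u_mono[OF 1] b b' \<xi>s s1 \<theta> by linarith
    next
      case 2
      have "u b + real (1 * N) \<le> u b'" using u_mono[OF 2] uB[of b 1] by simp
      then show ?thesis using b b' \<xi>s s1 \<theta> by (simp add: N_def)
    next
      case 3
      have "real d + 1 \<le> real B" using 3 by linarith
      then have "(real d + 1) / real B \<le> 1" using Br(1) by simp
      then have dB: "real d / real B + 2 * \<theta> \<le> 1" unfolding \<theta>(2) by (simp add: add_divide_distrib)
      have "1 / real B \<le> real d / real B" using 3 by (intro divide_right_mono) auto
      then have dB': "2 * \<theta> \<le> real d / real B" unfolding \<theta>(2) .
      define t where "t = s - int d * int n"
      have "of_int t = of_int s - real d * real n" by (simp add: t_def)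
      then have "0 < real_of_int t" "real_of_int t < 1"
        using dB dB' b b' \<xi>s \<theta> unfolding 3 u_add by linarith+
      then have "0 < t" "t < 1" by simp_all
      then show False by linarith
    qed
  qed
  define bound where "bound = nat \<lceil>\<Xi> / \<theta>\<rceil> + 1"
  \<comment> \<open>Slices of \<open>W\<close> on which the level function varies by at most
    \<open>\<theta>\<close>, so that one waiting time \<open>jj i\<close> serves the entire slice;
    \<open>bound\<close> slices reach up to \<open>\<Xi>\<close>.\<close>
  define Wi where "Wi i = W \<inter> {x\<in>M. \<xi> x \<in> {real i * \<theta>..real i * \<theta> + \<theta>}}" for i
  have "\<exists>j::int. \<exists>b. 1 \<le> j \<and> j \<le> 3 * int N \<and> u b \<le> real i * \<theta> + of_int j \<and> real i * \<theta> + \<theta> + of_int j \<le> u b + 1 - \<theta>" for i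
    unfolding N_def u_def using \<theta>(1) by (intro block_after_visit B2 n1 \<theta>_def) auto
  then obtain jj :: "nat \<Rightarrow> int" and bb where jj: "\<And>i. 1 \<le> jj i \<and> jj i \<le> 3 * int N \<and> u (bb i) \<le> real i * \<theta> + of_int (jj i) \<and>
      real i * \<theta> + \<theta> + of_int (jj i) \<le> u (bb i) + 1 - \<theta>" by metis
  have time_bound: "jj i + int (e * N) + int n < m" if "e < g" for i e
  proof -
    have "e * N \<le> g * N" using that by (intro mult_le_mono1) simp
    then have "int (e * N) \<le> int (g * N)" by (simp only: of_nat_le_iff)
    then show ?thesis using jj[of i] unfolding m_def by linarith
  qed
  \<comment> \<open>After the wait, every \<open>N\<close> further steps lead to the same position
    in a window, because \<open>u\<close> advances by the integer \<open>N\<close> over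
    \<open>B\<close> blocks. No visit to \<open>Q0\<close> before time \<open>m\<close> disturbs the
    counting.\<close>
  have W_next: "act x (jj i + int (e * N)) \<in> P" if x: "x \<in> Wi i" and e: "e < g" for x i e
  proof -
    have xW: "x \<in> W" "x \<in> M" and xi: "real i * \<theta> \<le> \<xi> x" "\<xi> x \<le> real i * \<theta> + \<theta>" using x by (auto simp: Wi_def)
    define s where "s = jj i + int (e * N)"
    have "0 \<le> int (e * N)" by simp
    then have s: "1 \<le> s" "s + int n < m" using jj[of i] time_bound[OF e, of i] unfolding s_def by linarith+
    have fr: "act x t \<notin> Q0" if "1 \<le> t" "t < m" for t using Wm[OF xW(1), of t] that Q0(2) by auto
    have "\<xi> (act x (int (nat s))) = \<xi> x + real (nat s)" using xW(2) fr s by (intro run) auto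
    then have \<xi>s: "\<xi> (act x s) = \<xi> x + of_int (jj i) + real (e * N)" using s by (simp add: s_def)
    have "u (bb i + B * e) \<le> \<xi> (act x s)" "\<xi> (act x s) \<le> u (bb i + B * e) + 1 - \<theta>"
      unfolding \<xi>s uB using jj[of i] xi by linarith+
    moreover have "act x s \<in> free (int n)" unfolding free_def using xW(2) fr s by auto
    ultimately show ?thesis unfolding P_def s_def[symmetric] using xW(2) by auto
  qed
  note of_nat_mult [simp del]
  \<comment> \<open>\<open>slack r\<close> is the \<open>r\<close>-th strip counted from the end of
    the block; \<open>rng\<close> lists the four pairwise disjoint parts of a block, one for each
    kind of tower.\<close>
  define slack where "slack r = {int ((a - r) * L)..<int ((a - r) * L) + int L}" for r
  have slack_sub: "slack r \<subseteq> {0..<int n}" if "1 \<le> r" "r \<le> 3" for r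
  proof -
    have "(a - r) * L + L = (a - r + 1) * L" by simp
    also have "\<dots> \<le> a * L" using that a4 by (intro mult_le_mono1) simp
    finally have "int ((a - r) * L) + int L \<le> int n" unfolding n_def by linarith
    then show ?thesis unfolding slack_def by auto
  qed
  define rng where "rng r = (if r = 0 then {0..<int ((a - 3) * L)} else slack r)" for r
  have rng_sub: "rng r \<subseteq> {0..<int n}" if "r \<le> 3" for r
  proof (cases "r = 0")
    case True
    have "(a - 3) * L \<le> n" unfolding n_def by simp
    then have "int ((a - 3) * L) \<le> int n" by (simp only: of_nat_le_iff)
    then show ?thesis using True unfolding rng_def by auto
  next
    case False
    then show ?thesis using slack_sub[of r] that by (simp add: rng_def)
  qed
  have rng_disj: "r = r'" if "\<tau> \<in> rng r" "\<tau> \<in> rng r'" "r \<le> 3" "r' \<le> 3" for \<tau> r r'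
  proof -
    have below: False if "\<tau> \<in> rng p" "\<tau> \<in> slack p'" "p' < p \<or> p = 0" "p \<le> 3" "1 \<le> p'" "p' \<le> 3" for p p'
    proof (cases "p = 0")
      case True
      have "(a - 3) * L \<le> (a - p') * L" using that a4 by (intro mult_le_mono1) simp
      then have "int ((a - 3) * L) \<le> int ((a - p') * L)" by (simp only: of_nat_le_iff)
      moreover have "\<tau> < int ((a - 3) * L)" "int ((a - p') * L) \<le> \<tau>"
        using that True by (simp_all add: rng_def slack_def)
      ultimately show False by linarith
    next
      case False
      have "(a - p) * L + L = (a - p + 1) * L" by simp
      also have "\<dots> \<le> (a - p') * L" using that a4 False by (intro mult_le_mono1) simp
      finally have "int ((a - p) * L) + int L \<le> int ((a - p') * L)" by linarith
      moreover have "\<tau> < int ((a - p) * L) + int L" "int ((a - p') * L) \<le> \<tau>"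
        using that False by (simp_all add: rng_def slack_def)
      ultimately show False by linarith
    qed
    show ?thesis
    proof (rule ccontr)
      assume "r \<noteq> r'"
      then consider "r' \<noteq> 0" "r' < r \<or> r = 0" | "r \<noteq> 0" "r < r' \<or> r' = 0" by linarith
      then show False
      proof cases
        case 1
        then show False using below[of r r'] that by (simp add: rng_def)
      next
        case 2
        then show False using below[of r' r] that by (simp add: rng_def)
      qed
    qed
  qed
  define kind where "kind t = (if t < 2 then t else 2 + t mod 2)" for t :: nat
  have kind3: "kind t \<le> 3" for t unfolding kind_def by (simp; linarith)
  define T where "T = {..<bound + 2}"
  define Q where "Q t = (if t = 0 then P else if t = 1 then P1 else Wi (t - 2))" for t :: nat
  define S where "S t = (if t = 0 then rng 0 else if t = 1 then (\<Union>e\<in>{1..<B}. (+) (int (e * n)) ` slack 1)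
    else (\<Union>e\<in>{..<g}. (+) (jj (t - 2) + int (e * N)) ` slack (kind t)))" for t
  \<comment> \<open>Consecutive windows are \<open>n + 1 / B\<close> apart, so the time elapsed in a
    block can equal \<open>n\<close>; hence the inclusive bound. An exceptional point visits
    \<open>Q0\<close> at a time between \<open>- n\<close> and \<open>B * n\<close>; seen from the
    visit it is at a level between \<open>- (B * n)\<close> and \<open>n\<close>. \<open>R t\<close>
    lists the starts of intervals of length \<open>L\<close> that cover \<open>H t\<close>.\<close>
  define H where "H t = (if t = 0 then {0..int n} else if t = 1 then {0..int n} \<union> S 1 else {- int (B * n)..int n} \<union> S t)" for t
  define R where "R t = (if t = 0 then (\<lambda>r. int r * int L) ` {..a}
    else if t = 1 then (\<lambda>r. int r * int L) ` {..a} \<union> (\<lambda>e. int (e * n) + int ((a - 1) * L)) ` {1..<B}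
    else (\<lambda>r. r * int L) ` {- int (B * a)..int a} \<union> (\<lambda>e. jj (t - 2) + int (e * N) + int ((a - kind t) * L)) ` {..<g})" for t
  have finR: "finite (R t)" for t by (simp add: R_def)
  have slack_shift: "(+) z ` slack r = (+) (z + int ((a - r) * L)) ` {0..<int L}" for z r
    unfolding slack_def by (auto simp: image_iff intro!: bexI[of _ "_ - int ((a - r) * L)"])
  have HR0: "{0..int n} \<subseteq> (\<Union>r\<in>(\<lambda>r. int r * int L) ` {..a}. (+) r ` {0..<int L})"
  proof
    fix z assume z: "z \<in> {0..int n}"
    have "z div int L \<le> int n div int L" using z L1 by (intro zdiv_mono1) auto
    also have "int n div int L = int a" using L1 by (simp add: n_def of_nat_mult)
    finally have "nat (z div int L) \<in> {..a}" by simp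
    have "0 \<le> z div int L" using z L1 by (simp add: pos_imp_zdiv_nonneg_iff)
    then have z_eq: "z = int (nat (z div int L)) * int L + z mod int L" by simp
    have "z mod int L \<in> {0..<int L}" using L1 by simp
    then have "z \<in> (+) (int (nat (z div int L)) * int L) ` {0..<int L}"
      by (rule rev_image_eqI) (rule z_eq)
    then show "z \<in> (\<Union>r\<in>(\<lambda>r. int r * int L) ` {..a}. (+) r ` {0..<int L})"
      by (rule UN_I[OF imageI[OF \<open>nat (z div int L) \<in> {..a}\<close>]])
  qed
  have HR2: "{- int (B * n)..int n} \<subseteq> (\<Union>r\<in>(\<lambda>r. r * int L) ` {- int (B * a)..int a}. (+) r ` {0..<int L})"
  proof
    fix z assume z: "z \<in> {- int (B * n)..int n}"
    have "z div int L \<le> int n div int L" using z L1 by (intro zdiv_mono1) auto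
    also have "int n div int L = int a" using L1 by (simp add: n_def of_nat_mult)
    finally have "z div int L \<le> int a" .
    moreover have "(- int (B * a) * int L) div int L \<le> z div int L"
      using z L1 by (intro zdiv_mono1) (auto simp: n_def of_nat_mult algebra_simps)
    moreover have "(- int (B * a) * int L) div int L = - int (B * a)"
      using L1 by (intro nonzero_mult_div_cancel_right) simp
    ultimately have q: "z div int L \<in> {- int (B * a)..int a}" by simp
    have z_eq: "z = (z div int L) * int L + z mod int L" by simp
    have "z mod int L \<in> {0..<int L}" using L1 by simp
    then have "z \<in> (+) ((z div int L) * int L) ` {0..<int L}"
      by (rule rev_image_eqI) (rule z_eq)
    then show "z \<in> (\<Union>r\<in>(\<lambda>r. r * int L) ` {- int (B * a)..int a}. (+) r ` {0..<int L})"
      by (rule UN_I[OF imageI[OF q]])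
  qed
  have S1R: "S 1 \<subseteq> (\<Union>r\<in>(\<lambda>e. int (e * n) + int ((a - 1) * L)) ` {1..<B}. (+) r ` {0..<int L})"
    unfolding S_def slack_shift by auto
  have StR: "S t \<subseteq> (\<Union>r\<in>(\<lambda>e. jj (t - 2) + int (e * N) + int ((a - kind t) * L)) ` {..<g}. (+) r ` {0..<int L})" if "t \<ge> 2" for t
    unfolding S_def slack_shift using that by auto
  have HR: "H t \<subseteq> (\<Union>r\<in>R t. (+) r ` {0..<int L})" for t
  proof -
    consider "t = 0" | "t = 1" | "t \<ge> 2" by linarith
    then show ?thesis
    proof cases
      case 1
      then show ?thesis unfolding H_def R_def using HR0 by simp
    next
      case 2
      have "{0..int n} \<union> S 1 \<subseteq> (\<Union>r\<in>(\<lambda>r. int r * int L) ` {..a} \<union> (\<lambda>e. int (e * n) + int ((a - 1) * L)) ` {1..<B}. (+) r ` {0..<int L})"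
        unfolding UN_Un by (rule Un_mono[OF HR0 S1R])
      then show ?thesis unfolding H_def R_def 2 by simp
    next
      case 3
      have "{- int (B * n)..int n} \<union> S t \<subseteq> (\<Union>r\<in>(\<lambda>r. r * int L) ` {- int (B * a)..int a} \<union> (\<lambda>e. jj (t - 2) + int (e * N) + int ((a - kind t) * L)) ` {..<g}. (+) r ` {0..<int L})"
        unfolding UN_Un by (rule Un_mono[OF HR2 StR[OF 3]])
      then show ?thesis unfolding H_def R_def using 3 by simp
    qed
  qed
  have card_slack: "card (slack r) = L" for r by (simp add: slack_def)
  have cardS: "card (R t) * q0 < k * card (S t)" for t
  proof -
    consider "t = 0" | "t = 1" | "t \<ge> 2" by linarith
    then show ?thesis
    proof cases
      case 1
      \<comment> \<open>There are \<open>a + 1\<close> intervals: \<open>a - 3\<close> that carry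
        colours, three for the strips kept back and one for the level \<open>n\<close>.\<close>
      have "card (R t) \<le> 4 + (a - 3)"
        unfolding R_def using 1 card_image_le[of "{..a}" "\<lambda>r. int r * int L"] a4 by simp
      then have "card (R t) * q0 \<le> (4 + (a - 3)) * q0" by (rule mult_le_mono1)
      also have "\<dots> < c * (a - 3)" using q0 a4 by (intro spare_levels) (auto simp: c_def a_def)
      also have "\<dots> = k * card (S t)" unfolding S_def rng_def using 1 by (simp add: c_def)
      finally show ?thesis .
    next
      case 2
      have "card (R t) \<le> card ((\<lambda>r. int r * int L) ` {..a}) + card ((\<lambda>e. int (e * n) + int ((a - 1) * L)) ` {1..<B})"
        unfolding R_def using 2 by (simp add: card_Un_le)
      also have "\<dots> \<le> (a + 1) + (B - 1)"
        using card_image_le[of "{..a}" "\<lambda>r. int r * int L"] card_image_le[of "{1..<B}" "\<lambda>e. int (e * n) + int ((a - 1) * L)"]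
        by simp
      finally have "card (R t) * q0 \<le> ((a + 1) + (B - 1)) * q0" by (rule mult_le_mono1)
      also have "\<dots> < c * (B - 1)"
        using q0 B2 by (intro spare_levels) (auto simp: c_def[symmetric] B_def)
      also have "\<dots> = k * ((B - 1) * L)" by (simp add: c_def)
      also have "(B - 1) * L = card (S t)"
      proof -
        have "card (\<Union>e\<in>{1..<B}. (+) (int (e * n)) ` slack 1) = card {1..<B} * card (slack 1)"
        proof (rule card_separated_shifts[OF _ slack_sub])
          fix e e' :: nat assume "e < e'"
          then have "(e + 1) * n \<le> e' * n" by (intro mult_le_mono1) simp
          then have "e * n + n \<le> e' * n" by simp
          then show "int (e * n) + int n \<le> int (e' * n)" by linarith
        qed auto
        then show ?thesis unfolding S_def using 2 by (simp add: card_slack)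
      qed
      finally show ?thesis .
    next
      case 3
      have "card (R t) \<le> card ((\<lambda>r. r * int L) ` {- int (B * a)..int a}) + card ((\<lambda>e. jj (t - 2) + int (e * N) + int ((a - kind t) * L)) ` {..<g})"
        unfolding R_def using 3 by (simp add: card_Un_le)
      also have "\<dots> \<le> (B * a + a + 1) + g"
      proof (rule add_mono)
        have "card ((\<lambda>r. r * int L) ` {- int (B * a)..int a}) \<le> card {- int (B * a)..int a}" by (intro card_image_le) simp
        also have "\<dots> = nat (int (B * a + a + 1))" by (simp add: of_nat_mult algebra_simps)
        finally show "card ((\<lambda>r. r * int L) ` {- int (B * a)..int a}) \<le> B * a + a + 1" by simp
        show "card ((\<lambda>e. jj (t - 2) + int (e * N) + int ((a - kind t) * L)) ` {..<g}) \<le> g"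
          using card_image_le[of "{..<g}" "\<lambda>e. jj (t - 2) + int (e * N) + int ((a - kind t) * L)"] by simp
      qed
      finally have "card (R t) * q0 \<le> ((B * a + a + 1) + g) * q0" by (rule mult_le_mono1)
      also have "\<dots> < c * g"
        using q0 by (intro spare_levels) (auto simp: c_def[symmetric] g_def)
      also have "\<dots> = k * (g * L)" by (simp add: c_def)
      also have "g * L = card (S t)"
      proof -
        have k13: "1 \<le> kind t" using 3 by (simp add: kind_def)
        have "card (\<Union>e\<in>{..<g}. (+) (jj (t - 2) + int (e * N)) ` slack (kind t)) = card {..<g} * card (slack (kind t))"
        proof (rule card_separated_shifts[OF _ slack_sub])
          fix e e' :: nat assume "e < e'"
          then have "(e + 1) * N \<le> e' * N" by (intro mult_le_mono1) simp
          then have "e * N + N \<le> e' * N" by simp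
          moreover have "n \<le> N" unfolding N_def using B2 by (simp add: le_SucI)
          ultimately show "jj (t - 2) + int (e * N) + int n \<le> jj (t - 2) + int (e' * N)" by linarith
        qed (use k13 kind3 in auto)
        then show ?thesis unfolding S_def using 3 by (simp add: card_slack)
      qed
      finally show ?thesis .
    qed
  qed
  have Qcl: "closedin mtopology (Q t)" for t
    unfolding Q_def using clP clP1 W cl_int by (auto simp: Wi_def intro!: closedin_Int)
  have QM: "x \<in> M" if "x \<in> Q t" for x t using closedin_subset[OF Qcl] that by auto
  have finS: "finite (S t)" for t unfolding S_def rng_def slack_def by auto
  \<comment> \<open>Every coloured level of every tower is a position \<open>\<tau>\<close> in a
    block started at a point of \<open>P\<close>, with \<open>\<tau>\<close> in the part reserved
    for the kind of the tower. Disjointness of the levels is reduced to this.\<close>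
  have dec: "\<exists>p\<in>P. \<exists>\<tau>\<in>rng (kind t). act x s = act p \<tau> \<and> (t = 1 \<longrightarrow> (\<exists>e\<in>{1..<B}. s = int (e * n) + \<tau>)) \<and>
      (t \<ge> 2 \<longrightarrow> 0 < s \<and> s < m)" if s: "s \<in> S t" and x: "x \<in> Q t" for t s x
  proof -
    consider "t = 0" | "t = 1" | "t \<ge> 2" by linarith
    then show ?thesis
    proof cases
      case 1
      then show ?thesis using s x by (intro bexI[of _ x] bexI[of _ s]) (auto simp: S_def Q_def kind_def)
    next
      case 2
      then obtain e \<tau> where e: "e \<in> {1..<B}" "\<tau> \<in> slack 1" "s = int (e * n) + \<tau>" using s by (auto simp: S_def)
      have xP: "x \<in> P1" using x 2 by (simp add: Q_def)
      have "act x (int (e * n)) \<in> P" using P1_next[OF xP] e(1) by simp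
      moreover have "\<tau> \<in> rng (kind t)" using e(2) 2 by (simp add: kind_def rng_def)
      moreover have "act x s = act (act x (int (e * n))) \<tau>" using P1M[OF xP] e(3) by simp
      ultimately show ?thesis using 2 e(1,3) by (intro bexI[of _ "act x (int (e * n))"] bexI[of _ \<tau>]) auto
    next
      case 3
      then obtain e \<tau> where e: "e < g" "\<tau> \<in> slack (kind t)" "s = jj (t - 2) + int (e * N) + \<tau>" using s by (auto simp: S_def)
      have xP: "x \<in> Wi (t - 2)" using x 3 by (simp add: Q_def)
      have k13: "1 \<le> kind t" using 3 by (simp add: kind_def)
      have "\<tau> \<in> {0..<int n}" using slack_sub[OF k13 kind3] e(2) by blast
      then have "0 < s \<and> s < m" using jj[of "t - 2"] time_bound[OF e(1), of "t - 2"] e(3) by simp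
      moreover have "act x (jj (t - 2) + int (e * N)) \<in> P" using W_next[OF xP e(1)] .
      moreover have "\<tau> \<in> rng (kind t)" using e(2) k13 by (simp add: rng_def)
      moreover have "act x s = act (act x (jj (t - 2) + int (e * N))) \<tau>" using QM[OF x] e(3) by simp
      ultimately show ?thesis using 3 by (intro bexI[of _ "act x (jj (t - 2) + int (e * N))"] bexI[of _ \<tau>]) auto
    qed
  qed
  have disj: "t = t' \<and> s = s'"
    if st: "s \<in> S t" "s' \<in> S t'" and xy: "x \<in> Q t" "y \<in> Q t'" and eq: "act x s = act y s'" for t t' s s' x y
  proof -
    obtain p \<tau> where p: "p \<in> P" "\<tau> \<in> rng (kind t)" "act x s = act p \<tau>" "t = 1 \<longrightarrow> (\<exists>e\<in>{1..<B}. s = int (e * n) + \<tau>)"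
      "t \<ge> 2 \<longrightarrow> 0 < s \<and> s < m" using dec[OF st(1) xy(1)] by blast
    obtain p' \<tau>' where p': "p' \<in> P" "\<tau>' \<in> rng (kind t')" "act y s' = act p' \<tau>'" "t' = 1 \<longrightarrow> (\<exists>e\<in>{1..<B}. s' = int (e * n) + \<tau>')"
      "t' \<ge> 2 \<longrightarrow> 0 < s' \<and> s' < m" using dec[OF st(2) xy(2)] by blast
    have pp: "act p \<tau> = act p' \<tau>'" using p(3) p'(3) eq by simp
    have tn: "0 \<le> \<tau>" "\<tau> < int n" "0 \<le> \<tau>'" "\<tau>' < int n"
      using rng_sub[OF kind3] p(2) p'(2) by fastforce+
    \<comment> \<open>Different positions of one point in two blocks would give two block starts
      less than \<open>n\<close> apart.\<close>
    have \<tau>: "\<tau> = \<tau>'"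
    proof (rule ccontr)
      assume "\<tau> \<noteq> \<tau>'"
      then consider "\<tau>' < \<tau>" | "\<tau> < \<tau>'" by linarith
      then show False
      proof cases
        case 1
        have "p' = act p (\<tau> - \<tau>')" using transfer[OF PM[OF p(1)] PM[OF p'(1)] pp] .
        then show False using P_gap[OF p(1), of "\<tau> - \<tau>'"] p'(1) 1 tn by simp
      next
        case 2
        have "p = act p' (\<tau>' - \<tau>)" using transfer[OF PM[OF p'(1)] PM[OF p(1)] pp[symmetric]] .
        then show False using P_gap[OF p'(1), of "\<tau>' - \<tau>"] p(1) 2 tn by simp
      qed
    qed
    have kk: "kind t = kind t'" using rng_disj[of \<tau> "kind t" "kind t'"] p(2) p'(2) \<tau> kind3 by simp
    have xM: "x \<in> M" "y \<in> M" using QM xy by auto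
    have xy': "y = act x (s - s')" "x = act y (s' - s)" using transfer[OF xM eq] transfer[OF xM(2,1) eq[symmetric]] by auto
    \<comment> \<open>Equal kinds leave three cases, settled by the return times to
      \<open>P\<close>, \<open>P1\<close> and \<open>W\<close>.\<close>
    consider "t = 0" "t' = 0" | "t = 1" "t' = 1" | "t \<ge> 2" "t' \<ge> 2" "t mod 2 = t' mod 2"
      using kk unfolding kind_def by (cases "t < 2"; cases "t' < 2") (auto simp: less_2_cases_iff)
    then show ?thesis
    proof cases
      case 1
      then have "s \<in> rng 0" "s' \<in> rng 0" using st by (auto simp: S_def)
      then have ss: "0 \<le> s" "s < int n" "0 \<le> s'" "s' < int n" using rng_sub[of 0] by fastforce+
      have "s = s'"
      proof (rule ccontr)
        assume "s \<noteq> s'"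
        then consider "s' < s" | "s < s'" by linarith
        then show False
        proof cases
          case a: 1
          then show False using P_gap[of x "s - s'"] xy xy'(1) ss 1 by (simp add: Q_def)
        next
          case 2
          then show False using P_gap[of y "s' - s"] xy xy'(2) ss 1 by (simp add: Q_def)
        qed
      qed
      then show ?thesis using 1 by simp
    next
      case 2
      obtain e e' where e: "e \<in> {1..<B}" "s = int (e * n) + \<tau>" "e' \<in> {1..<B}" "s' = int (e' * n) + \<tau>'" using p(4) p'(4) 2 by blast
      have lt: "int (r * n) - int (r' * n) < int (B * n)" if "r < B" for r r'
      proof -
        have "r * n < B * n" using that n1 by simp
        then show ?thesis by linarith
      qed
      have "s = s'"
      proof (rule ccontr)
        assume "s \<noteq> s'"
        then consider "s' < s" | "s < s'" by linarith
        then show False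
        proof cases
          case 1
          then show False using P1_gap[of x "s - s'"] xy xy'(1) 2 e \<tau> lt[of e e'] by (simp add: Q_def)
        next
          case b: 2
          then show False using P1_gap[of y "s' - s"] xy xy'(2) 2 e \<tau> lt[of e' e] by (simp add: Q_def)
        qed
      qed
      then show ?thesis using 2 by simp
    next
      case 3
      have ss: "0 < s" "s < m" "0 < s'" "s' < m" using p(5) p'(5) 3 by auto
      have W2: "x \<in> Wi (t - 2)" "y \<in> Wi (t' - 2)" using xy 3 by (auto simp: Q_def)
      then have W3: "x \<in> W" "y \<in> W" by (auto simp: Wi_def)
      have s: "s = s'"
      proof (rule ccontr)
        assume "s \<noteq> s'"
        then consider "s' < s" | "s < s'" by linarith
        then show False
        proof cases
          case 1
          then show False using Wm[OF W3(1), of "s - s'"] W3(2) xy'(1) ss by simp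
        next
          case 2
          then show False using Wm[OF W3(2), of "s' - s"] W3(1) xy'(2) ss by simp
        qed
      qed
      then have "y = x" using xy'(1) xM(1) by simp
      \<comment> \<open>The common base point lies in both slices, so their indices differ by at
        most 1; equal parity then makes them equal.\<close>
      then have "real (t - 2) * \<theta> \<le> real (t' - 2) * \<theta> + \<theta>" "real (t' - 2) * \<theta> \<le> real (t - 2) * \<theta> + \<theta>"
        using W2 by (auto simp: Wi_def)
      then have "real (t - 2) * \<theta> \<le> (real (t' - 2) + 1) * \<theta>" "real (t' - 2) * \<theta> \<le> (real (t - 2) + 1) * \<theta>"
        by (simp_all add: algebra_simps)
      then have "real (t - 2) \<le> real (t' - 2) + 1" "real (t' - 2) \<le> real (t - 2) + 1"
        using \<theta>(1) by (simp_all only: mult_le_cancel_right_pos)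
      then have "t \<le> t' + 1" "t' \<le> t + 1" using 3 by linarith+
      then have "t = t'" using 3(3) by presburger
      then show ?thesis using s by simp
    qed
  qed
  have cov: "\<exists>t\<in>T. \<exists>j\<in>H t. act x (- j) \<in> Q t" if x: "x \<in> M" for x
  proof (cases "\<exists>j\<in>{- int n..int (B * n)}. act x j \<in> Q0")
    case True
    then obtain j where "j \<in> {- int n..int (B * n)}" "act x j \<in> Q0" by (rule bexE)
    then have j: "- int n \<le> j" "j \<le> int (B * n)" "act x j \<in> W" using Q0(2) by auto
    define w where "w = act x j"
    have wM: "w \<in> M" using x by (simp add: w_def)
    define i where "i = nat \<lfloor>\<xi> w / \<theta>\<rfloor>"
    have "0 \<le> \<xi> w / \<theta>" using \<xi>b[OF wM] \<theta>(1) by simp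
    then have "real i \<le> \<xi> w / \<theta>" "\<xi> w / \<theta> \<le> real i + 1" unfolding i_def by linarith+
    then have "real i * \<theta> \<le> \<xi> w" "\<xi> w \<le> real i * \<theta> + \<theta>" using \<theta>(1) by (simp_all add: field_simps)
    then have "w \<in> Wi i" using j(3) wM by (simp add: Wi_def w_def)
    moreover have "i < bound"
    proof -
      have "\<xi> w / \<theta> \<le> \<Xi> / \<theta>" using \<xi>b[OF wM] \<theta>(1) by (simp add: divide_right_mono)
      then show ?thesis using \<open>real i \<le> \<xi> w / \<theta>\<close> unfolding bound_def by linarith
    qed
    moreover have "- j \<in> H (i + 2)" using j by (simp add: H_def)
    ultimately show ?thesis
      by (intro bexI[of _ "i + 2"] bexI[of _ "- j"]) (auto simp: Q_def T_def w_def)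
  next
    case False
    then have fr: "act x j \<notin> Q0" if "- int n \<le> j" "j \<le> int (B * n)" for j using that by auto
    define w where "w = real n + 1 / real B"
    have w1: "w \<ge> 1" using n1 Br(3) unfolding w_def by linarith
    \<comment> \<open>\<open>b\<close> is the block containing the value of \<open>\<xi>\<close> and
      \<open>j\<close> the whole number of steps since its start; going back \<open>j\<close> steps
      lands in the unit window, that is in \<open>P\<close> or in the gap \<open>P1\<close>.\<close>
    define b where "b = nat \<lfloor>\<xi> x / w\<rfloor>"
    have "0 \<le> \<xi> x / w" using \<xi>b[OF x] w1 by simp
    then have "real b \<le> \<xi> x / w" "\<xi> x / w < real b + 1" unfolding b_def by linarith+
    then have b: "u b \<le> \<xi> x" "\<xi> x < u b + w" using w1 unfolding u_def w_def[symmetric] by (simp_all add: field_simps)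
    define j where "j = nat \<lfloor>\<xi> x - u b\<rfloor>"
    have j: "real j \<le> \<xi> x - u b" "\<xi> x - u b < real j + 1" unfolding j_def using b by linarith+
    then have "real j < real n + 1" using b Br(2) unfolding w_def by linarith
    then have jn: "j \<le> n" by linarith
    define y where "y = act x (- int j)"
    have y: "y \<in> M" "act y z = act x (z - int j)" for z using x by (simp_all add: y_def)
    have "\<xi> (act y (int j)) = \<xi> y + real j"
    proof (rule run[OF y(1)])
      fix i assume "1 \<le> i" "i \<le> int j"
      then show "act y i \<notin> Q0" unfolding y(2) using jn by (intro fr) auto
    qed
    then have \<xi>y: "\<xi> y = \<xi> x - real j" using y(2)[of "int j"] x by simp
    have "act y i \<notin> Q0" if "1 \<le> i" "i \<le> int (B * n)" for i
      unfolding y(2) using that jn by (intro fr) auto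
    then have fy: "y \<in> free (int (B * n))" using y(1) by (simp add: free_def)
    have "1 * n \<le> B * n" using B2 by (intro mult_le_mono1) simp
    then have "int n \<le> int (B * n)" by (simp only: of_nat_le_iff mult_1)
    then have "{1..int n} \<subseteq> {1..int (B * n)}" by simp
    then have fy': "y \<in> free (int n)" using fy unfolding free_def by blast
    have "int j \<in> {0..int n}" using jn by simp
    then have jH: "int j \<in> H 0" "int j \<in> H 1" by (auto simp: H_def)
    have "y \<in> P \<or> y \<in> P1"
    proof (cases "\<xi> y \<le> u b + 1 - \<theta>")
      case True
      have "u b \<le> \<xi> y" using j \<xi>y by simp
      then show ?thesis unfolding P_def using y(1) fy' True by blast
    next
      case False
      have "u b + 1 - \<theta> \<le> \<xi> y" "\<xi> y \<le> u b + 1" using False j \<xi>y by auto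
      then show ?thesis unfolding P1_def using y(1) fy by blast
    qed
    then show ?thesis
    proof
      assume "y \<in> P"
      then show ?thesis using jH(1) by (intro bexI[of _ 0] bexI[of _ "int j"]) (auto simp: Q_def T_def y_def)
    next
      assume "y \<in> P1"
      then show ?thesis using jH(2) by (intro bexI[of _ 1] bexI[of _ "int j"]) (auto simp: Q_def T_def y_def)
    qed
  qed
  have finH: "finite (H t)" for t unfolding H_def using finS by auto
  have SH: "S t \<subseteq> H t" for t
  proof (cases "t = 0")
    case True
    then show ?thesis using rng_sub[of 0] by (auto simp: S_def H_def)
  qed (auto simp: H_def)
  have dimH: "cover_dim_le mtopology (small_on act \<U> (H t)) (card (R t) * q0)" for t
    using cover_dim_le_shifts[OF dim0 finR] by (rule cover_dim_le_mono) (auto intro: small_on_subset[OF _ HR])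
  show thesis
  proof (rule coloured_towers[of T Q S H \<U> "\<lambda>t. card (R t) * q0" k])
    show "finite T" by (simp add: T_def)
    show "\<And>t. t \<in> T \<Longrightarrow> closedin mtopology (Q t)" using Qcl .
    show "\<And>t. t \<in> T \<Longrightarrow> finite (S t) \<and> S t \<subseteq> H t" using finS SH by simp
    show "\<And>t. t \<in> T \<Longrightarrow> finite (H t)" using finH .
    show "\<And>t. t \<in> T \<Longrightarrow> cover_dim_le mtopology (small_on act \<U> (H t)) (card (R t) * q0)" using dimH .
    show "\<And>t. t \<in> T \<Longrightarrow> card (R t) * q0 < k * card (S t)" using cardS .
    show "t = t' \<and> s = s'" if "t \<in> T" "t' \<in> T" "s \<in> S t" "s' \<in> S t'" "x \<in> Q t" "y \<in> Q t'" "act x s = act y s'"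
      for t t' s s' x y using disj[OF that(3-7)] .
    show "\<exists>t\<in>T. \<exists>j\<in>H t. act x (- j) \<in> Q t" if "x \<in> M" for x using cov[OF that] .
  qed (rule that)
qed

end

section \<open>Paths and dendrites\<close>

lemma geometric_steps_converge:
  fixes g :: "nat \<Rightarrow> 'v::complete_space"
  assumes e: "\<And>n. dist (g n) (g (Suc n)) \<le> e / 2 ^ n"
  shows "\<exists>l. g \<longlonglongrightarrow> l \<and> (\<forall>n. dist (g n) l \<le> 2 * e / 2 ^ n)"
proof -
  have step: "dist (g n) (g (n + k)) \<le> 2 * e / 2 ^ n - 2 * e / 2 ^ (n + k)" for n k
  proof (induction k)
    case (Suc k)
    have "dist (g n) (g (n + Suc k)) \<le> dist (g n) (g (n + k)) + dist (g (n + k)) (g (Suc (n + k)))"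
      using dist_triangle by simp
    also have "\<dots> \<le> 2 * e / 2 ^ n - 2 * e / 2 ^ (n + k) + e / 2 ^ (n + k)"
      using Suc e by (intro add_mono) auto
    also have "\<dots> = 2 * e / 2 ^ n - 2 * e / 2 ^ (n + Suc k)" by (simp add: field_simps)
    finally show ?case .
  qed simp
  have e0: "e \<ge> 0" using order_trans[OF zero_le_dist e[of 0]] by simp
  have bd: "dist (g n) (g m) \<le> 2 * e / 2 ^ n" if "n \<le> m" for n m
  proof -
    have "2 * e / 2 ^ m \<ge> 0" using e0 by simp
    then show ?thesis using step[of n "m - n"] that by simp
  qed
  have lim0: "(\<lambda>n. 2 * e / 2 ^ n) \<longlonglongrightarrow> 0" by real_asymp
  have "Cauchy g"
  proof (rule metric_CauchyI)
    fix r :: real assume "r > 0"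
    then have "\<forall>\<^sub>F n in sequentially. 2 * e / 2 ^ n < r / 2" using lim0 by (intro order_tendstoD(2)[of _ 0]) auto
    then obtain N where N: "2 * e / 2 ^ N < r / 2" by (auto simp: eventually_sequentially)
    have "dist (g m) (g n) < r" if "m \<ge> N" "n \<ge> N" for m n
      using bd[OF that(1)] bd[OF that(2)] N dist_triangle3[of "g m" "g n" "g N"] by linarith
    then show "\<exists>M. \<forall>m\<ge>M. \<forall>n\<ge>M. dist (g m) (g n) < r" by blast
  qed
  then obtain l where l: "g \<longlonglongrightarrow> l" by (auto simp: Cauchy_convergent_iff convergent_def)
  have "dist (g n) l \<le> 2 * e / 2 ^ n" for n
  proof (rule tendsto_upperbound[where f="\<lambda>m. dist (g n) (g m)"])
    show "((\<lambda>m. dist (g n) (g m)) \<longlongrightarrow> dist (g n) l) sequentially" using l by (intro tendsto_intros)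
    show "\<forall>\<^sub>F m in sequentially. dist (g n) (g m) \<le> 2 * e / 2 ^ n"
      using bd by (intro eventually_sequentiallyI[of n])
  qed simp
  then show ?thesis using l by blast
qed

text \<open>Being joined by a \<open>\<delta>\<close>-chain in \<open>C\<close> is an equivalence
  relation with open classes. All large lengths occur because points may be repeated;
  \<open>small_paths\<close> needs one common length for all links.\<close>

lemma connected_chain:
  fixes C :: "'v::metric_space set"
  assumes "connected C" "x \<in> C" "y \<in> C" "\<delta> > 0"
  shows "\<exists>N0. \<forall>N\<ge>N0. \<exists>a::nat \<Rightarrow> 'v. a 0 = x \<and> a N = y \<and> (\<forall>i\<le>N. a i \<in> C) \<and> (\<forall>i<N. dist (a i) (a (Suc i)) < \<delta>)"
proof -
  define R where "R u v \<longleftrightarrow> (\<exists>N. \<exists>a::nat \<Rightarrow> 'v. a 0 = u \<and> a N = v \<and> (\<forall>i\<le>N. a i \<in> C) \<and> (\<forall>i<N. dist (a i) (a (Suc i)) < \<delta>))" for u v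
  have "R x y"
  proof (rule connected_equivalence_relation[OF assms(1-3)])
    fix u v assume "R u v"
    then obtain N and a :: "nat \<Rightarrow> 'v" where a: "a 0 = u" "a N = v" "\<forall>i\<le>N. a i \<in> C" "\<forall>i<N. dist (a i) (a (Suc i)) < \<delta>"
      unfolding R_def by blast
    have "dist (a (N - i)) (a (N - Suc i)) < \<delta>" if "i < N" for i
    proof -
      have "N - i = Suc (N - Suc i)" using that by simp
      then show ?thesis using a(4) that by (metis diff_Suc_less dist_commute gr_implies_not0 linorder_neqE_nat)
    qed
    then show "R v u" unfolding R_def using a
      by (intro exI[of _ N] exI[of _ "\<lambda>i. a (N - i)"]) auto
  next
    fix u v w assume "R u v" "R v w"
    then obtain N M and a b :: "nat \<Rightarrow> 'v" where a: "a 0 = u" "a N = v" "\<forall>i\<le>N. a i \<in> C" "\<forall>i<N. dist (a i) (a (Suc i)) < \<delta>"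
      and b: "b 0 = v" "b M = w" "\<forall>i\<le>M. b i \<in> C" "\<forall>i<M. dist (b i) (b (Suc i)) < \<delta>"
      unfolding R_def by blast
    define c where "c i = (if i \<le> N then a i else b (i - N))" for i
    have "dist (c i) (c (Suc i)) < \<delta>" if "i < N + M" for i
    proof -
      consider "i < N" | "i = N" | "i > N" by linarith
      then show ?thesis
      proof cases
        case 3
        then have "Suc i - N = Suc (i - N)" by simp
        then show ?thesis using 3 b(4) that by (simp add: c_def)
      qed (use a b that in \<open>auto simp: c_def\<close>)
    qed
    moreover have "c (N + M) = w" using a b by (cases "M = 0") (auto simp: c_def)
    ultimately show "R u w" unfolding R_def using a b
      by (intro exI[of _ "N + M"] exI[of _ c]) (auto simp: c_def)
  next
    fix u assume u: "u \<in> C"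
    have "R u v" if "v \<in> C" "dist u v < \<delta>" for v
      unfolding R_def using that u
      by (intro exI[of _ 1] exI[of _ "\<lambda>i. if i = 0 then u else v"]) auto
    then show "\<exists>T. openin (top_of_set C) T \<and> u \<in> T \<and> (\<forall>v\<in>T. R u v)"
      using u assms(4) by (intro exI[of _ "C \<inter> ball u \<delta>"]) auto
  qed
  then obtain N0 and a :: "nat \<Rightarrow> 'v" where a: "a 0 = x" "a N0 = y" "\<forall>i\<le>N0. a i \<in> C" "\<forall>i<N0. dist (a i) (a (Suc i)) < \<delta>"
    unfolding R_def by blast
  show ?thesis
  proof (intro exI[of _ N0] allI impI)
    fix N assume "N \<ge> N0"
    have "dist (a (min i N0)) (a (min (Suc i) N0)) < \<delta>" for i
      using a(4) assms(4) by (cases "i < N0") (simp_all add: min_def)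
    then show "\<exists>a::nat \<Rightarrow> 'v. a 0 = x \<and> a N = y \<and> (\<forall>i\<le>N. a i \<in> C) \<and> (\<forall>i<N. dist (a i) (a (Suc i)) < \<delta>)"
      using a(1-3) \<open>N \<ge> N0\<close> by (intro exI[of _ "\<lambda>i. a (min i N0)"]) simp
  qed
qed

text \<open>Local connectedness gives a connected neighbourhood for each point separately; a
  Lebesgue number of the resulting cover makes the scale \<open>\<delta>\<close> uniform.\<close>

lemma uniformly_locally_connected:
  fixes K :: "'v::metric_space set"
  assumes "compact K" "locally connected K" "\<epsilon> > 0"
  shows "\<exists>\<delta>>0. \<forall>x\<in>K. \<forall>y\<in>K. dist x y < \<delta> \<longrightarrow> (\<exists>C. connected C \<and> C \<subseteq> K \<and> C \<subseteq> ball x \<epsilon> \<and> x \<in> C \<and> y \<in> C)"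
proof -
  have "\<exists>U V. open U \<and> connected V \<and> z \<in> U \<and> U \<inter> K \<subseteq> V \<and> V \<subseteq> K \<and> V \<subseteq> ball z (\<epsilon>/2)" if "z \<in> K" for z
  proof -
    have "openin (top_of_set K) (K \<inter> ball z (\<epsilon>/2))" "z \<in> K \<inter> ball z (\<epsilon>/2)" using that assms(3) by auto
    then obtain U V where UV: "openin (top_of_set K) U" "connected V" "z \<in> U" "U \<subseteq> V" "V \<subseteq> K \<inter> ball z (\<epsilon>/2)"
      using assms(2) unfolding locally_def by meson
    then obtain T where "open T" "U = K \<inter> T" by (auto simp: openin_open)
    then show ?thesis using UV by (intro exI[of _ T] exI[of _ V]) auto
  qed
  then obtain U V where UV: "\<And>z. z \<in> K \<Longrightarrow> open (U z) \<and> connected (V z) \<and> z \<in> U z \<and> U z \<inter> K \<subseteq> V z \<and> V z \<subseteq> K \<and> V z \<subseteq> ball z (\<epsilon>/2)"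
    by metis
  obtain \<delta> where \<delta>: "\<delta> > 0" "\<forall>x\<in>K. \<exists>G\<in>U ` K. ball x \<delta> \<subseteq> G"
  proof (rule Heine_Borel_lemma[OF assms(1), of "U ` K"])
    show "K \<subseteq> \<Union>(U ` K)" using UV by blast
    show "\<And>G. G \<in> U ` K \<Longrightarrow> open G" using UV by blast
  qed (use that in blast)
  show ?thesis
  proof (intro exI[of _ \<delta>] conjI ballI impI \<delta>(1))
    fix x y assume xy: "x \<in> K" "y \<in> K" "dist x y < \<delta>"
    then obtain z where z: "z \<in> K" "ball x \<delta> \<subseteq> U z" using \<delta>(2) by blast
    have "x \<in> ball x \<delta>" "y \<in> ball x \<delta>" using xy \<delta>(1) by auto
    then have "x \<in> V z" "y \<in> V z" using z(2) xy(1,2) UV[OF z(1)] by blast+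
    moreover have "V z \<subseteq> ball x \<epsilon>"
    proof
      fix u assume "u \<in> V z"
      then have "dist z u < \<epsilon>/2" "dist z x < \<epsilon>/2" using UV[OF z(1)] \<open>x \<in> V z\<close> by auto
      then show "u \<in> ball x \<epsilon>" using dist_triangle3[of x u z] by simp
    qed
    ultimately show "\<exists>C. connected C \<and> C \<subseteq> K \<and> C \<subseteq> ball x \<epsilon> \<and> x \<in> C \<and> y \<in> C"
      using UV[OF z(1)] by blast
  qed
qed

text \<open>The Mazurkiewicz--Moore theorem, in uniform form. The path is the uniform limit of step functions on
  successively finer chains.\<close>

lemma small_paths:
  fixes K :: "'v::complete_space set"
  assumes K: "compact K" "locally connected K" and \<epsilon>: "\<epsilon> > 0"
  obtains \<delta> where "\<delta> > 0"
    "\<And>x y. x \<in> K \<Longrightarrow> y \<in> K \<Longrightarrow> dist x y < \<delta> \<Longrightarrow>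
      \<exists>g. path g \<and> path_image g \<subseteq> K \<inter> ball x \<epsilon> \<and> pathstart g = x \<and> pathfinish g = y"
proof -
  \<comment> \<open>The initial chain stays within \<open>e\<close> of \<open>x\<close>, and all
    later refinements move a point by at most \<open>2 * e\<close> in total; \<open>3 * e\<close> is
    below \<open>\<epsilon>\<close>.\<close>
  define e where "e = \<epsilon> / 4"
  have e: "e > 0" using \<epsilon> by (simp add: e_def)
  have "\<exists>\<delta>>0. \<delta> \<le> e / 2 ^ n \<and> (\<forall>x\<in>K. \<forall>y\<in>K. dist x y < \<delta> \<longrightarrow> (\<exists>C. connected C \<and> C \<subseteq> K \<and> C \<subseteq> ball x (e / 2 ^ n) \<and> x \<in> C \<and> y \<in> C))" for n
  proof -
    have p: "e / 2 ^ n > 0" using e by simp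
    obtain \<delta> where "\<delta> > 0" "\<forall>x\<in>K. \<forall>y\<in>K. dist x y < \<delta> \<longrightarrow> (\<exists>C. connected C \<and> C \<subseteq> K \<and> C \<subseteq> ball x (e / 2 ^ n) \<and> x \<in> C \<and> y \<in> C)"
      using uniformly_locally_connected[OF K p] by blast
    then show ?thesis using p by (intro exI[of _ "min \<delta> (e / 2 ^ n)"]) auto
  qed
  then obtain \<delta> where \<delta>0: "\<And>n. \<delta> n > 0" and \<delta>e: "\<And>n. \<delta> n \<le> e / 2 ^ n"
    and \<delta>C: "\<And>n x y. x \<in> K \<Longrightarrow> y \<in> K \<Longrightarrow> dist x y < \<delta> n \<Longrightarrow>
      \<exists>C. connected C \<and> C \<subseteq> K \<and> C \<subseteq> ball x (e / 2 ^ n) \<and> x \<in> C \<and> y \<in> C"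
    by metis
  have "\<exists>g. path g \<and> path_image g \<subseteq> K \<inter> ball x \<epsilon> \<and> pathstart g = x \<and> pathfinish g = y"
    if xy: "x \<in> K" "y \<in> K" "dist x y < \<delta> 0" for x y
  proof -
    define P where "P n Ma \<longleftrightarrow> (case Ma of (M, a) \<Rightarrow> M > 0 \<and> a 0 = x \<and> a M = y \<and> (\<forall>i\<le>M. a i \<in> K) \<and>
      (\<forall>i<M. dist (a i) (a (Suc i)) < \<delta> n) \<and> (n = 0 \<longrightarrow> M = 1))" for n and Ma :: "nat \<times> (nat \<Rightarrow> 'v)"
    \<comment> \<open>Consecutive chains are aligned: each link of the old one is replaced by
      exactly \<open>N\<close> links, which start near its first vertex.\<close>
    define Q where "Q n Ma Mb \<longleftrightarrow> (case Ma of (M, a) \<Rightarrow> case Mb of (M', b) \<Rightarrow> \<exists>N>0. M' = M * N \<and>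
      (\<forall>j<M. \<forall>i<N. dist (a j) (b (j * N + i)) \<le> e / 2 ^ n))" for n and Ma Mb :: "nat \<times> (nat \<Rightarrow> 'v)"
    have "\<exists>f. \<forall>n. P n (f n) \<and> Q n (f n) (f (Suc n))"
    proof (rule dependent_nat_choice)
      show "\<exists>Ma. P 0 Ma"
        using xy by (intro exI[of _ "(1, \<lambda>i. if i = 0 then x else y)"]) (auto simp: P_def)
    next
      fix Ma n assume "P n Ma"
      then obtain M a where Ma: "Ma = (M, a)" and a: "M > 0" "a 0 = x" "a M = y" "\<forall>i\<le>M. a i \<in> K"
        "\<forall>i<M. dist (a i) (a (Suc i)) < \<delta> n" by (cases Ma) (auto simp: P_def)
      have "\<exists>C. connected C \<and> C \<subseteq> K \<and> C \<subseteq> ball (a j) (e / 2 ^ n) \<and> a j \<in> C \<and> a (Suc j) \<in> C" if "j < M" for j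
        using a that by (intro \<delta>C) auto
      then obtain C where C: "\<And>j. j < M \<Longrightarrow> connected (C j) \<and> C j \<subseteq> K \<and> C j \<subseteq> ball (a j) (e / 2 ^ n) \<and> a j \<in> C j \<and> a (Suc j) \<in> C j"
        by metis
      have "\<exists>N0. \<forall>N\<ge>N0. \<exists>b::nat \<Rightarrow> 'v. b 0 = a j \<and> b N = a (Suc j) \<and> (\<forall>i\<le>N. b i \<in> C j) \<and> (\<forall>i<N. dist (b i) (b (Suc i)) < \<delta> (Suc n))"
        if "j < M" for j
        using C[OF that] \<delta>0 by (intro connected_chain) auto
      then obtain N0 where N0: "\<And>j N. j < M \<Longrightarrow> N \<ge> N0 j \<Longrightarrow> \<exists>b::nat \<Rightarrow> 'v. b 0 = a j \<and> b N = a (Suc j) \<and> (\<forall>i\<le>N. b i \<in> C j) \<and> (\<forall>i<N. dist (b i) (b (Suc i)) < \<delta> (Suc n))"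
        by metis
      define N where "N = Suc (\<Sum>j<M. N0 j)"
      have "N \<ge> N0 j" if "j < M" for j
        unfolding N_def using that member_le_sum[of j "{..<M}" N0] by simp
      then have "\<exists>b::nat \<Rightarrow> 'v. b 0 = a j \<and> b N = a (Suc j) \<and> (\<forall>i\<le>N. b i \<in> C j) \<and> (\<forall>i<N. dist (b i) (b (Suc i)) < \<delta> (Suc n))"
        if "j < M" for j
        by (rule N0[OF that]) (rule that)
      then obtain b where b: "\<And>j. j < M \<Longrightarrow> b j 0 = a j \<and> b j N = a (Suc j) \<and> (\<forall>i\<le>N. b j i \<in> C j) \<and> (\<forall>i<N. dist (b j i) (b j (Suc i)) < \<delta> (Suc n))"
        by metis
      define c where "c t = (if t = M * N then y else b (t div N) (t mod N))" for t
      have Npos: "N > 0" by (simp add: N_def)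
      have c_eq: "c (j * N + i) = b j i" if "j < M" "i \<le> N" for j i
      proof (cases "i = N")
        case True
        show ?thesis
        proof (cases "Suc j = M")
          case True
          then show ?thesis using \<open>i = N\<close> b[OF that(1)] a(3) by (auto simp: c_def)
        next
          case False
          then have "Suc j < M" using that by simp
          have ji: "j * N + i = Suc j * N" using True by simp
          moreover have "Suc j * N \<noteq> M * N" using False Npos mult_cancel2[of "Suc j" N M] by (simp del: mult_Suc)
          ultimately show ?thesis unfolding ji c_def
            using Npos b[OF \<open>Suc j < M\<close>] b[OF that(1)] True by simp
        qed
      next
        case False
        then have "j * N + i < Suc j * N" using that by simp
        also have "\<dots> \<le> M * N" using that by (intro mult_le_mono1) simp
        finally show ?thesis using False that by (simp add: c_def)
      qed
      have split: "\<exists>j<M. \<exists>i<N. t = j * N + i" if "t < M * N" for t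
        using that Npos by (intro exI[of _ "t div N"] conjI exI[of _ "t mod N"]) (auto simp: less_mult_imp_div_less)
      have "P (Suc n) (M * N, c)"
        unfolding P_def case_prod_conv
      proof (intro conjI allI impI)
        show "c 0 = x" using c_eq[of 0 0] b[of 0] a by simp
        show "c (M * N) = y" by (simp add: c_def)
        fix t assume t: "t < M * N"
        then obtain j i where ji: "j < M" "i < N" "t = j * N + i" using split by blast
        then have "c (Suc t) = b j (Suc i)" using c_eq[of j "Suc i"] by simp
        then show "dist (c t) (c (Suc t)) < \<delta> (Suc n)" using ji c_eq[of j i] b[of j] by simp
      next
        fix t assume t: "t \<le> M * N"
        show "c t \<in> K"
        proof (cases "t = M * N")
          case False
          then obtain j i where ji: "j < M" "i < N" "t = j * N + i" using split t by (metis le_neq_implies_less)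
          have "b j i \<in> C j" using b[OF ji(1)] ji(2) by simp
          then show ?thesis using ji c_eq[of j i] C[OF ji(1)] by auto
        qed (use xy in \<open>simp add: c_def\<close>)
      qed (use a Npos in auto)
      moreover have "Q n (M, a) (M * N, c)"
        unfolding Q_def case_prod_conv
      proof (intro exI[of _ N] conjI allI impI Npos refl)
        fix j i assume ji: "j < M" "i < N"
        then have "b j i \<in> C j" using b[OF ji(1)] by simp
        then show "dist (a j) (c (j * N + i)) \<le> e / 2 ^ n"
          using ji c_eq[of j i] C[OF ji(1)] by auto
      qed
      ultimately show "\<exists>Mb. P (Suc n) Mb \<and> Q n Ma Mb" using Ma by blast
    qed
    then obtain f where f: "\<And>n. P n (f n)" "\<And>n. Q n (f n) (f (Suc n))" by blast
    define M a where "M n = fst (f n)" and "a n = snd (f n)" for n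
    have Mpos: "M n > 0" and a0: "a n 0 = x" and aM: "a n (M n) = y" and aK: "\<And>i. i \<le> M n \<Longrightarrow> a n i \<in> K"
      and ad: "\<And>i. i < M n \<Longrightarrow> dist (a n i) (a n (Suc i)) < \<delta> n" for n
      using f(1)[of n] by (auto simp: P_def M_def a_def split: prod.splits)
    have M0: "M 0 = 1" using f(1)[of 0] by (auto simp: P_def M_def split: prod.splits)
    have QN: "\<exists>N>0. M (Suc n) = M n * N \<and> (\<forall>j<M n. \<forall>i<N. dist (a n j) (a (Suc n) (j * N + i)) \<le> e / 2 ^ n)" for n
      using f(2)[of n] by (auto simp: Q_def M_def a_def split: prod.splits)
    define k where "k n t = nat \<lfloor>t * real (M n)\<rfloor>" for n and t :: real
    define h where "h n t = a n (k n t)" for n t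
    have kM: "k n t \<le> M n" if "t \<in> {0..1}" for n t
    proof -
      have "t * real (M n) \<le> real (M n)" using that by (simp add: mult_left_le_one_le)
      then show ?thesis unfolding k_def by linarith
    qed
    have kl: "k n t < M n" if "0 \<le> t" "t < 1" for n t
    proof -
      have "t * real (M n) < real (M n)" using that Mpos[of n] by simp
      then show ?thesis unfolding k_def using that Mpos[of n] by linarith
    qed
    have h1: "h n 1 = y" and h0: "h n 0 = x" for n by (simp_all add: h_def k_def a0 aM)
    have hK: "h n t \<in> K" if "t \<in> {0..1}" for n t using aK kM that by (simp add: h_def)
    have step: "dist (h n t) (h (Suc n) t) \<le> e / 2 ^ n" if t: "t \<in> {0..1}" for n t
    proof (cases "t = 1")
      case True
      then show ?thesis using h1 e by simp
    next
      case False
      obtain N where N: "N > 0" "M (Suc n) = M n * N" "\<forall>j<M n. \<forall>i<N. dist (a n j) (a (Suc n) (j * N + i)) \<le> e / 2 ^ n"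
        using QN by blast
      \<comment> \<open>Because of the common factor \<open>N\<close>, the link of the finer chain
        in use at time \<open>t\<close> subdivides the link of the coarser chain in use at
        \<open>t\<close>.\<close>
      have "k (Suc n) t div N = k n t"
      proof -
        have "\<lfloor>t * real (M n * N) / real N\<rfloor> = \<lfloor>t * real (M n * N)\<rfloor> div int N"
          using floor_divide_real_eq_div[of "int N" "t * real (M n * N)"] by simp
        moreover have "t * real (M n * N) / real N = t * real (M n)" using N(1) by simp
        ultimately show ?thesis unfolding k_def N(2) using t by (simp add: nat_div_distrib)
      qed
      then have "k (Suc n) t = k n t * N + k (Suc n) t mod N" by (metis div_mult_mod_eq)
      then show ?thesis unfolding h_def using N kl[of t n] t False by (metis atLeastAtMost_iff mod_less_divisor order_le_less)
    qed
    have "\<exists>l. (\<lambda>n. h n t) \<longlonglongrightarrow> l \<and> (\<forall>n. dist (h n t) l \<le> 2 * e / 2 ^ n)" if "t \<in> {0..1}" for t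
      by (rule geometric_steps_converge) (rule step[OF that])
    then obtain g where g: "\<And>t. t \<in> {0..1} \<Longrightarrow> (\<lambda>n. h n t) \<longlonglongrightarrow> g t" "\<And>t n. t \<in> {0..1} \<Longrightarrow> dist (h n t) (g t) \<le> 2 * e / 2 ^ n"
      by metis
    \<comment> \<open>The step functions are not continuous, but nearby times use the same or
      adjacent vertices, and these are at most \<open>e / 2 ^ n\<close> apart. This suffices for
      continuity of the limit.\<close>
    have near: "dist (h n s) (h n t) \<le> e / 2 ^ n" if st: "s \<in> {0..1}" "t \<in> {0..1}" "s \<le> t" "t - s < 1 / real (M n)" for n s t
    proof -
      have "(t - s) * real (M n) < 1" using st Mpos[of n] by (simp add: field_simps)
      then have "t * real (M n) < s * real (M n) + 1" by (simp add: algebra_simps)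
      moreover have "s * real (M n) \<le> t * real (M n)" "0 \<le> s * real (M n)" using st by (auto intro: mult_right_mono)
      ultimately have "k n t = k n s \<or> k n t = Suc (k n s)" unfolding k_def by linarith
      then show ?thesis
      proof
        assume ks: "k n t = Suc (k n s)"
        then have "k n s < M n" using kM[OF st(2), of n] by simp
        then show ?thesis using ad[of "k n s" n] \<delta>e[of n] by (simp add: h_def ks)
      qed (use e in \<open>simp add: h_def\<close>)
    qed
    have "continuous_on {0..1} g"
      unfolding continuous_on_iff
    proof (intro ballI allI impI)
      fix s r :: real assume s: "s \<in> {0..1}" and r: "r > 0"
      have "(\<lambda>n. 5 * e / 2 ^ n) \<longlonglongrightarrow> 0" by real_asymp
      then have "\<forall>\<^sub>F n in sequentially. 5 * e / 2 ^ n < r" using r by (rule order_tendstoD(2))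
      then obtain n where n: "5 * e / 2 ^ n < r" by (auto simp: eventually_sequentially)
      have "dist (g t) (g s) < r" if t: "t \<in> {0..1}" "dist t s < 1 / real (M n)" for t
      proof -
        have "dist (h n s) (h n t) \<le> e / 2 ^ n"
          using near[of s t n] near[of t s n] s t by (cases "s \<le> t") (auto simp: dist_real_def dist_commute)
        then have "dist (g t) (g s) \<le> 2 * e / 2 ^ n + e / 2 ^ n + 2 * e / 2 ^ n"
          using g(2)[OF s, of n] g(2)[OF t(1), of n] dist_triangle3[of "g t" "g s" "h n t"]
            dist_triangle[of "h n t" "g s" "h n s"] dist_commute[of "h n s" "h n t"] by linarith
        also have "\<dots> = 5 * e / 2 ^ n" by (simp add: field_simps)
        finally show ?thesis using n by simp
      qed
      then show "\<exists>d>0. \<forall>t\<in>{0..1}. dist t s < d \<longrightarrow> dist (g t) (g s) < r"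
        using Mpos[of n] by (intro exI[of _ "1 / real (M n)"]) auto
    qed
    moreover have "g t \<in> K" if "t \<in> {0..1}" for t
      using closed_sequentially[OF compact_imp_closed[OF K(1)] _ g(1)[OF that]] hK[OF that] by blast
    moreover have "dist x (g t) < \<epsilon>" if t: "t \<in> {0..1}" for t
    proof -
      have "h 0 t = x \<or> h 0 t = y"
        using kM[OF t, of 0] M0 a0[of 0] aM[of 0] unfolding h_def by (cases "k 0 t") auto
      then have "dist x (h 0 t) \<le> e" using xy \<delta>e[of 0] e by auto
      then show ?thesis using g(2)[OF t, of 0] dist_triangle[of x "g t" "h 0 t"] e by (simp add: e_def)
    qed
    moreover have "g 0 = x" "g 1 = y"
      using LIMSEQ_unique[OF g(1)[of 0], of x] LIMSEQ_unique[OF g(1)[of 1], of y] h0 h1 by auto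
    ultimately show ?thesis
      by (intro exI[of _ g]) (auto simp: path_def path_image_def pathstart_def pathfinish_def)
  qed
  then show thesis using that[of "\<delta> 0"] \<delta>0 by blast
qed

text \<open>Path components of a relatively open subset of \<open>K\<close> are open by
  \<open>small_paths\<close>, so a connected one has a single path component.\<close>

lemma path_in_open_connected:
  fixes K :: "'v::complete_space set"
  assumes K: "compact K" "locally connected K" and C: "openin (top_of_set K) C" "connected C" "p \<in> C" "q \<in> C"
  shows "\<exists>g. path g \<and> path_image g \<subseteq> C \<and> pathstart g = p \<and> pathfinish g = q"
proof -
  have "path_component C p q"
  proof (rule connected_equivalence_relation[OF C(2,3,4)])
    fix u assume u: "u \<in> C"
    obtain T where T: "open T" "C = K \<inter> T" using C(1) by (auto simp: openin_open)
    then obtain r where r: "r > 0" "ball u r \<subseteq> T" using u open_contains_ball by blast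
    obtain \<delta> where \<delta>: "\<delta> > 0" "\<And>x y. x \<in> K \<Longrightarrow> y \<in> K \<Longrightarrow> dist x y < \<delta> \<Longrightarrow>
      \<exists>g. path g \<and> path_image g \<subseteq> K \<inter> ball x r \<and> pathstart g = x \<and> pathfinish g = y"
      by (rule small_paths[OF K r(1)]) (rule that)
    have "path_component C u v" if "v \<in> C" "dist u v < \<delta>" for v
      using \<delta>(2)[of u v] that u r T unfolding path_component_def by blast
    then show "\<exists>T. openin (top_of_set C) T \<and> u \<in> T \<and> (\<forall>v\<in>T. path_component C u v)"
      using u \<delta>(1) by (intro exI[of _ "C \<inter> ball u \<delta>"]) auto
  qed (auto intro: path_component_sym path_component_trans)
  then show ?thesis unfolding path_component_def by blast
qed

text \<open>From \<open>z\<close>, follow \<open>\<alpha>\<close> in both directions up to the first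
  points on \<open>\<beta>\<close>; the piece in between meets \<open>\<beta>\<close> only in its
  two ends, and a subarc of \<open>\<beta>\<close> closes it up.\<close>

lemma arcs_contain_simple_closed_curve:
  fixes \<alpha> \<beta> :: "real \<Rightarrow> 'v::real_normed_vector"
  assumes \<alpha>: "arc \<alpha>" and \<beta>: "arc \<beta>"
    and ends: "pathstart \<alpha> \<in> path_image \<beta>" "pathfinish \<alpha> \<in> path_image \<beta>"
    and z: "z \<in> path_image \<alpha>" "z \<notin> path_image \<beta>"
  obtains \<gamma> where "simple_path \<gamma>" "pathfinish \<gamma> = pathstart \<gamma>" "path_image \<gamma> \<subseteq> path_image \<alpha> \<union> path_image \<beta>"
proof -
  obtain s where s: "s \<in> {0..1}" "\<alpha> s = z" using z(1) by (auto simp: path_image_def)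
  define A where "A = {t\<in>{0..1}. \<alpha> t \<in> path_image \<beta>}"
  have c\<alpha>: "continuous_on {0..1} \<alpha>" using \<alpha> by (simp add: arc_def path_def)
  have "closed A"
    unfolding A_def
  proof -
    have "closedin (top_of_set {0..1}) ({0..1} \<inter> \<alpha> -` path_image \<beta>)"
      using c\<alpha> compact_imp_closed[OF compact_arc_image[OF \<beta>]] continuous_closedin_preimage by blast
    moreover have "{t\<in>{0..1}. \<alpha> t \<in> path_image \<beta>} = {0..1} \<inter> \<alpha> -` path_image \<beta>" by auto
    ultimately show "closed {t\<in>{0..1}. \<alpha> t \<in> path_image \<beta>}" by (metis closed_atLeastAtMost closedin_closed_trans)
  qed
  have A01: "0 \<in> A" "1 \<in> A" using ends by (auto simp: A_def pathstart_def pathfinish_def)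
  have sA: "s \<notin> A" using s z by (auto simp: A_def)
  have "compact (A \<inter> {0..s})" "A \<inter> {0..s} \<noteq> {}" using \<open>closed A\<close> A01 s by (auto simp: closed_Int_compact)
  then obtain a where a: "a \<in> A \<inter> {0..s}" "\<forall>t\<in>A \<inter> {0..s}. t \<le> a" using compact_attains_sup by blast
  have "compact (A \<inter> {s..1})" "A \<inter> {s..1} \<noteq> {}" using \<open>closed A\<close> A01 s by (auto simp: closed_Int_compact)
  then obtain b where b: "b \<in> A \<inter> {s..1}" "\<forall>t\<in>A \<inter> {s..1}. b \<le> t" using compact_attains_inf by blast
  have "a \<noteq> s" "b \<noteq> s" using a(1) b(1) sA by auto
  then have ab: "a < s" "s < b" "a \<in> {0..1}" "b \<in> {0..1}" "\<alpha> a \<in> path_image \<beta>" "\<alpha> b \<in> path_image \<beta>"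
    using a(1) b(1) by (auto simp: A_def)
  have between: "t = a \<or> t = b" if "t \<in> A" "a \<le> t" "t \<le> b" for t
  proof (cases "t \<le> s")
    case True
    then have "t \<le> a" using a(2) that ab by (simp add: A_def)
    then show ?thesis using that by simp
  next
    case False
    then have "b \<le> t" using b(2) that ab by (simp add: A_def)
    then show ?thesis using that by simp
  qed
  obtain u v where uv: "u \<in> {0..1}" "v \<in> {0..1}" "\<beta> u = \<alpha> a" "\<beta> v = \<alpha> b"
    using ab by (auto simp: path_image_def)
  have "\<alpha> a \<noteq> \<alpha> b" using arc_imp_inj_on[OF \<alpha>] ab by (metis inj_onD less_trans less_irrefl)
  then have "v \<noteq> u" using uv by auto
  define \<gamma> where "\<gamma> = subpath a b \<alpha> +++ subpath v u \<beta>"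
  have im1: "path_image (subpath a b \<alpha>) = \<alpha> ` {a..b}" using ab by (simp add: path_image_subpath)
  have im2: "path_image (subpath v u \<beta>) \<subseteq> path_image \<beta>" using uv by (intro path_image_subpath_subset) auto
  have "simple_path \<gamma>"
    unfolding \<gamma>_def
  proof (rule simple_path_join_loop)
    show "arc (subpath a b \<alpha>)" using ab by (intro arc_subpath_arc \<alpha>) auto
    show "arc (subpath v u \<beta>)" using uv \<open>v \<noteq> u\<close> by (intro arc_subpath_arc \<beta>) auto
    show "path_image (subpath a b \<alpha>) \<inter> path_image (subpath v u \<beta>) \<subseteq> {pathstart (subpath a b \<alpha>), pathstart (subpath v u \<beta>)}"
    proof
      fix w assume w: "w \<in> path_image (subpath a b \<alpha>) \<inter> path_image (subpath v u \<beta>)"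
      then obtain t where t: "a \<le> t" "t \<le> b" "w = \<alpha> t" using im1 by auto
      then have "t \<in> A" using w im2 ab by (auto simp: A_def)
      then show "w \<in> {pathstart (subpath a b \<alpha>), pathstart (subpath v u \<beta>)}" using between t uv by auto
    qed
  qed (use uv in auto)
  moreover have "pathfinish \<gamma> = pathstart \<gamma>" using uv by (simp add: \<gamma>_def)
  moreover have "path_image \<gamma> \<subseteq> path_image \<alpha> \<union> path_image \<beta>"
  proof -
    have "path_image (subpath a b \<alpha>) \<subseteq> path_image \<alpha>" using ab by (intro path_image_subpath_subset) auto
    then show ?thesis using im2 path_image_join_subset[of "subpath a b \<alpha>" "subpath v u \<beta>"] unfolding \<gamma>_def by blast
  qed
  ultimately show thesis by (rule that)
qed

section \<open>Cutting a dendrite at finitely many points\<close>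

locale dendrite_set =
  fixes K :: "'v::{complete_space,real_normed_vector} set"
  assumes compact_K: "compact K" and connected_K: "connected K" and locally_connected_K: "locally connected K"
    and no_circle: "\<And>S. S \<subseteq> K \<Longrightarrow> \<not> S homeomorphic sphere (0::complex) 1"
begin

text \<open>An inner point \<open>z\<close> of an arc from \<open>p\<close> to \<open>q\<close>
  separates them: an arc inside the component of \<open>q\<close> in \<open>K - {z}\<close> would
  otherwise form a simple closed curve with the first one. \<open>insert z U\<close> is closed
  because the other components are open.\<close>

lemma separating_point:
  assumes pq: "p \<in> K" "q \<in> K" "p \<noteq> q"
  obtains z U where "z \<in> K" "z \<noteq> p" "openin (top_of_set K) U" "q \<in> U" "p \<notin> U"
    "closedin (top_of_set K) (insert z U)"
proof -
  obtain \<alpha>0 where \<alpha>0: "path \<alpha>0" "path_image \<alpha>0 \<subseteq> K" "pathstart \<alpha>0 = p" "pathfinish \<alpha>0 = q"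
    using path_in_open_connected[OF compact_K locally_connected_K _ connected_K pq(1,2)] by auto
  obtain \<alpha> where \<alpha>: "arc \<alpha>" "path_image \<alpha> \<subseteq> path_image \<alpha>0" "pathstart \<alpha> = p" "pathfinish \<alpha> = q"
    using path_contains_arc[OF \<alpha>0(1,3,4) pq(3)] by metis
  define z where "z = \<alpha> (1/2)"
  have inj: "inj_on \<alpha> {0..1}" using \<alpha>(1) by (rule arc_imp_inj_on)
  have z: "z \<in> path_image \<alpha>" by (auto simp: z_def path_image_def)
  have "\<alpha> (1/2) \<noteq> \<alpha> 0" "\<alpha> (1/2) \<noteq> \<alpha> 1" using inj by (auto dest!: inj_onD)
  then have zp: "z \<noteq> p" and zq: "z \<noteq> q" using \<alpha> by (auto simp: z_def pathstart_def pathfinish_def)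
  have zK: "z \<in> K" using z \<alpha>(2) \<alpha>0(2) by blast
  define U where "U = connected_component_set (K - {z}) q"
  have opKz: "openin (top_of_set K) (K - {z})" by (simp add: openin_delete)
  have op: "openin (top_of_set K) (connected_component_set (K - {z}) w)" if "w \<in> K - {z}" for w
    using locally_connected_K opKz that locally_connected_open_connected_component by blast
  have qU: "q \<in> U" unfolding U_def using pq zq by auto
  have opU: "openin (top_of_set K) U" unfolding U_def using op pq zq by blast
  have UK: "U \<subseteq> K - {z}" unfolding U_def by (rule connected_component_subset)
  have "p \<notin> U"
  proof
    assume "p \<in> U"
    then obtain \<beta>0 where \<beta>0: "path \<beta>0" "path_image \<beta>0 \<subseteq> U" "pathstart \<beta>0 = p" "pathfinish \<beta>0 = q"
      using path_in_open_connected[OF compact_K locally_connected_K opU _ _ qU] connected_connected_component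
      unfolding U_def by metis
    obtain \<beta> where \<beta>: "arc \<beta>" "path_image \<beta> \<subseteq> path_image \<beta>0" "pathstart \<beta> = p" "pathfinish \<beta> = q"
      using path_contains_arc[OF \<beta>0(1,3,4) pq(3)] by metis
    have "z \<notin> path_image \<beta>" using \<beta>(2) \<beta>0(2) UK by blast
    moreover have "pathstart \<alpha> \<in> path_image \<beta>" "pathfinish \<alpha> \<in> path_image \<beta>"
      using \<alpha> \<beta> by (metis pathstart_in_path_image, metis pathfinish_in_path_image)
    ultimately obtain \<gamma> where \<gamma>: "simple_path \<gamma>" "pathfinish \<gamma> = pathstart \<gamma>" "path_image \<gamma> \<subseteq> path_image \<alpha> \<union> path_image \<beta>"
      using arcs_contain_simple_closed_curve[OF \<alpha>(1) \<beta>(1) _ _ z] by metis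
    have "path_image \<gamma> homeomorphic sphere (0::complex) 1"
      using \<gamma> by (intro homeomorphic_simple_path_image_circle) auto
    moreover have "path_image \<gamma> \<subseteq> K" using \<gamma>(3) \<alpha>(2) \<alpha>0(2) \<beta>(2) \<beta>0(2) UK by blast
    ultimately show False using no_circle by blast
  qed
  moreover have "closedin (top_of_set K) (insert z U)"
  proof -
    have eq: "K - insert z U = (\<Union>w\<in>K - insert z U. connected_component_set (K - {z}) w)" (is "?L = ?R")
    proof
      show "?L \<subseteq> ?R"
      proof
        fix w assume w: "w \<in> ?L"
        then have "connected_component (K - {z}) w w" by auto
        then show "w \<in> ?R" using w by blast
      qed
      show "?R \<subseteq> ?L"
      proof
        fix v assume "v \<in> ?R"
        then obtain w where w: "w \<in> K" "w \<noteq> z" "w \<notin> U" "connected_component (K - {z}) w v" by blast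
        have "v \<in> K - {z}" using w(4) connected_component_in by blast
        moreover have "v \<notin> U"
        proof
          assume "v \<in> U"
          then have "connected_component (K - {z}) q v" by (simp add: U_def)
          then have "connected_component (K - {z}) q w"
            using w(4) connected_component_sym connected_component_trans by metis
          then show False using w(3) by (simp add: U_def)
        qed
        ultimately show "v \<in> ?L" by blast
      qed
    qed
    have "openin (top_of_set K) ?R" using op by (intro openin_Union) auto
    then have "openin (top_of_set K) (K - insert z U)" using eq by simp
    then show ?thesis using UK zK by (auto simp: closedin_def)
  qed
  ultimately show thesis using that[OF zK zp opU qU] by blast
qed

text \<open>By compactness finitely many cut points separate \<open>y\<close> from the complement of
  the ball; what remains around \<open>y\<close> has its boundary among them.\<close>

lemma finite_boundary_neighbourhood:
  assumes y: "y \<in> K" and r: "r > 0"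
  obtains V B where "openin (top_of_set K) V" "y \<in> V" "V \<subseteq> ball y r" "finite B" "B \<subseteq> K"
    "closedin (top_of_set K) (V \<union> B)"
proof -
  define T where "T = K - ball y r"
  have cT: "compact T" unfolding T_def using compact_K by (simp add: compact_diff)
  have "\<exists>z U. z \<in> K \<and> z \<noteq> y \<and> openin (top_of_set K) U \<and> w \<in> U \<and> y \<notin> U \<and> closedin (top_of_set K) (insert z U)"
    if "w \<in> T" for w
  proof -
    have "w \<in> K" "y \<noteq> w" using that r by (auto simp: T_def)
    then show ?thesis using separating_point[OF y, of w] by metis
  qed
  then obtain z U where zU: "\<And>w. w \<in> T \<Longrightarrow> z w \<in> K \<and> z w \<noteq> y \<and> openin (top_of_set K) (U w) \<and> w \<in> U w \<and> y \<notin> U w \<and> closedin (top_of_set K) (insert (z w) (U w))"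
    by metis
  then have "\<forall>w\<in>T. \<exists>O'. open O' \<and> U w = K \<inter> O'" by (auto simp: openin_open)
  then obtain O' where O': "\<And>w. w \<in> T \<Longrightarrow> open (O' w) \<and> U w = K \<inter> O' w" by metis
  obtain F where F: "F \<subseteq> T" "finite F" "T \<subseteq> (\<Union>w\<in>F. O' w)"
  proof (rule compactE_image[OF cT, of T O'])
    show "T \<subseteq> (\<Union>w\<in>T. O' w)"
    proof
      fix w assume "w \<in> T"
      then have "w \<in> O' w" using zU[of w] O'[of w] by blast
      then show "w \<in> (\<Union>w\<in>T. O' w)" using \<open>w \<in> T\<close> by blast
    qed
  qed (use O' in auto)
  define C where "C = (\<Union>w\<in>F. insert (z w) (U w))"
  define B where "B = z ` F"
  have FT: "w \<in> T" if "w \<in> F" for w using that F(1) by blast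
  have cC: "closedin (top_of_set K) C"
    unfolding C_def using zU FT F(2) by (intro closedin_Union) auto
  have V: "openin (top_of_set K) (K - C)"
    using cC by (simp add: openin_diff)
  show thesis
  proof (rule that[OF V])
    show "y \<in> K - C" using y zU FT unfolding C_def by fastforce
    show "K - C \<subseteq> ball y r"
    proof
      fix x assume x: "x \<in> K - C"
      have "x \<notin> T"
      proof
        assume "x \<in> T"
        then obtain w where "w \<in> F" "x \<in> O' w" using F(3) by blast
        then have "x \<in> U w" using O'[OF FT] x by blast
        then show False using x \<open>w \<in> F\<close> unfolding C_def by blast
      qed
      then show "x \<in> ball y r" using x by (simp add: T_def)
    qed
    show "finite B" using F(2) by (simp add: B_def)
    show BK: "B \<subseteq> K" using zU FT by (auto simp: B_def)
    have "(K - C) \<union> B = (K - (\<Union>w\<in>F. U w)) \<union> B"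
      by (auto simp: C_def B_def)
    moreover have "closedin (top_of_set K) (K - (\<Union>w\<in>F. U w))"
      using zU FT by (intro closedin_diff openin_Union) auto
    moreover have "closedin (top_of_set K) B"
      using BK \<open>finite B\<close> by (simp add: closedin_closed_eq finite_imp_closed closed_subset)
    ultimately show "closedin (top_of_set K) ((K - C) \<union> B)" by (metis closedin_Un)
  qed
qed

text \<open>Off a finite set the dendrite is cut into small open pieces; \<open>a\<close> selects a point of each piece.\<close>

lemma finite_cut_set:
  assumes r: "r > 0"
  obtains Z and a :: "'v \<Rightarrow> 'v" where "finite Z" "Z \<subseteq> K" "finite (a ` (K - Z))"
    "\<And>y. y \<in> K - Z \<Longrightarrow> a y \<in> K \<and> dist y (a y) < r"
    "\<And>v. openin (top_of_set K) {y\<in>K - Z. a y = v}"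
proof -
  have "\<exists>V B. openin (top_of_set K) V \<and> y \<in> V \<and> V \<subseteq> ball y (r/2) \<and> finite B \<and> B \<subseteq> K \<and> closedin (top_of_set K) (V \<union> B)"
    if "y \<in> K" for y
    using finite_boundary_neighbourhood[OF that, of "r/2"] r by (metis half_gt_zero)
  then obtain V B where VB: "\<And>y. y \<in> K \<Longrightarrow> openin (top_of_set K) (V y) \<and> y \<in> V y \<and> V y \<subseteq> ball y (r/2) \<and> finite (B y) \<and> B y \<subseteq> K \<and> closedin (top_of_set K) (V y \<union> B y)"
    by metis
  then have "\<forall>w\<in>K. \<exists>O'. open O' \<and> V w = K \<inter> O'" by (auto simp: openin_open)
  then obtain O' where O': "\<And>w. w \<in> K \<Longrightarrow> open (O' w) \<and> V w = K \<inter> O' w" by metis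
  obtain F where F: "F \<subseteq> K" "finite F" "K \<subseteq> (\<Union>w\<in>F. O' w)"
  proof (rule compactE_image[OF compact_K, of K O'])
    show "K \<subseteq> (\<Union>w\<in>K. O' w)"
    proof
      fix w assume "w \<in> K"
      then have "w \<in> O' w" using VB[of w] O'[of w] by blast
      then show "w \<in> (\<Union>w\<in>K. O' w)" using \<open>w \<in> K\<close> by blast
    qed
  qed (use O' in auto)
  have FK: "w \<in> K" if "w \<in> F" for w using that F(1) by blast
  define Z where "Z = (\<Union>w\<in>F. B w)"
  have finZ: "finite Z" unfolding Z_def using F(2) VB FK by auto
  have ZK: "Z \<subseteq> K" unfolding Z_def using VB FK by blast
  \<comment> \<open>The signature of a point records which sets \<open>V w\<close> contain it. As
    \<open>a\<close> depends on the signature only, it takes finitely many values, and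
    \<open>y\<close> and \<open>a y\<close> lie in a common small set \<open>V w\<close>.\<close>
  define sig where "sig y = {w\<in>F. y \<in> V w}" for y
  define a where "a y = (SOME x. x \<in> K - Z \<and> sig x = sig y)" for y
  have a: "a y \<in> K - Z \<and> sig (a y) = sig y" if "y \<in> K - Z" for y
    unfolding a_def by (rule someI[of _ y]) (use that in auto)
  \<comment> \<open>Off \<open>Z\<close> the boundary points are absent, so each \<open>V w\<close>
    is relatively open and closed there and the signature is locally constant.\<close>
  have opsig: "openin (top_of_set K) {y\<in>K - Z. sig y = S}" if "S \<subseteq> F" for S
  proof -
    have fS: "finite S" "finite (F - S)" using F(2) that finite_subset by auto
    have eq: "{y\<in>K - Z. sig y = S} = ((K - Z) - (\<Union>w\<in>F - S. V w \<union> B w)) \<inter> (K - (\<Union>w\<in>S. K - V w))"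
      using that by (auto simp: sig_def Z_def)
    have o1: "openin (top_of_set K) (K - Z)"
      using ZK finZ by (intro openin_diff) (auto simp: finite_imp_closed closed_subset)
    have c1: "closedin (top_of_set K) (\<Union>w\<in>F - S. V w \<union> B w)"
      using VB FK fS by (intro closedin_Union) auto
    have o2: "openin (top_of_set K) (K - (\<Union>w\<in>S. K - V w))"
      using VB FK fS that by (intro openin_diff closedin_Union) (auto intro!: closedin_diff)
    show ?thesis unfolding eq by (rule openin_Int[OF openin_diff[OF o1 c1] o2])
  qed
  show thesis
  proof (rule that[OF finZ ZK, of a])
    have "a ` (K - Z) \<subseteq> (\<lambda>S. SOME x. x \<in> K - Z \<and> sig x = S) ` Pow F"
      by (auto simp: a_def sig_def)
    then show "finite (a ` (K - Z))" using F(2) by (meson finite_Pow_iff finite_imageI finite_subset)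
  next
    fix y assume y: "y \<in> K - Z"
    then obtain w where w: "w \<in> F" "y \<in> O' w" using F(3) by blast
    then have "y \<in> V w" using O'[OF FK] y by blast
    then have "w \<in> sig y" using w by (simp add: sig_def)
    then have "a y \<in> V w" using a[OF y] by (auto simp: sig_def)
    then have "dist w y < r/2" "dist w (a y) < r/2" using VB[OF FK[OF w(1)]] \<open>y \<in> V w\<close> by auto
    then show "a y \<in> K \<and> dist y (a y) < r" using a[OF y] dist_triangle3[of y "a y" w] by auto
  next
    fix v
    have "{y\<in>K - Z. a y = v} = (\<Union>S\<in>{S. S \<subseteq> F \<and> (\<exists>y\<in>K - Z. sig y = S \<and> a y = v)}. {y\<in>K - Z. sig y = S})" (is "?L = ?R")
    proof
      show "?L \<subseteq> ?R" by (auto simp: sig_def)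
      show "?R \<subseteq> ?L"
      proof
        fix x assume "x \<in> ?R"
        then obtain y where y: "y \<in> K - Z" "a y = v" "x \<in> K - Z" "sig x = sig y" by auto
        then have "a x = a y" by (simp add: a_def)
        then show "x \<in> ?L" using y by simp
      qed
    qed
    moreover have "openin (top_of_set K) ?R" using opsig by (intro openin_Union) auto
    ultimately show "openin (top_of_set K) {y\<in>K - Z. a y = v}" by simp
  qed
qed

end

section \<open>Perturbation of maps into dendrites\<close>

lemma continuous_map_locally:
  assumes "\<And>x. x \<in> topspace X \<Longrightarrow> \<exists>U h. openin X U \<and> x \<in> U \<and> continuous_map X Y h \<and> (\<forall>u\<in>U. g u = h u)"
  shows "continuous_map X Y g"
proof -
  obtain U h where U: "\<And>x. x \<in> topspace X \<Longrightarrow> openin X (U x) \<and> x \<in> U x \<and> continuous_map X Y (h x) \<and> (\<forall>u\<in>U x. g u = h x u)"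
    using assms by metis
  show ?thesis
  proof (rule pasting_lemma[where I="topspace X" and T=U and f="\<lambda>_. g"])
    show "continuous_map (subtopology X (U x)) Y g" if "x \<in> topspace X" for x
      using continuous_map_eq[OF continuous_map_from_subtopology[of X Y "h x" "U x"], of g] U[OF that]
      by (simp add: topspace_subtopology)
  qed (use U in auto)
qed

text \<open>The Urysohn functions \<open>w A\<close> compete: \<open>P A\<close> demands that
  \<open>w A\<close> exceed every other \<open>w B\<close> by at least 1/2, which cannot hold for
  two sets at once. On \<open>A\<close> itself \<open>w A\<close> is 1 and the others are 0.\<close>

lemma closed_neighbourhoods_of_disjoint_family:
  assumes X: "normal_space X" and \<A>: "finite \<A>" "disjoint \<A>" "\<And>A. A \<in> \<A> \<Longrightarrow> closedin X A"
    and N: "\<And>A. A \<in> \<A> \<Longrightarrow> openin X (N A) \<and> A \<subseteq> N A"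
  obtains P Q where "\<And>A. A \<in> \<A> \<Longrightarrow> closedin X (P A) \<and> openin X (Q A) \<and> A \<subseteq> Q A \<and> Q A \<subseteq> P A \<and> P A \<subseteq> N A"
    "\<And>A B. A \<in> \<A> \<Longrightarrow> B \<in> \<A> \<Longrightarrow> A \<noteq> B \<Longrightarrow> P A \<inter> P B = {}"
proof -
  have "\<exists>w. continuous_map X (top_of_set {0..1::real}) w \<and> w ` (topspace X - (N A - \<Union>(\<A> - {A}))) \<subseteq> {0} \<and> w ` A \<subseteq> {1}"
    if A: "A \<in> \<A>" for A
  proof -
    have "closedin X (\<Union>(\<A> - {A}))" using \<A> by (intro closedin_Union) auto
    then have "openin X (N A - \<Union>(\<A> - {A}))" using N[OF A] by (intro openin_diff) auto
    then have "closedin X (topspace X - (N A - \<Union>(\<A> - {A})))" by blast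
    moreover have "disjnt (topspace X - (N A - \<Union>(\<A> - {A}))) A"
      using N[OF A] \<A>(2) A unfolding disjnt_def disjoint_def by fastforce
    ultimately show ?thesis using Urysohn_lemma[OF X _ \<A>(3)[OF A], of _ 0 1] by (metis zero_le_one)
  qed
  then obtain w where w: "\<And>A. A \<in> \<A> \<Longrightarrow> continuous_map X (top_of_set {0..1::real}) (w A) \<and>
      w A ` (topspace X - (N A - \<Union>(\<A> - {A}))) \<subseteq> {0} \<and> w A ` A \<subseteq> {1}"
    by metis
  have wc: "continuous_map X euclideanreal (w A)" if "A \<in> \<A>" for A
    using w[OF that] by (simp add: continuous_map_in_subtopology)
  define P where "P A = {x\<in>topspace X. w A x \<in> {1/2..}} \<inter> (topspace X - (\<Union>B\<in>\<A> - {A}. {x\<in>topspace X. w A x - w B x \<in> {..<1/2}}))" for A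
  define Q where "Q A = {x\<in>topspace X. w A x \<in> {1/2<..}} \<inter> (topspace X - (\<Union>B\<in>\<A> - {A}. {x\<in>topspace X. w A x - w B x \<in> {..1/2}}))" for A
  show thesis
  proof (rule that[of P Q])
    fix A assume A: "A \<in> \<A>"
    have diff: "continuous_map X euclideanreal (\<lambda>x. w A x - w B x)" if "B \<in> \<A>" for B
      by (intro continuous_map_diff wc A that)
    have "closedin X (P A)"
      unfolding P_def
      using closedin_continuous_map_preimage[OF wc[OF A], of "{1/2..}"] \<A>(1)
        openin_continuous_map_preimage[OF diff, of _ "{..<1/2}"]
      by (intro closedin_Int closedin_diff openin_Union) auto
    moreover have "openin X (Q A)"
      unfolding Q_def
      using openin_continuous_map_preimage[OF wc[OF A], of "{1/2<..}"] \<A>(1)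
        closedin_continuous_map_preimage[OF diff, of _ "{..1/2}"]
      by (intro openin_Int openin_diff closedin_Union) auto
    moreover have "A \<subseteq> Q A"
    proof
      fix x assume x: "x \<in> A"
      then have xX: "x \<in> topspace X" using \<A>(3)[OF A] closedin_subset by blast
      have "w A x = 1" using w[OF A] x by blast
      moreover have "w B x = 0" if B: "B \<in> \<A> - {A}" for B
      proof -
        have "x \<in> \<Union>(\<A> - {B})" using x A B by blast
        then show ?thesis using w[of B] B xX by blast
      qed
      ultimately show "x \<in> Q A" using xX by (auto simp: Q_def)
    qed
    moreover have "Q A \<subseteq> P A" by (auto simp: Q_def P_def)
    moreover have "P A \<subseteq> N A"
    proof
      fix x assume "x \<in> P A"
      then have "x \<in> topspace X" "w A x \<noteq> 0" by (auto simp: P_def)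
      then show "x \<in> N A" using w[OF A] by blast
    qed
    ultimately show "closedin X (P A) \<and> openin X (Q A) \<and> A \<subseteq> Q A \<and> Q A \<subseteq> P A \<and> P A \<subseteq> N A" by blast
  next
    fix A B assume AB: "A \<in> \<A>" "B \<in> \<A>" "A \<noteq> B"
    show "P A \<inter> P B = {}"
    proof (rule ccontr)
      assume "\<not> ?thesis"
      then obtain x where x: "x \<in> P A" "x \<in> P B" by blast
      have "B \<in> \<A> - {A}" "A \<in> \<A> - {B}" using AB by blast+
      then have "x \<notin> {x\<in>topspace X. w A x - w B x \<in> {..<1/2}}" "x \<notin> {x\<in>topspace X. w B x - w A x \<in> {..<1/2}}"
        using x unfolding P_def by blast+
      moreover have "x \<in> topspace X" using x by (simp add: P_def)
      ultimately have "w A x - w B x \<ge> 1/2" "w B x - w A x \<ge> 1/2" by auto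
      then show False by linarith
    qed
  qed
qed

context dendrite_set
begin

text \<open>Away from a finite cut set \<open>Z\<close>, \<open>f\<close> is replaced by the locally
  constant \<open>a \<circ> f\<close>; near \<open>z\<close> in \<open>Z\<close> the values run
  along a short path from \<open>a (f x)\<close> to \<open>z\<close>, steered by a Urysohn function.
  A set \<open>A\<close> on which \<open>f\<close> varies little either comes close to some
  \<open>z\<close>, and then the steering sends all of it to \<open>z\<close>, or it stays away from
  \<open>Z\<close>, and then \<open>a \<circ> f\<close> is constant on it.\<close>

lemma approximation_constant_on_closed_sets:
  fixes X :: "'a topology"
  assumes X: "normal_space X" and f: "continuous_map X (top_of_set K) f" and \<epsilon>: "\<epsilon> > 0"
  shows "\<exists>\<eta>>0. \<forall>\<A>. finite \<A> \<and> disjoint \<A> \<and> {} \<notin> \<A> \<and>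
      (\<forall>A\<in>\<A>. closedin X A \<and> (\<forall>x\<in>A. \<forall>y\<in>A. dist (f x) (f y) < \<eta>)) \<longrightarrow>
      (\<exists>g. continuous_map X (top_of_set K) g \<and> (\<forall>x\<in>topspace X. dist (g x) (f x) < \<epsilon>) \<and>
        (\<forall>A\<in>\<A>. \<exists>c\<in>K. \<forall>x\<in>A. g x = c))"
proof -
  have fK: "f x \<in> K" if "x \<in> topspace X" for x
    using f that by (auto simp: continuous_map_in_subtopology)
  have fc: "continuous_map X euclidean f" using f by (simp add: continuous_map_in_subtopology)
  have op: "openin X {x\<in>topspace X. f x \<in> T}" if "open T" for T
    using openin_continuous_map_preimage[OF fc] that by simp
  have cl: "closedin X {x\<in>topspace X. f x \<in> T}" if "closed T" for T
    using closedin_continuous_map_preimage[OF fc] that by simp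
  have "\<epsilon>/4 > 0" using \<epsilon> by simp
  then obtain \<delta>1 where \<delta>1: "\<delta>1 > 0" "\<And>x y. x \<in> K \<Longrightarrow> y \<in> K \<Longrightarrow> dist x y < \<delta>1 \<Longrightarrow>
      \<exists>g. path g \<and> path_image g \<subseteq> K \<inter> ball x (\<epsilon>/4) \<and> pathstart g = x \<and> pathfinish g = y"
    by (rule small_paths[OF compact_K locally_connected_K]) (rule that)
  define \<delta> where "\<delta> = min \<delta>1 (\<epsilon>/4)"
  have \<delta>: "\<delta> > 0" "\<delta> \<le> \<epsilon>/4" using \<delta>1 \<epsilon> by (auto simp: \<delta>_def)
  have "\<forall>x y. \<exists>g. x \<in> K \<and> y \<in> K \<and> dist x y < \<delta> \<longrightarrow>
      path g \<and> path_image g \<subseteq> K \<inter> ball x (\<epsilon>/4) \<and> pathstart g = x \<and> pathfinish g = y"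
    using \<delta>1(2) by (simp add: \<delta>_def)
  then obtain \<gamma> where \<gamma>: "\<And>x y. x \<in> K \<Longrightarrow> y \<in> K \<Longrightarrow> dist x y < \<delta> \<Longrightarrow>
      path (\<gamma> x y) \<and> path_image (\<gamma> x y) \<subseteq> K \<inter> ball x (\<epsilon>/4) \<and> pathstart (\<gamma> x y) = x \<and> pathfinish (\<gamma> x y) = y"
    by metis
  have "\<delta>/2 > 0" using \<delta> by simp
  then obtain Z and a :: "'v \<Rightarrow> 'v" where Z: "finite Z" "Z \<subseteq> K" "finite (a ` (K - Z))"
    "\<And>y. y \<in> K - Z \<Longrightarrow> a y \<in> K \<and> dist y (a y) < \<delta>/2"
    "\<And>v. openin (top_of_set K) {y\<in>K - Z. a y = v}"
    by (rule finite_cut_set) (rule that)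
  \<comment> \<open>\<open>s\<close> is at most half of every distance between distinct points of
    \<open>Z\<close>, so a value is within \<open>s\<close> of at most one of them.\<close>
  define S where "S = insert (\<delta>/2) ((\<lambda>(z,z'). dist z z' / 2) ` {(z,z')\<in>Z \<times> Z. z \<noteq> z'})"
  define s where "s = Min S"
  have "finite {(z,z')\<in>Z \<times> Z. z \<noteq> z'}"
    by (rule finite_subset[of _ "Z \<times> Z"]) (use Z(1) in auto)
  then have finS: "finite S" by (simp add: S_def)
  have s0: "s > 0" using finS \<delta> by (auto simp: s_def S_def)
  have s\<delta>: "s \<le> \<delta>/2" unfolding s_def using finS by (intro Min_le) (simp_all add: S_def)
  have sZ: "2 * s \<le> dist z z'" if "z \<in> Z" "z' \<in> Z" "z \<noteq> z'" for z z'
  proof -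
    have "dist z z' / 2 \<in> S" using that by (auto simp: S_def)
    then have "s \<le> dist z z' / 2" unfolding s_def using finS by (intro Min_le) auto
    then show ?thesis by simp
  qed
  have uniq: "z = z'" if "z \<in> Z" "z' \<in> Z" "dist y z < s" "dist y z' < s" for z z' y
  proof (rule ccontr)
    assume "z \<noteq> z'"
    then show False using sZ[OF that(1,2)] that(3,4) dist_triangle3[of z z' y] by linarith
  qed
  \<comment> \<open>On this compact set away from \<open>Z\<close> the locally constant
    \<open>a\<close> has a uniform scale \<open>\<delta>2\<close>.\<close>
  define K' where "K' = K - (\<Union>z\<in>Z. ball z (s/2))"
  have cK': "compact K'" unfolding K'_def using compact_K by (intro compact_diff) auto
  have "\<forall>v. \<exists>T. open T \<and> {y\<in>K - Z. a y = v} = K \<inter> T" using Z(5) by (simp add: openin_open)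
  then obtain T where T': "\<forall>v. open (T v) \<and> {y\<in>K - Z. a y = v} = K \<inter> T v" by (rule exE[OF choice])
  have opT: "open (T v)" for v by (rule conjunct1[OF spec[OF T']])
  have T: "y \<in> T v \<longleftrightarrow> y \<notin> Z \<and> a y = v" if "y \<in> K" for y v
  proof -
    have "y \<in> {y\<in>K - Z. a y = v} \<longleftrightarrow> y \<in> K \<inter> T v"
      by (rule arg_cong[OF conjunct2[OF spec[OF T']], of "\<lambda>A. y \<in> A"])
    then show ?thesis using that by simp
  qed
  have K'Z: "y \<in> K" "y \<notin> Z" if "y \<in> K'" for y
  proof -
    have "y \<in> ball y (s/2)" using s0 by simp
    then show "y \<in> K" "y \<notin> Z" using that unfolding K'_def by blast+
  qed
  obtain \<delta>2 where \<delta>2: "\<delta>2 > 0" "\<forall>y\<in>K'. \<exists>G\<in>range T. ball y \<delta>2 \<subseteq> G"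
  proof (rule Heine_Borel_lemma[OF cK', of "range T"])
    show "K' \<subseteq> \<Union>(range T)"
    proof
      fix y assume y: "y \<in> K'"
      then have "y \<in> T (a y)" using K'Z[OF y] T[of y "a y"] by blast
      then show "y \<in> \<Union>(range T)" by blast
    qed
  qed (use opT in blast)+
  have a_const: "a y = a y'" if "y \<in> K'" "y' \<in> K'" "dist y y' < \<delta>2" for y y'
  proof -
    from bspec[OF \<delta>2(2) that(1)] obtain v where v: "ball y \<delta>2 \<subseteq> T v" by (elim bexE rangeE) simp
    have "y \<in> ball y \<delta>2" "y' \<in> ball y \<delta>2" using that \<delta>2(1) by auto
    then have "y \<in> T v" "y' \<in> T v" using v by blast+
    then show ?thesis
      using T[OF K'Z(1)[OF that(1)], of v] T[OF K'Z(1)[OF that(2)], of v] by simp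
  qed
  define \<eta> where "\<eta> = min \<delta>2 (s/8)"
  have \<eta>: "\<eta> > 0" using \<delta>2 s0 by (simp add: \<eta>_def)
  show ?thesis
  proof (intro exI[of _ \<eta>] conjI \<eta> allI impI)
    fix \<A> assume fam: "finite \<A> \<and> disjoint \<A> \<and> {} \<notin> \<A> \<and>
      (\<forall>A\<in>\<A>. closedin X A \<and> (\<forall>x\<in>A. \<forall>y\<in>A. dist (f x) (f y) < \<eta>))"
    then have \<A>: "finite \<A>" "disjoint \<A>" "{} \<notin> \<A>" by simp_all
    have cA: "closedin X A" if "A \<in> \<A>" for A using fam that by simp
    have osc: "dist (f x) (f y) < \<eta>" if "A \<in> \<A>" "x \<in> A" "y \<in> A" for A x y using fam that by simp
    have AX: "x \<in> topspace X" if "A \<in> \<A>" "x \<in> A" for x A using cA[OF that(1)] that(2) closedin_subset by blast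
    \<comment> \<open>The radii are staggered. A set that comes within \<open>s / 2\<close> of
      \<open>z\<close> stays within \<open>5 * s / 8\<close>, clear of the region beyond
      \<open>3 * s / 4\<close>; a set that does not stays outside \<open>s / 4\<close>. So whole
      members of the family can be put into \<open>one\<close> or \<open>zero\<close> without making
      these meet.\<close>
    define ty where "ty z A \<longleftrightarrow> (\<exists>x\<in>A. dist (f x) z \<le> s/2)" for z A
    have ty: "dist (f x) z \<le> 5 * s / 8" if "A \<in> \<A>" "ty z A" "x \<in> A" for z A x
    proof -
      from that(2) obtain x' where "x' \<in> A" "dist (f x') z \<le> s/2" by (auto simp: ty_def)
      then show ?thesis using osc[OF that(1) that(3), of x'] dist_triangle[of "f x" z "f x'"] by (simp add: \<eta>_def)
    qed
    have nty: "dist (f x) z > s/2" if "\<not> ty z A" "x \<in> A" for z A x using that by (force simp: ty_def)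
    define one where "one z = {x\<in>topspace X. f x \<in> cball z (s/4)} \<union> \<Union>{A\<in>\<A>. ty z A}" for z
    define zero where "zero z = {x\<in>topspace X. f x \<in> - ball z (3 * s / 4)} \<union> \<Union>{A\<in>\<A>. \<not> ty z A}" for z
    have c1: "closedin X (one z)" and c0: "closedin X (zero z)" for z
      unfolding one_def zero_def using \<A>(1) cA by (intro closedin_Un closedin_Union cl; auto)+
    have "disjnt (zero z) (one z)" for z
    proof -
      have False if x: "x \<in> zero z" "x \<in> one z" for x
      proof -
        consider "3 * s / 4 \<le> dist (f x) z" | A where "A \<in> \<A>" "\<not> ty z A" "x \<in> A"
          using x(1) by (auto simp: zero_def dist_commute)
        then show False
        proof cases
          case 1
          consider "dist (f x) z \<le> s/4" | A where "A \<in> \<A>" "ty z A" "x \<in> A"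
            using x(2) by (auto simp: one_def dist_commute)
          then show False using 1 s0 ty by cases fastforce+
        next
          case 2
          consider "dist (f x) z \<le> s/4" | B where "B \<in> \<A>" "ty z B" "x \<in> B"
            using x(2) by (auto simp: one_def dist_commute)
          then show False
          proof cases
            case 1
            then show False using nty[OF 2(2,3)] s0 by linarith
          next
            case B: 2
            then have "A = B" using \<A>(2) 2 unfolding disjoint_def by blast
            then show False using B 2 by simp
          qed
        qed
      qed
      then show ?thesis by (auto simp: disjnt_iff)
    qed
    then have "\<exists>l. continuous_map X (top_of_set {0..1::real}) l \<and> l ` zero z \<subseteq> {0} \<and> l ` one z \<subseteq> {1}" for z
      using Urysohn_lemma[OF X c0 c1, of z z 0 1] by (metis zero_le_one)
    then obtain l where l: "\<And>z. continuous_map X (top_of_set {0..1::real}) (l z) \<and> l z ` zero z \<subseteq> {0} \<and> l z ` one z \<subseteq> {1}"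
      by metis
    have l01: "l z x \<in> {0..1}" if "x \<in> topspace X" for z x
      using l[of z] that unfolding continuous_map_in_subtopology by blast
    have l1: "l z x = 1" if "x \<in> one z" for z x using l[of z] that by blast
    have l0: "l z x = 0" if "x \<in> zero z" for z x using l[of z] that by blast
    define zz where "zz y = (SOME z. z \<in> Z \<and> dist y z < s)" for y
    have zz: "zz y = z" if "z \<in> Z" "dist y z < s" for y z
    proof -
      have "zz y \<in> Z \<and> dist y (zz y) < s" unfolding zz_def by (rule someI[of _ z]) (use that in auto)
      then show ?thesis using uniq that by blast
    qed
    \<comment> \<open>The path parameter is 1 close to \<open>z\<close> and 0 near the rim of the
      ball of radius \<open>s\<close>, so the three clauses agree where they meet.\<close>
    define g where "g x = (if f x \<in> Z then f x else if \<exists>z\<in>Z. dist (f x) z < s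
      then \<gamma> (a (f x)) (zz (f x)) (l (zz (f x)) x) else a (f x))" for x
    have g_near: "g x = \<gamma> (a (f x)) z (l z x)" if "f x \<notin> Z" "z \<in> Z" "dist (f x) z < s" for x z
      using that zz[OF that(2,3)] by (auto simp: g_def)
    have av: "dist (a (f x)) z < \<delta> \<and> a (f x) \<in> K \<and> z \<in> K" if "x \<in> topspace X" "f x \<notin> Z" "z \<in> Z" "dist (f x) z < s" for x z
    proof -
      have "dist (f x) (a (f x)) < \<delta>/2" "a (f x) \<in> K" using Z(4) fK that by auto
      then show ?thesis using that s\<delta> dist_triangle3[of "a (f x)" z "f x"] Z(2) by auto
    qed
    have g_one: "g x = z" if x: "x \<in> topspace X" "z \<in> Z" "dist (f x) z < s" "x \<in> one z" for x z
    proof (cases "f x \<in> Z")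
      case True
      then have "f x = z" using uniq[OF _ x(2), of "f x" "f x"] x(3) s0 by simp
      then show ?thesis using x by (simp add: g_def)
    next
      case False
      then show ?thesis using g_near[OF False x(2,3)] l1[OF x(4)] \<gamma> av[OF x(1) False x(2,3)]
        by (simp add: pathfinish_def)
    qed
    have g_zero: "g x = a (f x)" if x: "x \<in> topspace X" "f x \<notin> Z" "\<And>z. z \<in> Z \<Longrightarrow> x \<in> zero z" for x
    proof (cases "\<exists>z\<in>Z. dist (f x) z < s")
      case True
      then obtain z where z: "z \<in> Z" "dist (f x) z < s" by blast
      then show ?thesis using g_near[OF x(2) z] l0[OF x(3)[OF z(1)]] \<gamma> av[OF x(1,2) z]
        by (simp add: pathstart_def)
    next
      case False
      then show ?thesis using x by (simp add: g_def)
    qed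
    have "continuous_map X (top_of_set K) g"
    proof (rule continuous_map_locally)
      fix x assume x: "x \<in> topspace X"
      consider (a) z where "z \<in> Z" "dist (f x) z < s/4" | (b) z where "f x \<notin> Z" "z \<in> Z" "dist (f x) z < s"
        | (c) "f x \<notin> Z" "\<And>z. z \<in> Z \<Longrightarrow> dist (f x) z \<ge> s"
        using s0 by (metis dist_self divide_pos_pos not_le zero_less_numeral)
      then show "\<exists>U h. openin X U \<and> x \<in> U \<and> continuous_map X (top_of_set K) h \<and> (\<forall>u\<in>U. g u = h u)"
      proof cases
        case a
        have "g u = z" if "u \<in> {x\<in>topspace X. f x \<in> ball z (s/4)}" for u
          using that s0 a by (intro g_one) (auto simp: one_def dist_commute)
        then show ?thesis using op[of "ball z (s/4)"] x a Z(2)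
          by (intro exI[of _ "{x\<in>topspace X. f x \<in> ball z (s/4)}"] exI[of _ "\<lambda>_. z"]) (auto simp: dist_commute)
      next
        case b
        define v where "v = a (f x)"
        define U where "U = {x\<in>topspace X. f x \<in> T v} \<inter> {x\<in>topspace X. f x \<in> ball z s}"
        have Uv: "f u \<notin> Z \<and> a (f u) = v" if "u \<in> U" for u
        proof -
          have "f u \<in> T v" "f u \<in> K" using that fK by (auto simp: U_def)
          then show ?thesis using T[of "f u" v] by blast
        qed
        have vz: "dist v z < \<delta> \<and> v \<in> K \<and> z \<in> K" unfolding v_def using av[OF x b] .
        have "g u = \<gamma> v z (l z u)" if "u \<in> U" for u
        proof -
          have "dist (f u) z < s" using that by (auto simp: U_def dist_commute)
          then show ?thesis using Uv[OF that] g_near[of u z] b by simp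
        qed
        moreover have "openin X U" unfolding U_def using opT by (intro openin_Int op) auto
        moreover have "x \<in> U"
        proof -
          have "f x \<in> T v" using b fK[OF x] T[of "f x" v] by (simp add: v_def)
          then show ?thesis using x b by (simp add: U_def dist_commute)
        qed
        moreover have "continuous_map X (top_of_set K) (\<lambda>u. \<gamma> v z (l z u))"
        proof -
          have "continuous_map (top_of_set {0..1}) (top_of_set K) (\<gamma> v z)"
            using \<gamma>[of v z] vz by (auto simp: path_def path_image_def continuous_map_in_subtopology)
          from continuous_map_compose[OF conjunct1[OF l[of z]] this] show ?thesis by (simp add: o_def)
        qed
        ultimately show ?thesis by blast
      next
        case c
        define v where "v = a (f x)"
        define U where "U = {x\<in>topspace X. f x \<in> T v} \<inter> {x\<in>topspace X. f x \<in> - (\<Union>z\<in>Z. cball z (3 * s / 4))}"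
        have Uv: "f u \<notin> Z \<and> a (f u) = v" if "u \<in> U" for u
        proof -
          have "f u \<in> T v" "f u \<in> K" using that fK by (auto simp: U_def)
          then show ?thesis using T[of "f u" v] by blast
        qed
        have "g u = v" if u: "u \<in> U" for u
        proof -
          have "u \<in> zero z" if "z \<in> Z" for z using u that by (auto simp: U_def zero_def)
          then show ?thesis using g_zero[of u] Uv[OF u] u by (auto simp: U_def)
        qed
        moreover have "openin X U"
          unfolding U_def using opT Z(1) by (intro openin_Int op open_Compl closed_UN) auto
        moreover have "x \<in> U"
        proof -
          have "f x \<in> T v" using c fK[OF x] T[of "f x" v] by (simp add: v_def)
          moreover have "dist z (f x) > 3 * s / 4" if "z \<in> Z" for z using c(2)[OF that] s0 by (simp add: dist_commute)
          ultimately show ?thesis using x by (force simp: U_def)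
        qed
        moreover have "v \<in> K" using Z(4) fK[OF x] c by (simp add: v_def)
        then have "continuous_map X (top_of_set K) (\<lambda>_. v)" by simp
        ultimately show ?thesis by blast
      qed
    qed
    moreover have "dist (g x) (f x) < \<epsilon>" if x: "x \<in> topspace X" for x
    proof (cases "f x \<in> Z")
      case True
      then show ?thesis using \<epsilon> by (simp add: g_def)
    next
      case False
      then have d: "dist (f x) (a (f x)) < \<delta>/2" using Z(4) fK[OF x] by auto
      show ?thesis
      proof (cases "\<exists>z\<in>Z. dist (f x) z < s")
        case True
        then obtain z where z: "z \<in> Z" "dist (f x) z < s" by blast
        have "g x \<in> path_image (\<gamma> (a (f x)) z)"
          using g_near[OF False z] l01[OF x] by (auto simp: path_image_def)
        then have "dist (a (f x)) (g x) < \<epsilon>/4" using \<gamma> av[OF x False z] by fastforce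
        then show ?thesis using d \<delta> \<epsilon> dist_triangle[of "f x" "g x" "a (f x)"] by (simp add: dist_commute)
      next
        case 2: False
        then show ?thesis using False d \<delta> \<epsilon> by (simp add: g_def dist_commute)
      qed
    qed
    moreover have "\<exists>c\<in>K. \<forall>x\<in>A. g x = c" if A: "A \<in> \<A>" for A
    proof (cases "\<exists>z\<in>Z. ty z A")
      case True
      then obtain z where z: "z \<in> Z" "ty z A" by blast
      have "g x = z" if "x \<in> A" for x
      proof (rule g_one)
        show "dist (f x) z < s" using ty[OF A z(2) that] s0 by simp
        show "x \<in> one z" using A z that by (auto simp: one_def)
      qed (use AX A that z in auto)
      then show ?thesis using z Z(2) by blast
    next
      case False
      have "A \<noteq> {}" using A \<A>(3) by auto
      then obtain x0 where x0: "x0 \<in> A" by auto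
      have K': "f x \<in> K'" if "x \<in> A" for x
      proof -
        have "dist z (f x) > s/2" if "z \<in> Z" for z using nty[OF _ \<open>x \<in> A\<close>] False that by (metis dist_commute)
        then show ?thesis using fK[OF AX[OF A that]] by (force simp: K'_def)
      qed
      have "g x = a (f x0)" if "x \<in> A" for x
      proof -
        have "a (f x) = a (f x0)" using K' x0 that osc[OF A that x0] by (intro a_const) (auto simp: \<eta>_def)
        moreover have "g x = a (f x)"
          using K'Z(2)[OF K'[OF that]] AX[OF A that] False A that by (intro g_zero) (auto simp: zero_def)
        ultimately show ?thesis by simp
      qed
      moreover have "a (f x0) \<in> K" using Z(4) fK[OF AX[OF A x0]] K'Z(2)[OF K'[OF x0]] by blast
      ultimately show ?thesis by blast
    qed
    ultimately show "\<exists>g. continuous_map X (top_of_set K) g \<and> (\<forall>x\<in>topspace X. dist (g x) (f x) < \<epsilon>) \<and>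
        (\<forall>A\<in>\<A>. \<exists>c\<in>K. \<forall>x\<in>A. g x = c)" by blast
  qed
qed

end

text \<open>A neighbourhood \<open>U\<close> whose frontier is a single point \<open>q\<close> can
  be collapsed to \<open>q\<close>: the constant map on the closure of \<open>U\<close> and the
  identity off \<open>U\<close> agree at \<open>q\<close>. This is the reason for working with
  end-points.\<close>

lemma end_point_collapse:
  fixes K :: "'v::metric_space set"
  assumes e: "e \<in> end_points (top_of_set K)" and r: "r > 0"
  obtains \<rho> where "continuous_on K \<rho>" "\<rho> ` K \<subseteq> K"
    "\<And>y. y \<in> K \<Longrightarrow> \<rho> y \<noteq> e \<and> (\<rho> y = y \<or> dist e y < r \<and> dist e (\<rho> y) < r)"
proof -
  define W where "W = K \<inter> ball e (r/2)"
  have eK: "e \<in> K" using e by (simp add: end_points_def)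
  have "openin (top_of_set K) W \<and> e \<in> W" using eK r by (auto simp: W_def)
  then obtain U q where U: "openin (top_of_set K) U" "e \<in> U" "U \<subseteq> W" "top_of_set K frontier_of U = {q}"
    using e unfolding end_points_def by blast
  define C where "C = top_of_set K closure_of U"
  have cC: "closedin (top_of_set K) C" by (simp add: C_def)
  have "C \<subseteq> K \<inter> cball e (r/2)"
    unfolding C_def
  proof (rule closure_of_minimal)
    show "U \<subseteq> K \<inter> cball e (r/2)" using U(3) by (auto simp: W_def)
    show "closedin (top_of_set K) (K \<inter> cball e (r/2))" by (simp add: closedin_closed_Int)
  qed
  moreover have fr: "C - U = {q}"
    using U(4) interior_of_openin[OF U(1)] by (simp add: frontier_of_def C_def)
  ultimately have q: "q \<in> K" "dist e q \<le> r/2" "q \<notin> U" by auto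
  have UC: "U \<subseteq> C" unfolding C_def by (rule closure_of_subset[OF openin_subset[OF U(1)]])
  have CK: "C \<union> (K - U) = K" using cC UC closedin_subset by fastforce
  define \<rho> where "\<rho> y = (if y \<in> U then q else y)" for y
  show thesis
  proof (rule that[of \<rho>])
    have "continuous_on (C \<union> (K - U)) \<rho>"
      unfolding \<rho>_def
    proof (rule continuous_on_cases_local)
      show "closedin (top_of_set (C \<union> (K - U))) C" using cC CK by simp
      show "closedin (top_of_set (C \<union> (K - U))) (K - U)" unfolding CK using U(1) by (simp add: closedin_diff)
      show "\<And>x. x \<in> C \<and> x \<notin> U \<or> x \<in> K - U \<and> x \<in> U \<Longrightarrow> q = x" using fr by (metis Diff_iff singletonD)
    qed auto
    then show "continuous_on K \<rho>" by (simp add: CK)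
    show "\<rho> ` K \<subseteq> K" using q by (auto simp: \<rho>_def)
    show "\<rho> y \<noteq> e \<and> (\<rho> y = y \<or> dist e y < r \<and> dist e (\<rho> y) < r)" if "y \<in> K" for y
    proof (cases "y \<in> U")
      case True
      then have "dist e y < r/2" using U(3) by (auto simp: W_def)
      then show ?thesis using True q U(2) r by (auto simp: \<rho>_def)
    next
      case False
      then show ?thesis using U(2) by (auto simp: \<rho>_def)
    qed
  qed
qed

text \<open>The end-points are removed one at a time. The radius of the new collapse stays below the
  distances from the new end-point to \<open>E\<close> and \<open>C\<close>, so it neither moves
  \<open>C\<close> nor brings values back to \<open>E\<close>.\<close>

lemma end_points_collapse:
  fixes K :: "'v::metric_space set"
  assumes "finite E" "E \<subseteq> end_points (top_of_set K)" "finite C" "E \<inter> C = {}" "r > 0"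
  shows "\<exists>\<rho>. continuous_on K \<rho> \<and> \<rho> ` K \<subseteq> K \<and> (\<forall>y\<in>K. \<rho> y \<notin> E \<and> dist (\<rho> y) y < r) \<and> (\<forall>c\<in>C \<inter> K. \<rho> c = c)"
  using assms
proof (induction E arbitrary: r)
  case empty
  then show ?case by (intro exI[of _ id]) (auto simp: continuous_on_id)
next
  case (insert e E)
  obtain \<rho>1 where \<rho>1: "continuous_on K \<rho>1" "\<rho>1 ` K \<subseteq> K" "\<forall>y\<in>K. \<rho>1 y \<notin> E \<and> dist (\<rho>1 y) y < r/2" "\<forall>c\<in>C \<inter> K. \<rho>1 c = c"
    using insert.IH[of "r/2"] insert.prems by auto
  have "finite (E \<union> C)" using insert by simp
  then obtain r0 where r0: "r0 > 0" "\<forall>x\<in>E \<union> C. x \<noteq> e \<longrightarrow> r0 \<le> dist e x"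
    using finite_set_avoid by blast
  \<comment> \<open>A collapse displaces points by less than \<open>2 * r'\<close>, hence by at most
    \<open>r / 2\<close>; the induction hypothesis uses the other half.\<close>
  define r' where "r' = min r0 (r/4)"
  have "r' > 0" using r0 insert.prems by (simp add: r'_def)
  have "e \<in> end_points (top_of_set K)" using insert.prems by simp
  then obtain \<rho>2 where \<rho>2: "continuous_on K \<rho>2" "\<rho>2 ` K \<subseteq> K"
    "\<And>y. y \<in> K \<Longrightarrow> \<rho>2 y \<noteq> e \<and> (\<rho>2 y = y \<or> dist e y < r' \<and> dist e (\<rho>2 y) < r')"
    using \<open>r' > 0\<close> by (rule end_point_collapse) (rule that)
  have far: "r' \<le> dist e x" if "x \<in> E \<union> C" for x
  proof -
    have "x \<noteq> e" using insert that by auto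
    then show ?thesis using r0(2) that by (simp add: r'_def min_le_iff_disj)
  qed
  have "continuous_on K (\<rho>2 \<circ> \<rho>1)"
    using \<rho>1 \<rho>2 by (intro continuous_on_compose) (auto intro: continuous_on_subset)
  moreover have "(\<rho>2 \<circ> \<rho>1) ` K \<subseteq> K" using \<rho>1(2) \<rho>2(2) by auto
  moreover have "(\<rho>2 \<circ> \<rho>1) y \<notin> insert e E \<and> dist ((\<rho>2 \<circ> \<rho>1) y) y < r" if y: "y \<in> K" for y
  proof -
    have u: "\<rho>1 y \<in> K" "\<rho>1 y \<notin> E" "dist (\<rho>1 y) y < r/2" using \<rho>1 y by auto
    have "\<rho>2 (\<rho>1 y) \<notin> E"
      using \<rho>2(3)[OF u(1)] u(2) far by force
    moreover have "dist (\<rho>2 (\<rho>1 y)) (\<rho>1 y) \<le> r/2"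
      using \<rho>2(3)[OF u(1)]
    proof (elim conjE disjE)
      assume "dist e (\<rho>1 y) < r'" "dist e (\<rho>2 (\<rho>1 y)) < r'"
      then show ?thesis using dist_triangle3[of "\<rho>2 (\<rho>1 y)" "\<rho>1 y" e] by (simp add: r'_def)
    qed (use insert.prems in simp)
    ultimately show ?thesis
      using \<rho>2(3)[OF u(1)] u(3) dist_triangle[of "\<rho>2 (\<rho>1 y)" y "\<rho>1 y"] by simp
  qed
  moreover have "(\<rho>2 \<circ> \<rho>1) c = c" if c: "c \<in> C \<inter> K" for c
  proof -
    have "\<rho>1 c = c" using \<rho>1(4) c by blast
    moreover have "\<rho>2 c = c" using \<rho>2(3)[of c] far[of c] c by auto
    ultimately show ?thesis by simp
  qed
  ultimately show ?case by blast
qed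

locale superdendrite_set = dendrite_set K for K :: "'v::{complete_space,real_normed_vector} set" +
  assumes nondegenerate: "\<exists>p\<in>K. \<exists>q\<in>K. p \<noteq> q"
    and dense_end_points: "top_of_set K closure_of end_points (top_of_set K) = K"
begin

text \<open>A non-degenerate connected set has no isolated points, so removing a finite set from a
  ball around \<open>c\<close> leaves a non-empty open set, which then contains an end-point by
  density.\<close>

lemma end_point_near:
  assumes c: "c \<in> K" and r: "r > 0" and F: "finite F"
  shows "\<exists>e\<in>end_points (top_of_set K). dist c e < r \<and> e \<notin> F"
proof -
  have "K \<noteq> {x}" for x using nondegenerate by blast
  then have "c islimpt K" using connected_imp_perfect[OF connected_K c] by metis
  then have "infinite (K \<inter> ball c r)" using r by (simp add: islimpt_eq_infinite_ball)
  then have "infinite (K \<inter> ball c r - F)" using F by simp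
  then have "K \<inter> ball c r - F \<noteq> {}" by (metis finite.emptyI)
  then obtain y where y: "y \<in> K \<inter> ball c r - F" by (metis ex_in_conv)
  have "K \<inter> ball c r - F = K \<inter> (ball c r - F)" by blast
  then have "openin (top_of_set K) (K \<inter> ball c r - F)"
    using F by (metis finite_imp_closed open_ball open_Diff openin_open_Int)
  moreover have "y \<in> top_of_set K closure_of end_points (top_of_set K)" using y dense_end_points by simp
  then have "\<forall>T. y \<in> T \<and> openin (top_of_set K) T \<longrightarrow> (\<exists>e. e \<in> end_points (top_of_set K) \<and> e \<in> T)"
    unfolding in_closure_of by (rule conjunct2)
  ultimately have "\<exists>e. e \<in> end_points (top_of_set K) \<and> e \<in> K \<inter> ball c r - F"
    using y by metis
  then show ?thesis by auto
qed

lemma distinct_end_points_near: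
  assumes "finite \<A>" "\<And>A. A \<in> \<A> \<Longrightarrow> c A \<in> K" "r > 0" "finite F"
  shows "\<exists>e. inj_on e \<A> \<and> (\<forall>A\<in>\<A>. e A \<in> end_points (top_of_set K) \<and> dist (c A) (e A) < r \<and> e A \<notin> F)"
  using assms(1,2)
proof (induction \<A>)
  case (insert B \<A>)
  then obtain e where e: "inj_on e \<A>" "\<forall>A\<in>\<A>. e A \<in> end_points (top_of_set K) \<and> dist (c A) (e A) < r \<and> e A \<notin> F"
    by auto
  have fin: "finite (F \<union> e ` \<A>)" using insert assms by simp
  have cB: "c B \<in> K" by (rule insert.prems) simp
  obtain b where b: "b \<in> end_points (top_of_set K)" "dist (c B) b < r" "b \<notin> F \<union> e ` \<A>"
    using end_point_near[OF cB assms(3) fin] by metis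
  have "inj_on (e(B := b)) (insert B \<A>)"
    using e(1) b(3) insert.hyps by (auto simp: inj_on_def)
  moreover have "\<forall>A\<in>insert B \<A>. (e(B := b)) A \<in> end_points (top_of_set K) \<and> dist (c A) ((e(B := b)) A) < r \<and> (e(B := b)) A \<notin> F"
    using e(2) b insert.hyps by auto
  ultimately show ?case by blast
qed simp

text \<open>On each \<open>A\<close> the perturbed map takes a value at an end-point that it takes only near \<open>A\<close>: after making
  the map constant near \<open>A\<close>, one bends it along a path to an end-point, having first pushed everything else
  off small neighbourhoods of the end-points used.\<close>

lemma perturbation:
  fixes X :: "'a topology"
  assumes X: "normal_space X" and f: "continuous_map X (top_of_set K) f" and \<epsilon>: "\<epsilon> > 0"
  shows "\<exists>\<eta>>0. \<forall>\<A> N. finite \<A> \<and> disjoint \<A> \<and> {} \<notin> \<A> \<and>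
      (\<forall>A\<in>\<A>. closedin X A \<and> openin X (N A) \<and> A \<subseteq> N A \<and> (\<forall>x\<in>A. \<forall>y\<in>A. dist (f x) (f y) < \<eta>)) \<longrightarrow>
      (\<exists>g. continuous_map X (top_of_set K) g \<and> (\<forall>x\<in>topspace X. dist (g x) (f x) < \<epsilon>) \<and>
        (\<forall>A\<in>\<A>. \<exists>e. (\<forall>x\<in>A. g x = e) \<and> (\<forall>x\<in>topspace X. g x = e \<longrightarrow> x \<in> N A)))"
proof -
  have e4: "\<epsilon>/4 > 0" using \<epsilon> by simp
  from approximation_constant_on_closed_sets[OF X f e4] obtain \<eta>1 where \<eta>1: "\<eta>1 > 0 \<and> (\<forall>\<A>. finite \<A> \<and> disjoint \<A> \<and> {} \<notin> \<A> \<and>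
      (\<forall>A\<in>\<A>. closedin X A \<and> (\<forall>x\<in>A. \<forall>y\<in>A. dist (f x) (f y) < \<eta>1)) \<longrightarrow>
      (\<exists>g. continuous_map X (top_of_set K) g \<and> (\<forall>x\<in>topspace X. dist (g x) (f x) < \<epsilon>/4) \<and>
        (\<forall>A\<in>\<A>. \<exists>c\<in>K. \<forall>x\<in>A. g x = c)))"
    by (rule exE)
  note \<eta>1 = conjunct1[OF \<eta>1] mp[OF spec[OF conjunct2[OF \<eta>1]]]
  obtain \<delta> where \<delta>: "\<delta> > 0" "\<And>x y. x \<in> K \<Longrightarrow> y \<in> K \<Longrightarrow> dist x y < \<delta> \<Longrightarrow>
      \<exists>g. path g \<and> path_image g \<subseteq> K \<inter> ball x (\<epsilon>/4) \<and> pathstart g = x \<and> pathfinish g = y"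
    by (rule small_paths[OF compact_K locally_connected_K e4]) (rule that)
  have fc: "continuous_map X euclidean f" using f by (simp add: continuous_map_in_subtopology)
  have \<eta>3: "\<eta>1/3 > 0" using \<eta>1 by simp
  show ?thesis
  proof (intro exI[of _ "\<eta>1/3"] conjI \<eta>3 allI impI)
    fix \<A> N
    assume fam: "finite \<A> \<and> disjoint \<A> \<and> {} \<notin> \<A> \<and>
      (\<forall>A\<in>\<A>. closedin X A \<and> openin X (N A) \<and> A \<subseteq> N A \<and> (\<forall>x\<in>A. \<forall>y\<in>A. dist (f x) (f y) < \<eta>1/3))"
    then have \<A>: "finite \<A>" "disjoint \<A>" "{} \<notin> \<A>" by simp_all
    have cA: "closedin X A" if "A \<in> \<A>" for A using fam that by simp
    have N: "openin X (N A) \<and> A \<subseteq> N A" if "A \<in> \<A>" for A using fam that by simp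
    have osc: "dist (f x) (f y) < \<eta>1/3" if "A \<in> \<A>" "x \<in> A" "y \<in> A" for A x y
      using fam that by (metis (no_types, lifting))
    have ne: "A \<noteq> {}" if "A \<in> \<A>" for A using that \<A>(3) by auto
    have AX: "A \<subseteq> topspace X" if "A \<in> \<A>" for A using cA[OF that] closedin_subset by blast
    define p where "p A = (SOME x. x \<in> A)" for A :: "'a set"
    have p: "p A \<in> A" if "A \<in> \<A>" for A unfolding p_def using ne[OF that] by (simp add: some_in_eq)
    \<comment> \<open>Values within a third of \<open>\<eta>1\<close> of \<open>f (p A)\<close> keep
      the oscillation of \<open>f\<close> on the enlarged sets \<open>P A\<close> below
      \<open>\<eta>1\<close>, so the approximation can be made constant on \<open>P A\<close> and
      not only on \<open>A\<close>.\<close>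
    define N' where "N' A = N A \<inter> {x\<in>topspace X. f x \<in> ball (f (p A)) (\<eta>1/3)}" for A
    have N': "openin X (N' A) \<and> A \<subseteq> N' A" if A: "A \<in> \<A>" for A
    proof
      show "openin X (N' A)"
        unfolding N'_def using N[OF A] openin_continuous_map_preimage[OF fc, of "ball (f (p A)) (\<eta>1/3)"]
        by (intro openin_Int) auto
      show "A \<subseteq> N' A" using N[OF A] osc[OF A p[OF A]] AX[OF A] by (auto simp: N'_def)
    qed
    obtain P Q where PQ: "\<And>A. A \<in> \<A> \<Longrightarrow> closedin X (P A) \<and> openin X (Q A) \<and> A \<subseteq> Q A \<and> Q A \<subseteq> P A \<and> P A \<subseteq> N' A"
      and dP: "\<And>A B. A \<in> \<A> \<Longrightarrow> B \<in> \<A> \<Longrightarrow> A \<noteq> B \<Longrightarrow> P A \<inter> P B = {}"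
      by (rule closed_neighbourhoods_of_disjoint_family[OF X \<A>(1,2), of N']) (erule cA | erule N' | rule that)+
    have "\<exists>g. continuous_map X (top_of_set K) g \<and> (\<forall>x\<in>topspace X. dist (g x) (f x) < \<epsilon>/4) \<and>
        (\<forall>A\<in>P ` \<A>. \<exists>c\<in>K. \<forall>x\<in>A. g x = c)"
    proof (rule \<eta>1(2), intro conjI ballI)
      show "finite (P ` \<A>)" using \<A>(1) by simp
      show "disjoint (P ` \<A>)" using dP by (intro disjointI) blast
      show "{} \<notin> P ` \<A>" using PQ ne by fastforce
      show "closedin X B" if "B \<in> P ` \<A>" for B using that PQ by blast
      fix B x y assume B: "B \<in> P ` \<A>" and xy: "x \<in> B" "y \<in> B"
      then obtain A where A: "A \<in> \<A>" "B = P A" by blast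
      then have "x \<in> N' A" "y \<in> N' A" using PQ[OF A(1)] xy by auto
      then have "dist (f (p A)) (f x) < \<eta>1/3" "dist (f (p A)) (f y) < \<eta>1/3" by (auto simp: N'_def)
      then show "dist (f x) (f y) < \<eta>1"
        using dist_triangle3[of "f x" "f y" "f (p A)"] \<eta>1(1) by linarith
    qed
    then obtain g1 where g1: "continuous_map X (top_of_set K) g1" "\<forall>x\<in>topspace X. dist (g1 x) (f x) < \<epsilon>/4"
      and gP: "\<forall>A\<in>\<A>. \<exists>c\<in>K. \<forall>x\<in>P A. g1 x = c" by auto
    from gP obtain c where c: "\<And>A. A \<in> \<A> \<Longrightarrow> c A \<in> K \<and> (\<forall>x\<in>P A. g1 x = c A)" by metis
    have "finite (c ` \<A>)" using \<A>(1) by simp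
    \<comment> \<open>The end-points avoid all constants \<open>c A\<close>: pushing values off the
      end-points can then fix these constants, at which the pieces are glued.\<close>
    then obtain e where e: "inj_on e \<A>"
      "\<And>A. A \<in> \<A> \<Longrightarrow> e A \<in> end_points (top_of_set K) \<and> dist (c A) (e A) < \<delta> \<and> e A \<notin> c ` \<A>"
      using distinct_end_points_near[OF \<A>(1) _ \<delta>(1), of c "c ` \<A>"] c by blast
    have eK: "e A \<in> K" if "A \<in> \<A>" for A using e(2)[OF that] by (simp add: end_points_def)
    have "\<exists>\<gamma>. path \<gamma> \<and> path_image \<gamma> \<subseteq> K \<inter> ball (c A) (\<epsilon>/4) \<and> pathstart \<gamma> = c A \<and> pathfinish \<gamma> = e A"
      if "A \<in> \<A>" for A
      using \<delta>(2)[of "c A" "e A"] c[OF that] e(2)[OF that] eK[OF that] by blast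
    then obtain \<gamma> where \<gamma>: "\<And>A. A \<in> \<A> \<Longrightarrow> path (\<gamma> A) \<and> path_image (\<gamma> A) \<subseteq> K \<inter> ball (c A) (\<epsilon>/4) \<and>
        pathstart (\<gamma> A) = c A \<and> pathfinish (\<gamma> A) = e A"
      by metis
    have "\<exists>\<rho>. continuous_on K \<rho> \<and> \<rho> ` K \<subseteq> K \<and> (\<forall>y\<in>K. \<rho> y \<notin> e ` \<A> \<and> dist (\<rho> y) y < \<epsilon>/4) \<and> (\<forall>u\<in>c ` \<A> \<inter> K. \<rho> u = u)"
      using \<A>(1) e(2) e4 by (intro end_points_collapse) auto
    then obtain \<rho> where \<rho>': "continuous_on K \<rho> \<and> \<rho> ` K \<subseteq> K \<and> (\<forall>y\<in>K. \<rho> y \<notin> e ` \<A> \<and> dist (\<rho> y) y < \<epsilon>/4) \<and> (\<forall>u\<in>c ` \<A> \<inter> K. \<rho> u = u)"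
      by (rule exE)
    have \<rho>: "continuous_on K \<rho>" "\<rho> ` K \<subseteq> K" "\<And>y. y \<in> K \<Longrightarrow> \<rho> y \<notin> e ` \<A> \<and> dist (\<rho> y) y < \<epsilon>/4"
      "\<And>A. A \<in> \<A> \<Longrightarrow> \<rho> (c A) = c A" using \<rho>' c by simp_all
    \<comment> \<open>The path towards \<open>e A\<close> might run through the marks of other sets;
      \<open>\<sigma> A\<close> pushes it off these and leaves both of its ends in place.\<close>
    have "\<exists>\<sigma>. continuous_on K \<sigma> \<and> \<sigma> ` K \<subseteq> K \<and> (\<forall>y\<in>K. \<sigma> y \<notin> e ` (\<A> - {A}) \<and> dist (\<sigma> y) y < \<epsilon>/4) \<and>
        (\<forall>u\<in>insert (e A) (c ` \<A>) \<inter> K. \<sigma> u = u)" if A: "A \<in> \<A>" for A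
    proof (rule end_points_collapse)
      show "e ` (\<A> - {A}) \<inter> insert (e A) (c ` \<A>) = {}"
        using e A by (auto dest: inj_onD)
    qed (use \<A>(1) e(2) e4 in auto)
    then obtain \<sigma> where \<sigma>: "\<And>A. A \<in> \<A> \<Longrightarrow> continuous_on K (\<sigma> A) \<and> \<sigma> A ` K \<subseteq> K \<and>
        (\<forall>y\<in>K. \<sigma> A y \<notin> e ` (\<A> - {A}) \<and> dist (\<sigma> A y) y < \<epsilon>/4) \<and>
        (\<forall>u\<in>insert (e A) (c ` \<A>) \<inter> K. \<sigma> A u = u)" by metis
    have "\<exists>u. continuous_map X (top_of_set {0..1::real}) u \<and> u ` (topspace X - Q A) \<subseteq> {0} \<and> u ` A \<subseteq> {1}"
      if A: "A \<in> \<A>" for A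
    proof -
      have "closedin X (topspace X - Q A)" using PQ[OF A] by blast
      moreover have "disjnt (topspace X - Q A) A" using PQ[OF A] by (auto simp: disjnt_iff)
      ultimately show ?thesis using Urysohn_lemma[OF X _ cA[OF A], of _ 0 1] by (metis zero_le_one)
    qed
    then obtain u where u: "\<And>A. A \<in> \<A> \<Longrightarrow> continuous_map X (top_of_set {0..1::real}) (u A) \<and>
        u A ` (topspace X - Q A) \<subseteq> {0} \<and> u A ` A \<subseteq> {1}" by metis
    have u01: "u A x \<in> {0..1}" if "A \<in> \<A>" "x \<in> topspace X" for A x
      using u[OF that(1)] that(2) unfolding continuous_map_in_subtopology by blast
    define h where "h A x = \<sigma> A (\<gamma> A (u A x))" for A x
    have \<gamma>K: "\<gamma> A (u A x) \<in> K \<and> dist (c A) (\<gamma> A (u A x)) < \<epsilon>/4" if "A \<in> \<A>" "x \<in> topspace X" for A x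
    proof -
      have "\<gamma> A (u A x) \<in> path_image (\<gamma> A)" using u01[OF that] by (auto simp: path_image_def)
      then show ?thesis using \<gamma>[OF that(1)] by auto
    qed
    have hc: "continuous_map X (top_of_set K) (h A)" if A: "A \<in> \<A>" for A
    proof -
      have gA: "continuous_map (top_of_set {0..1}) (top_of_set K) (\<gamma> A)"
        using \<gamma>[OF A] by (auto simp: path_def path_image_def continuous_map_in_subtopology)
      have sA: "continuous_map (top_of_set K) (top_of_set K) (\<sigma> A)"
        using \<sigma>[OF A] by (auto simp: continuous_map_in_subtopology)
      have "continuous_map X (top_of_set K) (\<sigma> A \<circ> (\<gamma> A \<circ> u A))"
        by (rule continuous_map_compose[OF continuous_map_compose[OF conjunct1[OF u[OF A]] gA] sA])
      then show ?thesis by (simp add: h_def[abs_def] o_def)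
    qed
    have h_off: "h A x = c A" if A: "A \<in> \<A>" and x: "x \<in> topspace X" "x \<notin> Q A" for A x
    proof -
      have "u A x = 0" using u[OF A] x by blast
      then show ?thesis using \<gamma>[OF A] \<sigma>[OF A] c[OF A] A by (simp add: h_def pathstart_def)
    qed
    have h_on: "h A x = e A" if A: "A \<in> \<A>" and x: "x \<in> A" for A x
    proof -
      have "u A x = 1" using u[OF A] x by blast
      then show ?thesis using \<gamma>[OF A] \<sigma>[OF A] eK[OF A] by (simp add: h_def pathfinish_def)
    qed
    define k where "k x = \<rho> (g1 x)" for x
    have g1K: "g1 x \<in> K" if "x \<in> topspace X" for x
      using g1(1) that unfolding continuous_map_in_subtopology by blast
    have kc: "continuous_map X (top_of_set K) k"
    proof -
      have "continuous_map (top_of_set K) (top_of_set K) \<rho>"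
        using \<rho> by (auto simp: continuous_map_in_subtopology)
      from continuous_map_compose[OF g1(1) this] show ?thesis by (simp add: k_def[abs_def] o_def)
    qed
    have k_P: "k x = c A" if "A \<in> \<A>" "x \<in> P A" for A x using c[OF that(1)] that(2) \<rho>(4)[OF that(1)] by (simp add: k_def)
    define R where "R = topspace X - (\<Union>A\<in>\<A>. Q A)"
    \<comment> \<open>On the collar between \<open>Q A\<close> and \<open>P A\<close> both
      \<open>h A\<close> and \<open>k\<close> equal \<open>c A\<close>, so the bent pieces and the
      pushed map fit together.\<close>
    define g where "g x = (if \<exists>A\<in>\<A>. x \<in> P A then h (SOME A. A \<in> \<A> \<and> x \<in> P A) x else k x)" for x
    have g_P: "g x = h A x" if "A \<in> \<A>" "x \<in> P A" for A x
    proof -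
      have "(SOME A. A \<in> \<A> \<and> x \<in> P A) = A"
        by (rule some_equality) (use that dP in blast)+
      then show ?thesis using that by (auto simp: g_def)
    qed
    have g_R: "g x = k x" if "x \<in> R" for x
    proof (cases "\<exists>A\<in>\<A>. x \<in> P A")
      case True
      then obtain A where A: "A \<in> \<A>" "x \<in> P A" by blast
      have "h A x = c A" using h_off[OF A(1)] that A(1) by (auto simp: R_def)
      then show ?thesis using g_P[OF A] k_P[OF A] by simp
    qed (simp add: g_def)
    have cases: "x \<in> R \<or> (\<exists>A\<in>\<A>. x \<in> P A)" if "x \<in> topspace X" for x
      using that PQ unfolding R_def by blast
    have "continuous_map X (top_of_set K) g"
    proof (rule pasting_lemma_closed[where I="insert R (P ` \<A>)" and T="\<lambda>S. S" and f="\<lambda>_. g"])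
      have "closedin X R" unfolding R_def using PQ by (intro closedin_diff openin_Union) auto
      then show "closedin X S" if "S \<in> insert R (P ` \<A>)" for S using that PQ by blast
      show "continuous_map (subtopology X S) (top_of_set K) g" if S: "S \<in> insert R (P ` \<A>)" for S
      proof (cases "S = R")
        case True
        show ?thesis
          by (rule continuous_map_eq[OF continuous_map_from_subtopology[OF kc]]) (use g_R True in auto)
      next
        case False
        then obtain A where A: "A \<in> \<A>" "S = P A" using S by blast
        show ?thesis
          by (rule continuous_map_eq[OF continuous_map_from_subtopology[OF hc[OF A(1)]]]) (use g_P[OF A(1)] A in auto)
      qed
      show "\<exists>S. S \<in> insert R (P ` \<A>) \<and> x \<in> S \<and> g x = g x" if "x \<in> topspace X" for x
        using cases[OF that] by blast
    qed (use \<A>(1) in auto)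
    moreover have "dist (g x) (f x) < \<epsilon>" if x: "x \<in> topspace X" for x
      using cases[OF x]
    proof
      assume "x \<in> R"
      then have "dist (g x) (g1 x) < \<epsilon>/4" using g_R \<rho>(3)[OF g1K[OF x]] by (simp add: k_def)
      moreover have "dist (g1 x) (f x) < \<epsilon>/4" using g1(2) x by blast
      ultimately show ?thesis using dist_triangle[of "g x" "f x" "g1 x"] \<epsilon> by linarith
    next
      assume "\<exists>A\<in>\<A>. x \<in> P A"
      then obtain A where A: "A \<in> \<A>" "x \<in> P A" by blast
      have "dist (g x) (\<gamma> A (u A x)) < \<epsilon>/4" using g_P[OF A] \<sigma>[OF A(1)] \<gamma>K[OF A(1) x] by (simp add: h_def)
      moreover have "dist (c A) (\<gamma> A (u A x)) < \<epsilon>/4" using \<gamma>K[OF A(1) x] by simp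
      moreover have "dist (c A) (f x) < \<epsilon>/4" using g1(2) x c[OF A(1)] A(2) by metis
      ultimately show ?thesis
        using dist_triangle[of "g x" "f x" "\<gamma> A (u A x)"] dist_triangle3[of "\<gamma> A (u A x)" "f x" "c A"] \<epsilon> by linarith
    qed
    \<comment> \<open>The value \<open>e A\<close> does not occur on \<open>R\<close> by the choice
      of \<open>\<rho>\<close>, and on \<open>P B\<close> with \<open>B \<noteq> A\<close> it is
      excluded by \<open>\<sigma> B\<close>.\<close>
    moreover have "\<exists>v. (\<forall>x\<in>A. g x = v) \<and> (\<forall>x\<in>topspace X. g x = v \<longrightarrow> x \<in> N A)" if A: "A \<in> \<A>" for A
    proof (intro exI[of _ "e A"] conjI ballI impI)
      fix x assume "x \<in> A"
      then show "g x = e A" using g_P[OF A] h_on[OF A] PQ[OF A] by auto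
    next
      fix x assume x: "x \<in> topspace X" and gx: "g x = e A"
      have "x \<notin> R"
      proof
        assume "x \<in> R"
        then show False using g_R \<rho>(3)[OF g1K[OF x]] gx A by (simp add: k_def)
      qed
      then obtain B where B: "B \<in> \<A>" "x \<in> P B" using cases[OF x] by blast
      have "B = A"
      proof (rule ccontr)
        assume "B \<noteq> A"
        then have "e A \<in> e ` (\<A> - {B})" using A by blast
        moreover have "h B x \<notin> e ` (\<A> - {B})" using \<sigma>[OF B(1)] \<gamma>K[OF B(1) x] by (simp add: h_def)
        ultimately show False using g_P[OF B] gx by simp
      qed
      then show "x \<in> N A" using B PQ[OF A] by (auto simp: N'_def)
    qed
    ultimately show "\<exists>g. continuous_map X (top_of_set K) g \<and> (\<forall>x\<in>topspace X. dist (g x) (f x) < \<epsilon>) \<and>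
        (\<forall>A\<in>\<A>. \<exists>e. (\<forall>x\<in>A. g x = e) \<and> (\<forall>x\<in>topspace X. g x = e \<longrightarrow> x \<in> N A))" by blast
  qed
qed

end

section \<open>Isometric transfer of superdendrites into a Banach space\<close>

lemma end_points_homeomorphic_map:
  assumes h: "homeomorphic_map X Y h"
  shows "h ` end_points X \<subseteq> end_points Y"
proof
  fix q assume "q \<in> h ` end_points X"
  then obtain p where p: "p \<in> end_points X" "q = h p" by blast
  have pX: "p \<in> topspace X" using p by (simp add: end_points_def)
  have "\<exists>U v. openin Y U \<and> h p \<in> U \<and> U \<subseteq> W \<and> Y frontier_of U = {v}" if W: "openin Y W" "h p \<in> W" for W
  proof -
    define W' where "W' = {x\<in>topspace X. h x \<in> W}"
    have "openin X W'" unfolding W'_def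
      using openin_continuous_map_preimage[OF homeomorphic_imp_continuous_map[OF h] W(1)] .
    moreover have "p \<in> W'" using W pX by (simp add: W'_def)
    ultimately obtain U v where U: "openin X U" "p \<in> U" "U \<subseteq> W'" "X frontier_of U = {v}"
      using p(1) unfolding end_points_def by blast
    have UX: "U \<subseteq> topspace X" using U(1) by (rule openin_subset)
    have "openin Y (h ` U)" using homeomorphic_map_openness[OF h UX] U(1) by simp
    moreover have "Y frontier_of (h ` U) = {h v}" using homeomorphic_map_frontier_of[OF h UX] U(4) by simp
    moreover have "h ` U \<subseteq> W" using U(3) by (auto simp: W'_def)
    ultimately show ?thesis using U(2) by blast
  qed
  moreover have "h p \<in> topspace Y" using homeomorphic_imp_surjective_map[OF h] pX by blast
  ultimately show "q \<in> end_points Y" using p(2) unfolding end_points_def by blast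
qed

text \<open>Makes the bounded functions \<open>nat \<Rightarrow>\<^sub>C real\<close> an instance of \<open>complete_space\<close>: the Banach space into
  which compact metric spaces are embedded.\<close>

instantiation nat :: metric_space
begin

definition dist_nat :: "nat \<Rightarrow> nat \<Rightarrow> real" where
  "dist_nat m n = \<bar>real m - real n\<bar>"

definition uniformity_nat :: "(nat \<times> nat) filter" where
  "uniformity_nat = (INF e\<in>{0 <..}. principal {(x, y). dist x y < e})"

instance
proof
  show "uniformity = (INF e\<in>{0 <..}. principal {(x, y :: nat). dist x y < e})"
    by (simp add: uniformity_nat_def)
  fix U :: "nat set"
  have eq: "x = y" if "\<bar>real x - real y\<bar> < 1" for x y
    using that by linarith
  have "\<forall>\<^sub>F (x', y) in uniformity. x' = x \<longrightarrow> y \<in> U" if "x \<in> U" for x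
    unfolding uniformity_nat_def
    by (rule eventually_INF1[of 1]) (use that in \<open>auto simp: eventually_principal dist_nat_def dest: eq\<close>)
  then show "open U \<longleftrightarrow> (\<forall>x\<in>U. \<forall>\<^sub>F (x', y) in uniformity. x' = x \<longrightarrow> y \<in> U)"
    by (simp add: open_discrete)
qed (auto simp: dist_nat_def)

end

text \<open>The Frechet-Kuratowski embedding: \<open>x\<close> is sent to its distances from a dense
  sequence \<open>s\<close>. The triangle inequality bounds the sup distance from above; evaluating
  at some \<open>s n\<close> near \<open>x\<close> bounds it from below.\<close>

lemma compact_metric_isometric_embedding:
  fixes D :: "'b metric"
  assumes comp: "compact_space (mtopology_of D)" and ne: "mspace D \<noteq> {}"
  obtains h :: "'b \<Rightarrow> (nat \<Rightarrow>\<^sub>C real)" where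
    "\<And>x y. x \<in> mspace D \<Longrightarrow> y \<in> mspace D \<Longrightarrow> dist (h x) (h y) = mdist D x y"
proof -
  interpret Metric_space "mspace D" "mdist D" by simp
  have cM: "compactin mtopology (mspace D)"
    using comp by (simp add: compact_space_def mtopology_of_def)
  have "\<forall>n. \<exists>F. finite F \<and> F \<subseteq> mspace D \<and> mspace D \<subseteq> (\<Union>x\<in>F. mball x (1 / Suc n))"
    using compactin_imp_mtotally_bounded[OF cM] unfolding mtotally_bounded_def by simp
  then obtain F where F: "\<And>n. finite (F n) \<and> F n \<subseteq> mspace D \<and> mspace D \<subseteq> (\<Union>x\<in>F n. mball x (1 / Suc n))"
    by metis
  define S where "S = (\<Union>n. F n)"
  have cS: "countable S" unfolding S_def using F by (intro countable_UN) (auto intro: countable_finite)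
  have SM: "S \<subseteq> mspace D" using F by (auto simp: S_def)
  have "S \<noteq> {}"
  proof -
    obtain x where "x \<in> mspace D" using ne by blast
    then have "x \<in> (\<Union>u\<in>F 0. mball u (1 / Suc 0))" using F[of 0] by blast
    then show ?thesis unfolding S_def by blast
  qed
  define s where "s = from_nat_into S"
  have rs: "range s = S" unfolding s_def using cS \<open>S \<noteq> {}\<close> by (rule range_from_nat_into[rotated])
  have sM: "s n \<in> mspace D" for n using rs SM by blast
  have dense: "\<exists>n. mdist D x (s n) < e" if x: "x \<in> mspace D" and e: "e > 0" for x e
  proof -
    obtain m where m: "1 / real (Suc m) < e" using nat_approx_posE[OF e] by blast
    obtain u where u: "u \<in> F m" "x \<in> mball u (1 / Suc m)" using F[of m] x by blast
    then have "u \<in> range s" unfolding rs S_def by blast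
    then obtain n where "u = s n" by blast
    then show ?thesis using u m commute by (intro exI[of _ n]) auto
  qed
  obtain B where B: "\<And>x y. x \<in> mspace D \<Longrightarrow> y \<in> mspace D \<Longrightarrow> mdist D x y \<le> B"
    using compactin_imp_mbounded[OF cM] by (auto simp: mbounded_alt)
  define h where "h x = Bcontfun (\<lambda>n. mdist D x (s n))" for x
  have h: "apply_bcontfun (h x) n = mdist D x (s n)" if "x \<in> mspace D" for x n
  proof -
    have "(\<lambda>n. mdist D x (s n)) \<in> bcontfun"
      unfolding bcontfun_def using B[OF that sM] nonneg
      by (auto simp: bounded_iff intro!: exI[of _ B])
    then show ?thesis unfolding h_def by (simp add: Bcontfun_inverse)
  qed
  show thesis
  proof (rule that[of h])
    fix x y assume xy: "x \<in> mspace D" "y \<in> mspace D"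
    have "dist (h x) (h y) \<le> mdist D x y"
    proof (rule dist_bound)
      fix n show "dist (apply_bcontfun (h x) n) (apply_bcontfun (h y) n) \<le> mdist D x y"
        using h[OF xy(1), of n] h[OF xy(2), of n] triangle[OF xy(1) xy(2) sM[of n]] triangle[OF xy(2) xy(1) sM[of n]] commute[of x y]
        by (simp add: dist_real_def)
    qed
    moreover have "mdist D x y \<le> dist (h x) (h y)"
    proof (rule field_le_epsilon)
      fix e :: real assume "e > 0"
      then obtain n where n: "mdist D x (s n) < e / 2" using dense[OF xy(1), of "e/2"] by auto
      have "mdist D x y \<le> mdist D x (s n) + mdist D y (s n)" using triangle[OF xy(1) sM xy(2), of n] commute[of "s n" y] by simp
      moreover have "mdist D y (s n) - mdist D x (s n) \<le> dist (h x) (h y)"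
        using dist_bounded[of "h x" n "h y"] h[OF xy(1), of n] h[OF xy(2), of n] by (simp add: dist_real_def)
      ultimately show "mdist D x y \<le> dist (h x) (h y) + e" using n by linarith
    qed
    ultimately show "dist (h x) (h y) = mdist D x y" by simp
  qed
qed

lemma locally_connected_if_locally_connected_space:
  assumes "locally_connected_space (top_of_set K)"
  shows "locally connected K"
  unfolding locally_def
proof (intro allI impI)
  fix w x assume "openin (top_of_set K) w \<and> x \<in> w"
  then obtain U V where "openin (top_of_set K) U" "connectedin (top_of_set K) V" "x \<in> U" "U \<subseteq> V" "V \<subseteq> w"
    using assms unfolding locally_connected_space_def neighbourhood_base_of by metis
  then show "\<exists>U V. openin (top_of_set K) U \<and> connected V \<and> x \<in> U \<and> U \<subseteq> V \<and> V \<subseteq> w"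
    by (auto simp: connectedin_subtopology)
qed

lemma homeomorphic_imp_homeomorphic_space:
  assumes "S homeomorphic T"
  shows "top_of_set S homeomorphic_space top_of_set T"
proof -
  obtain f g where "homeomorphism S T f g" using assms by (auto simp: homeomorphic_def)
  then have "homeomorphic_maps (top_of_set S) (top_of_set T) f g"
    by (auto simp: homeomorphism_def homeomorphic_maps_def continuous_map_in_subtopology)
  then show ?thesis by (auto simp: homeomorphic_space_def)
qed

text \<open>The defining properties of a superdendrite are topological and pass through the
  homeomorphism; keeping distances as well lets the estimates of the perturbation be read back
  without change.\<close>

lemma superdendrite_embedding:
  fixes D :: "'b metric"
  assumes D: "superdendrite D"
  obtains h :: "'b \<Rightarrow> (nat \<Rightarrow>\<^sub>C real)" where
    "\<And>x y. x \<in> mspace D \<Longrightarrow> y \<in> mspace D \<Longrightarrow> dist (h x) (h y) = mdist D x y"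
    "homeomorphic_map (mtopology_of D) (top_of_set (h ` mspace D)) h"
    "superdendrite_set (h ` mspace D)"
proof -
  have den: "dendrite D" and ends: "mtopology_of D closure_of end_points (mtopology_of D) = mspace D"
    using D by (auto simp: superdendrite_def)
  obtain p q where pq: "p \<in> mspace D" "q \<in> mspace D" "p \<noteq> q" using den by (auto simp: dendrite_def)
  have comp: "compact_space (mtopology_of D)" using den by (simp add: dendrite_def)
  have "mspace D \<noteq> {}" using pq by blast
  with comp obtain h :: "'b \<Rightarrow> (nat \<Rightarrow>\<^sub>C real)" where
    h: "\<And>x y. x \<in> mspace D \<Longrightarrow> y \<in> mspace D \<Longrightarrow> dist (h x) (h y) = mdist D x y"
    by (rule compact_metric_isometric_embedding) (rule that)
  define K where "K = h ` mspace D"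
  interpret S: Submetric UNIV dist K
    by (simp add: Submetric_def Submetric_axioms_def Met_TC.Metric_space_axioms)
  have "Metric_space12 (mspace D) (mdist D) K dist"
    by (simp add: Metric_space12_def S.sub.Metric_space_axioms)
  then have "homeomorphic_map (Metric_space.mtopology (mspace D) (mdist D)) S.sub.mtopology h"
    by (rule Metric_space12.isometry_imp_homeomorphic_map) (use h K_def in auto)
  then have hom: "homeomorphic_map (mtopology_of D) (top_of_set K) h"
    by (simp add: mtopology_of_def S.mtopology_submetric)
  have hs: "mtopology_of D homeomorphic_space top_of_set K"
    using hom by (rule homeomorphic_map_imp_homeomorphic_space)
  have inj: "h x = h y \<Longrightarrow> x = y" if "x \<in> mspace D" "y \<in> mspace D" for x y
    using h[OF that] that by simp
  have "superdendrite_set K"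
  proof unfold_locales
    have "compact_space (top_of_set K)" using comp homeomorphic_compact_space[OF hs] by simp
    then show "compact K" by (simp add: compact_space_def compactin_subtopology)
    have "connected_space (top_of_set K)" using den homeomorphic_connected_space[OF hs] by (simp add: dendrite_def)
    then show "connected K" by (simp add: connectedin_topspace[of "top_of_set K", simplified] connectedin_def flip: connectedin_iff_connected)
    have "locally_connected_space (top_of_set K)"
      using den homeomorphic_locally_connected_space[OF hs] by (simp add: dendrite_def)
    then show "locally connected K" by (rule locally_connected_if_locally_connected_space)
  next
    fix T assume T: "T \<subseteq> K"
    show "\<not> T homeomorphic sphere (0::complex) 1"
    proof
      assume "T homeomorphic sphere (0::complex) 1"
      then have 1: "top_of_set T homeomorphic_space top_of_set (sphere (0::complex) 1)"
        by (rule homeomorphic_imp_homeomorphic_space)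
      define S' where "S' = {x\<in>mspace D. h x \<in> T}"
      have "h ` S' = T" using T unfolding S'_def K_def by auto
      then have "h ` (topspace (mtopology_of D) \<inter> S') = topspace (top_of_set K) \<inter> T"
        using T by (auto simp: S'_def)
      then have "homeomorphic_map (subtopology (mtopology_of D) S') (subtopology (top_of_set K) T) h"
        by (rule homeomorphic_map_subtopologies[OF hom])
      moreover have "subtopology (top_of_set K) T = top_of_set T"
        using T by (simp add: subtopology_subtopology inf.absorb2)
      ultimately have "subtopology (mtopology_of D) S' homeomorphic_space top_of_set (sphere (0::complex) 1)"
        using 1 homeomorphic_map_imp_homeomorphic_space homeomorphic_space_trans by metis
      moreover have "S' \<subseteq> mspace D" by (auto simp: S'_def)
      ultimately show False using den unfolding dendrite_def by blast
    qed
  next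
    show "\<exists>p\<in>K. \<exists>q\<in>K. p \<noteq> q" using pq inj unfolding K_def by blast
    have sub: "end_points (mtopology_of D) \<subseteq> topspace (mtopology_of D)" by (auto simp: end_points_def)
    have "K = h ` (mtopology_of D closure_of end_points (mtopology_of D))" by (simp add: ends K_def)
    also have "\<dots> = top_of_set K closure_of (h ` end_points (mtopology_of D))"
      using homeomorphic_map_closure_of[OF hom sub] by simp
    also have "\<dots> \<subseteq> top_of_set K closure_of end_points (top_of_set K)"
      by (intro closure_of_mono end_points_homeomorphic_map hom)
    finally show "top_of_set K closure_of end_points (top_of_set K) = K"
      using closure_of_subset_topspace[of "top_of_set K"] by auto
  qed
  then show thesis using that[OF h] hom unfolding K_def by blast
qed

lemma superdendrite_perturbation:
  fixes X :: "'a topology" and D :: "'b metric"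
  assumes D: "superdendrite D" and X: "normal_space X" and f: "continuous_map X (mtopology_of D) f" and \<epsilon>: "\<epsilon> > 0"
  shows "\<exists>\<eta>>0. \<forall>\<A> N. finite \<A> \<and> disjoint \<A> \<and> {} \<notin> \<A> \<and>
      (\<forall>A\<in>\<A>. closedin X A \<and> openin X (N A) \<and> A \<subseteq> N A \<and> (\<forall>x\<in>A. \<forall>y\<in>A. mdist D (f x) (f y) < \<eta>)) \<longrightarrow>
      (\<exists>g. continuous_map X (mtopology_of D) g \<and> (\<forall>x\<in>topspace X. mdist D (g x) (f x) < \<epsilon>) \<and>
        (\<forall>A\<in>\<A>. \<exists>e. (\<forall>x\<in>A. g x = e) \<and> (\<forall>x\<in>topspace X. g x = e \<longrightarrow> x \<in> N A)))"
proof -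
  obtain h :: "'b \<Rightarrow> (nat \<Rightarrow>\<^sub>C real)" where
    h: "\<And>x y. x \<in> mspace D \<Longrightarrow> y \<in> mspace D \<Longrightarrow> dist (h x) (h y) = mdist D x y"
    and hom: "homeomorphic_map (mtopology_of D) (top_of_set (h ` mspace D)) h"
    and K: "superdendrite_set (h ` mspace D)"
    by (rule superdendrite_embedding[OF D]) (rule that)

  obtain \<kappa> where \<kappa>: "homeomorphic_maps (mtopology_of D) (top_of_set (h ` mspace D)) h \<kappa>"
    using hom homeomorphic_map_maps by blast
  have \<kappa>c: "continuous_map (top_of_set (h ` mspace D)) (mtopology_of D) \<kappa>"
    and \<kappa>h: "\<And>x. x \<in> mspace D \<Longrightarrow> \<kappa> (h x) = x"
    using \<kappa> by (auto simp: homeomorphic_maps_def)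
  have fM: "f x \<in> mspace D" if "x \<in> topspace X" for x
    using continuous_map_image_subset_topspace[OF f] that by auto
  have "continuous_map X (top_of_set (h ` mspace D)) (h \<circ> f)"
    using continuous_map_compose[OF f homeomorphic_imp_continuous_map[OF hom]] .
  from superdendrite_set.perturbation[OF K X this \<epsilon>] obtain \<eta> where \<eta>: "\<eta> > 0 \<and> (\<forall>\<A> N. finite \<A> \<and> disjoint \<A> \<and> {} \<notin> \<A> \<and>
      (\<forall>A\<in>\<A>. closedin X A \<and> openin X (N A) \<and> A \<subseteq> N A \<and> (\<forall>x\<in>A. \<forall>y\<in>A. dist ((h \<circ> f) x) ((h \<circ> f) y) < \<eta>)) \<longrightarrow>
      (\<exists>g. continuous_map X (top_of_set (h ` mspace D)) g \<and> (\<forall>x\<in>topspace X. dist (g x) ((h \<circ> f) x) < \<epsilon>) \<and>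
        (\<forall>A\<in>\<A>. \<exists>e. (\<forall>x\<in>A. g x = e) \<and> (\<forall>x\<in>topspace X. g x = e \<longrightarrow> x \<in> N A))))"
    by (rule exE)
  note pert = mp[OF spec[OF spec[OF conjunct2[OF \<eta>]]]]
  show ?thesis
  proof (intro exI[of _ \<eta>] conjI conjunct1[OF \<eta>] allI impI)
    fix \<A> N
    assume fam: "finite \<A> \<and> disjoint \<A> \<and> {} \<notin> \<A> \<and>
      (\<forall>A\<in>\<A>. closedin X A \<and> openin X (N A) \<and> A \<subseteq> N A \<and> (\<forall>x\<in>A. \<forall>y\<in>A. mdist D (f x) (f y) < \<eta>))"
    have AX: "x \<in> topspace X" if "A \<in> \<A>" "x \<in> A" for A x
      using fam that closedin_subset by (metis subsetD)
    have "\<exists>g. continuous_map X (top_of_set (h ` mspace D)) g \<and> (\<forall>x\<in>topspace X. dist (g x) ((h \<circ> f) x) < \<epsilon>) \<and>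
        (\<forall>A\<in>\<A>. \<exists>e. (\<forall>x\<in>A. g x = e) \<and> (\<forall>x\<in>topspace X. g x = e \<longrightarrow> x \<in> N A))"
    proof (rule pert, intro conjI ballI)
      fix A x y assume A: "A \<in> \<A>" and xy: "x \<in> A" "y \<in> A"
      have "dist ((h \<circ> f) x) ((h \<circ> f) y) = mdist D (f x) (f y)"
        using h fM AX[OF A] xy by simp
      also have "\<dots> < \<eta>" using fam A xy by metis
      finally show "dist ((h \<circ> f) x) ((h \<circ> f) y) < \<eta>" .
    qed (use fam in simp_all)
    then obtain g where g: "continuous_map X (top_of_set (h ` mspace D)) g"
      "\<forall>x\<in>topspace X. dist (g x) ((h \<circ> f) x) < \<epsilon>"
      and gA: "\<forall>A\<in>\<A>. \<exists>e. (\<forall>x\<in>A. g x = e) \<and> (\<forall>x\<in>topspace X. g x = e \<longrightarrow> x \<in> N A)"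
      by (elim exE conjE) (rule that)
    have gK: "g x \<in> h ` mspace D" if "x \<in> topspace X" for x
      using continuous_map_image_subset_topspace[OF g(1)] that by auto
    have hk: "h (\<kappa> v) = v \<and> \<kappa> v \<in> mspace D" if "v \<in> h ` mspace D" for v
      using that \<kappa>h by auto
    have "continuous_map X (mtopology_of D) (\<kappa> \<circ> g)" using g(1) \<kappa>c by (rule continuous_map_compose)
    moreover have "mdist D ((\<kappa> \<circ> g) x) (f x) < \<epsilon>" if x: "x \<in> topspace X" for x
    proof -
      have "mdist D (\<kappa> (g x)) (f x) = dist (h (\<kappa> (g x))) (h (f x))"
        by (rule h[symmetric, OF conjunct2[OF hk[OF gK[OF x]]] fM[OF x]])
      also have "\<dots> < \<epsilon>" using g(2) hk[OF gK[OF x]] x by simp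
      finally show ?thesis by simp
    qed
    moreover have "\<exists>e. (\<forall>x\<in>A. (\<kappa> \<circ> g) x = e) \<and> (\<forall>x\<in>topspace X. (\<kappa> \<circ> g) x = e \<longrightarrow> x \<in> N A)" if A: "A \<in> \<A>" for A
    proof -
      obtain e where e: "\<forall>x\<in>A. g x = e" "\<forall>x\<in>topspace X. g x = e \<longrightarrow> x \<in> N A" using gA A by metis
      \<comment> \<open>Non-emptiness puts \<open>e\<close> into the image of \<open>h\<close>,
        where \<open>\<kappa>\<close> is injective; outside the image nothing is known about
        \<open>\<kappa>\<close>.\<close>
      have "A \<noteq> {}" using fam A by metis
      then obtain a where a: "a \<in> A" by (metis ex_in_conv)
      then have eK: "e \<in> h ` mspace D" using e(1) gK AX[OF A] by metis
      have "x \<in> N A" if x: "x \<in> topspace X" "\<kappa> (g x) = \<kappa> e" for x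
      proof -
        have "g x = e" using hk[OF gK[OF x(1)]] hk[OF eK] x(2) by metis
        then show ?thesis using e(2) x(1) by simp
      qed
      then show ?thesis using e(1) by (intro exI[of _ "\<kappa> e"]) simp
    qed
    ultimately show "\<exists>g. continuous_map X (mtopology_of D) g \<and> (\<forall>x\<in>topspace X. mdist D (g x) (f x) < \<epsilon>) \<and>
        (\<forall>A\<in>\<A>. \<exists>e. (\<forall>x\<in>A. g x = e) \<and> (\<forall>x\<in>topspace X. g x = e \<longrightarrow> x \<in> N A))" by blast
  qed
qed

section \<open>Generic maps separate orbits\<close>

context compact_dynamics
begin

text \<open>The members of \<open>\<U>\<close> are open and only finitely many times count, so
  smallness at these times extends from \<open>A\<close> to the intersection of the corresponding
  preimages.\<close>

lemma open_neighbourhood_small_on: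
  assumes \<U>: "finite_open_cover mtopology \<U>" and A: "A \<subseteq> M" and J: "finite J"
  shows "\<exists>N. openin mtopology N \<and> A \<subseteq> N \<and> (\<forall>z\<in>J. small_on act \<U> {z} A \<longrightarrow> small_on act \<U> {z} N)"
proof -
  define J' where "J' = {z\<in>J. small_on act \<U> {z} A}"
  have "\<exists>U\<in>\<U>. \<forall>x\<in>A. act x z \<in> U" if "z \<in> J'" for z using that by (simp add: J'_def small_on_def)
  then obtain U where U: "\<And>z. z \<in> J' \<Longrightarrow> U z \<in> \<U> \<and> (\<forall>x\<in>A. act x z \<in> U z)" by metis
  define N where "N = M - (\<Union>z\<in>J'. M - {x\<in>M. act x z \<in> U z})"
  have op: "openin mtopology {x\<in>M. act x z \<in> U z}" if "z \<in> J'" for z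
    using U[OF that] \<U> by (intro openin_act_preimage) (simp add: finite_open_cover_def)
  have "openin mtopology N"
    unfolding N_def
  proof (rule openin_diff)
    show "openin mtopology M" using openin_topspace[of mtopology] by simp
    show "closedin mtopology (\<Union>z\<in>J'. M - {x\<in>M. act x z \<in> U z})"
    proof (rule closedin_Union)
      show "finite ((\<lambda>z. M - {x\<in>M. act x z \<in> U z}) ` J')" using J by (simp add: J'_def)
      fix T assume "T \<in> (\<lambda>z. M - {x\<in>M. act x z \<in> U z}) ` J'"
      then obtain z where z: "z \<in> J'" "T = M - {x\<in>M. act x z \<in> U z}" by (rule imageE)
      show "closedin mtopology T" unfolding z(2)
        using closedin_diff[OF closedin_topspace op[OF z(1)]] by (simp only: topspace_mtopology)
    qed
  qed
  moreover have "A \<subseteq> N" using A U by (auto simp: N_def)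
  moreover have "small_on act \<U> {z} N" if "z \<in> J" "small_on act \<U> {z} A" for z
  proof -
    have z: "z \<in> J'" using that by (simp add: J'_def)
    then have "\<forall>x\<in>N. act x z \<in> U z" by (auto simp: N_def)
    then show ?thesis using U[OF z] by (auto simp: small_on_def)
  qed
  ultimately show ?thesis by blast
qed

text \<open>Towers rest on aperiodicity and serve infinite spaces; a finite space is discrete, so
  singletons at time 0 do. That there is a coordinate to put them in follows from
  \<open>q < k * L\<close>.\<close>

lemma mdim_less_imp_coloured_towers:
  assumes min: "minimal_system mtopology act" and mdim: "mdim mtopology act < ereal (real k)"
    and \<U>: "finite_open_cover mtopology \<U>"
  obtains \<A> :: "nat \<Rightarrow> 'a set set" and J :: "int set" where "finite J"
    "\<And>i. finite (\<A> i)" "\<And>i. disjoint (\<A> i)" "\<And>i. {} \<notin> \<A> i"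
    "\<And>i A. i < k \<Longrightarrow> A \<in> \<A> i \<Longrightarrow> closedin mtopology A \<and> (\<exists>U\<in>\<U>. A \<subseteq> U)"
    "\<And>x. x \<in> M \<Longrightarrow> \<exists>i<k. \<exists>A\<in>\<A> i. \<exists>z\<in>J. act x z \<in> A \<and> small_on act \<U> {- z} A"
proof -
  have "M \<noteq> {}" using min by (simp add: minimal_system_def)
  then obtain L q where Lq: "L \<ge> 1" "q < k * L" "cover_dim_le mtopology (small_on act \<U> {0..<int L}) q"
    by (rule mdim_less_imp_cover_dim_le[OF mdim _ \<U>]) (rule that)
  show thesis
  proof (cases "finite M")
    case False
    show ?thesis by (rule coloured_towers_infinite[OF min False Lq(2,3)]) (rule that)
  next
    case True
    define \<A> :: "nat \<Rightarrow> 'a set set" where "\<A> i = (\<lambda>x. {x}) ` M" for i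
    have "0 < k * L" using Lq(2) by linarith
    then have k: "0 < k" by auto
    have un: "\<Union>\<U> = M" using \<U> by (simp add: finite_open_cover_def)
    show ?thesis
    proof (rule that[of "{0}" \<A>])
      show "disjoint (\<A> i)" for i by (auto simp: \<A>_def disjoint_def)
      show "closedin mtopology A \<and> (\<exists>U\<in>\<U>. A \<subseteq> U)" if "A \<in> \<A> i" for i A
      proof -
        obtain x where x: "x \<in> M" "A = {x}" using \<open>A \<in> \<A> i\<close> by (auto simp: \<A>_def)
        then have "\<exists>U\<in>\<U>. x \<in> U" using un by blast
        then show ?thesis using x by (auto intro: closedin_Hausdorff_finite Hausdorff_space_mtopology)
      qed
      show "\<exists>i<k. \<exists>A\<in>\<A> i. \<exists>z\<in>{0}. act x z \<in> A \<and> small_on act \<U> {- z} A" if x: "x \<in> M" for x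
      proof -
        have "\<exists>U\<in>\<U>. x \<in> U" using un x by blast
        then have "small_on act \<U> {0} {x}" using x by (simp add: small_on_def)
        then show ?thesis using k x by (intro exI[of _ 0] conjI bexI[of _ "{x}"] bexI[of _ 0]) (auto simp: \<A>_def)
      qed
    qed (use True in \<open>auto simp: \<A>_def\<close>)
  qed
qed

lemma finite_open_cover_subordinate:
  assumes "\<And>x. x \<in> M \<Longrightarrow> openin mtopology (V x) \<and> x \<in> V x"
  obtains \<U> where "finite_open_cover mtopology \<U>" "\<U> \<subseteq> V ` M"
proof -
  have "compactin mtopology M" using compact_space by (simp add: compact_space_def)
  moreover have "M \<subseteq> \<Union>(V ` M)" using assms by blast
  moreover have "openin mtopology U" if "U \<in> V ` M" for U using that assms by blast
  ultimately obtain \<U> where \<U>: "finite \<U>" "\<U> \<subseteq> V ` M" "M \<subseteq> \<Union>\<U>" unfolding compactin_def by meson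
  have op: "openin mtopology U" if "U \<in> \<U>" for U using that \<U>(2) assms by blast
  then have "\<Union>\<U> = M" using \<U>(3) openin_subset by fastforce
  then show thesis using that[of \<U>] \<U> op by (simp add: finite_open_cover_def)
qed

text \<open>The tolerances \<open>\<eta> i\<close> depend only on the given map and on
  \<open>\<epsilon>\<close>, so they are available before the cover is chosen. The cover is then
  taken fine enough for them and for \<open>r\<close>, and the families obtained from it are handled
  coordinate by coordinate.\<close>

lemma separating_approximation:
  fixes D :: "'b metric"
  assumes min: "minimal_system mtopology act" and mdim: "mdim mtopology act < ereal (real k)"
    and D: "superdendrite D" and f: "\<And>i. i < k \<Longrightarrow> continuous_map mtopology (mtopology_of D) (\<lambda>x. f x i)"
    and \<epsilon>: "\<epsilon> > 0" and r: "r > 0"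
  obtains g where "\<And>i. i < k \<Longrightarrow> continuous_map mtopology (mtopology_of D) (g i)"
    "\<And>i x. i < k \<Longrightarrow> x \<in> M \<Longrightarrow> mdist D (g i x) (f x i) < \<epsilon>"
    "\<And>x y. x \<in> M \<Longrightarrow> y \<in> M \<Longrightarrow> r \<le> d x y \<Longrightarrow> \<exists>z. \<exists>i<k. g i (act x z) \<noteq> g i (act y z)"
proof -
  interpret D: Metric_space "mspace D" "mdist D" by simp
  have nrm: "normal_space mtopology" by (simp add: metrizable_imp_normal_space metrizable_space_mtopology)
  have fD: "f x i \<in> mspace D" if "i < k" "x \<in> M" for x i
    using continuous_map_image_subset_topspace[OF f[OF that(1)]] that(2) by auto
  define good where "good i \<eta> \<longleftrightarrow> \<eta> > 0 \<and> (\<forall>\<A> N. finite \<A> \<and> disjoint \<A> \<and> {} \<notin> \<A> \<and>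
      (\<forall>A\<in>\<A>. closedin mtopology A \<and> openin mtopology (N A) \<and> A \<subseteq> N A \<and> (\<forall>x\<in>A. \<forall>y\<in>A. mdist D (f x i) (f y i) < \<eta>)) \<longrightarrow>
      (\<exists>g. continuous_map mtopology (mtopology_of D) g \<and> (\<forall>x\<in>topspace mtopology. mdist D (g x) (f x i) < \<epsilon>) \<and>
        (\<forall>A\<in>\<A>. \<exists>e. (\<forall>x\<in>A. g x = e) \<and> (\<forall>x\<in>topspace mtopology. g x = e \<longrightarrow> x \<in> N A))))" for i \<eta>
  have "\<exists>\<eta>. good i \<eta>" if "i < k" for i
    unfolding good_def by (rule superdendrite_perturbation[OF D nrm f[OF that] \<epsilon>])
  then obtain \<eta> where \<eta>: "\<And>i. i < k \<Longrightarrow> good i (\<eta> i)" by metis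
  have \<eta>0: "\<eta> i > 0" if "i < k" for i using \<eta>[OF that] by (simp add: good_def)
  define V where "V x = mball x (r/2) - (\<Union>i<k. M - {y\<in>M. f y i \<in> D.mball (f x i) (\<eta> i / 2)})" for x
  have V: "openin mtopology (V x) \<and> x \<in> V x" if x: "x \<in> M" for x
  proof
    have "openin mtopology {y\<in>M. f y i \<in> D.mball (f x i) (\<eta> i / 2)}" if "i < k" for i
    proof -
      have "openin (mtopology_of D) (D.mball (f x i) (\<eta> i / 2))" by (simp add: mtopology_of_def)
      from openin_continuous_map_preimage[OF f[OF that] this] show ?thesis by simp
    qed
    then have "closedin mtopology (M - {y\<in>M. f y i \<in> D.mball (f x i) (\<eta> i / 2)})" if "i < k" for i
      using closedin_diff[OF closedin_topspace] that by (metis topspace_mtopology)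
    then show "openin mtopology (V x)"
      unfolding V_def by (intro openin_diff openin_mball closedin_Union) auto
    show "x \<in> V x" using x r \<eta>0 fD by (auto simp: V_def)
  qed
  obtain \<U> where \<U>: "finite_open_cover mtopology \<U>" "\<U> \<subseteq> V ` M"
    by (rule finite_open_cover_subordinate[of V]) (erule V | rule that)+
  have small: "d x y < r" "i < k \<Longrightarrow> mdist D (f x i) (f y i) < \<eta> i" if U: "U \<in> \<U>" and xy: "x \<in> U" "y \<in> U" for U x y i
  proof -
    obtain c where c: "c \<in> M" "U = V c" using U \<U>(2) by blast
    have b: "x \<in> mball c (r/2)" "y \<in> mball c (r/2)" using xy c by (auto simp: V_def)
    then show "d x y < r" using triangle[of x c y] commute[of x c] by auto
    assume i: "i < k"
    have "x \<in> M" "y \<in> M" using b by auto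
    then have "f x i \<in> D.mball (f c i) (\<eta> i / 2)" "f y i \<in> D.mball (f c i) (\<eta> i / 2)"
      using xy c i unfolding V_def by blast+
    then show "mdist D (f x i) (f y i) < \<eta> i" using D.triangle[of "f x i" "f c i" "f y i"] D.commute[of "f x i" "f c i"] by auto
  qed
  obtain \<A> :: "nat \<Rightarrow> 'a set set" and J :: "int set" where J: "finite J"
    and \<A>: "\<And>i. finite (\<A> i)" "\<And>i. disjoint (\<A> i)" "\<And>i. {} \<notin> \<A> i"
    "\<And>i A. i < k \<Longrightarrow> A \<in> \<A> i \<Longrightarrow> closedin mtopology A \<and> (\<exists>U\<in>\<U>. A \<subseteq> U)"
    and cov: "\<And>x. x \<in> M \<Longrightarrow> \<exists>i<k. \<exists>A\<in>\<A> i. \<exists>z\<in>J. act x z \<in> A \<and> small_on act \<U> {- z} A"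
    by (rule mdim_less_imp_coloured_towers[OF min mdim \<U>(1)]) (rule that)
  \<comment> \<open>Equal values at time \<open>z\<close> only place \<open>act y z\<close> in
    \<open>N A\<close>, so the neighbourhood has to inherit the smallness of \<open>A\<close> at all
    times \<open>- z\<close> with \<open>z\<close> in \<open>J\<close>.\<close>
  have "\<exists>N. openin mtopology N \<and> A \<subseteq> N \<and> (\<forall>z\<in>uminus ` J. small_on act \<U> {z} A \<longrightarrow> small_on act \<U> {z} N)" if "A \<subseteq> M" for A
    using J by (intro open_neighbourhood_small_on \<U>(1) that) simp
  then obtain N where N: "\<And>A. A \<subseteq> M \<Longrightarrow> openin mtopology (N A) \<and> A \<subseteq> N A \<and> (\<forall>z\<in>uminus ` J. small_on act \<U> {z} A \<longrightarrow> small_on act \<U> {z} (N A))"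
    by metis
  have AM: "A \<subseteq> M" if "i < k" "A \<in> \<A> i" for i A
    using \<A>(4)[OF that] closedin_subset[of mtopology A] by simp
  have "\<exists>g. continuous_map mtopology (mtopology_of D) g \<and> (\<forall>x\<in>topspace mtopology. mdist D (g x) (f x i) < \<epsilon>) \<and>
        (\<forall>A\<in>\<A> i. \<exists>e. (\<forall>x\<in>A. g x = e) \<and> (\<forall>x\<in>topspace mtopology. g x = e \<longrightarrow> x \<in> N A))" if i: "i < k" for i
  proof (rule mp[OF spec[OF spec[OF conjunct2[OF \<eta>[OF i, unfolded good_def]]]]], intro conjI ballI \<A>(1,2,3))
    fix A assume A: "A \<in> \<A> i"
    show "closedin mtopology A" using \<A>(4)[OF i A] by simp
    show "openin mtopology (N A)" "A \<subseteq> N A" using N[OF AM[OF i A]] by simp_all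
    fix x y assume "x \<in> A" "y \<in> A"
    then show "mdist D (f x i) (f y i) < \<eta> i" using \<A>(4)[OF i A] small(2)[OF _ _ _ i] by blast
  qed
  then obtain g where g: "\<And>i. i < k \<Longrightarrow> continuous_map mtopology (mtopology_of D) (g i) \<and> (\<forall>x\<in>topspace mtopology. mdist D (g i x) (f x i) < \<epsilon>) \<and>
        (\<forall>A\<in>\<A> i. \<exists>e. (\<forall>x\<in>A. g i x = e) \<and> (\<forall>x\<in>topspace mtopology. g i x = e \<longrightarrow> x \<in> N A))" by metis
  show thesis
  proof (rule that[of g])
    show "continuous_map mtopology (mtopology_of D) (g i)" if "i < k" for i using g[OF that] by simp
    show "mdist D (g i x) (f x i) < \<epsilon>" if "i < k" "x \<in> M" for i x using g[OF that(1)] that(2) by simp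
    show "\<exists>z. \<exists>i<k. g i (act x z) \<noteq> g i (act y z)" if xy: "x \<in> M" "y \<in> M" and far: "r \<le> d x y" for x y
    proof (rule ccontr)
      assume "\<not> ?thesis"
      then have eq: "g i (act x z) = g i (act y z)" if "i < k" for i z using that by blast
      obtain i A z where A: "i < k" "A \<in> \<A> i" "z \<in> J" "act x z \<in> A" "small_on act \<U> {- z} A"
        using cov[OF xy(1)] by metis
      obtain e where e: "\<forall>x\<in>A. g i x = e" "\<forall>x\<in>topspace mtopology. g i x = e \<longrightarrow> x \<in> N A"
        using g[OF A(1)] A(2) by metis
      have "g i (act y z) = e" using e(1) A(4) eq[OF A(1)] by metis
      then have y: "act y z \<in> N A" using e(2) xy(2) by simp
      have x: "act x z \<in> N A" using N[OF AM[OF A(1,2)]] A(4) by blast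
      have "small_on act \<U> {- z} (N A)" using N[OF AM[OF A(1,2)]] A(3,5) by blast
      then obtain U where U: "U \<in> \<U>" "\<forall>v\<in>N A. act v (- z) \<in> U" by (auto simp: small_on_def)
      have "x \<in> U" "y \<in> U" using U(2) x y xy by force+
      then show False using small(1)[OF U(1)] far by fastforce
    qed
  qed
qed

text \<open>Pairs at distance at least \<open>r\<close> form a compact set, covered by the
  increasing open sets \<open>W n\<close> on which some time separates by more than
  \<open>1 / real (Suc n)\<close>. The uniform bound is what makes the sets of the Baire argument
  open.\<close>

lemma uniformly_separated:
  fixes P :: "'c metric"
  assumes f: "continuous_map mtopology (mtopology_of P) f"
    and sep: "\<And>x y. x \<in> M \<Longrightarrow> y \<in> M \<Longrightarrow> r \<le> d x y \<Longrightarrow> \<exists>z. f (act x z) \<noteq> f (act y z)"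
  shows "\<exists>e>0. \<forall>x\<in>M. \<forall>y\<in>M. r \<le> d x y \<longrightarrow> (\<exists>z. e < mdist P (f (act x z)) (f (act y z)))"
proof -
  let ?XX = "prod_topology mtopology mtopology"
  have fP: "f x \<in> mspace P" if "x \<in> M" for x
    using continuous_map_image_subset_topspace[OF f] that by auto
  have hc: "continuous_map ?XX euclideanreal (\<lambda>p. mdist P (f (act (fst p) z)) (f (act (snd p) z)))" for z
  proof (rule continuous_map_mdist)
    show "continuous_map ?XX (mtopology_of P) (\<lambda>p. f (act (fst p) z))"
      using continuous_map_compose[OF continuous_map_compose[OF continuous_map_fst continuous_act] f]
      by (simp add: o_def)
    show "continuous_map ?XX (mtopology_of P) (\<lambda>p. f (act (snd p) z))"
      using continuous_map_compose[OF continuous_map_compose[OF continuous_map_snd continuous_act] f]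
      by (simp add: o_def)
  qed
  have dc: "continuous_map ?XX euclideanreal (\<lambda>p. d (fst p) (snd p))"
    using continuous_map_mdist[of ?XX Self fst snd]
    by (simp add: mtopology_of_def continuous_map_fst continuous_map_snd)
  define K where "K = {p \<in> topspace ?XX. d (fst p) (snd p) \<in> {r..}}"
  have "compact_space ?XX" using compact_space by (simp add: compact_space_prod_topology)
  moreover have "closedin ?XX K"
    unfolding K_def by (rule closedin_continuous_map_preimage[OF dc]) simp
  ultimately have cK: "compactin ?XX K" by (rule closedin_compact_space)
  define W where "W n = {p \<in> topspace ?XX. \<exists>z. mdist P (f (act (fst p) z)) (f (act (snd p) z)) \<in> {1 / real (Suc n)<..}}" for n
  have W_mono: "W m \<subseteq> W n" if "m \<le> n" for m n
  proof -
    have "1 / real (Suc n) \<le> 1 / real (Suc m)" using that by (intro divide_left_mono) auto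
    then have "1 / real (Suc n) < t" if "1 / real (Suc m) < t" for t using that by linarith
    then show ?thesis unfolding W_def greaterThan_iff by blast
  qed
  have "openin ?XX (W n)" for n
  proof -
    have "W n = (\<Union>z. {p \<in> topspace ?XX. mdist P (f (act (fst p) z)) (f (act (snd p) z)) \<in> {1 / real (Suc n)<..}})"
      by (auto simp: W_def)
    moreover have op: "openin ?XX {p \<in> topspace ?XX. mdist P (f (act (fst p) z)) (f (act (snd p) z)) \<in> {1 / real (Suc n)<..}}" for z
      by (rule openin_continuous_map_preimage[OF hc]) simp
    have "openin ?XX (\<Union>z. {p \<in> topspace ?XX. mdist P (f (act (fst p) z)) (f (act (snd p) z)) \<in> {1 / real (Suc n)<..}})"
      by (rule openin_Union) (use op in blast)
    ultimately show ?thesis by simp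
  qed
  moreover have "K \<subseteq> \<Union>(range W)"
  proof
    fix p assume p: "p \<in> K"
    then have M: "fst p \<in> M" "snd p \<in> M" "r \<le> d (fst p) (snd p)" by (auto simp: K_def)
    then obtain z where z: "f (act (fst p) z) \<noteq> f (act (snd p) z)" using sep by blast
    then have "0 < mdist P (f (act (fst p) z)) (f (act (snd p) z))" using fP M by (simp add: order.strict_iff_order)
    then obtain n where "1 / real (Suc n) < mdist P (f (act (fst p) z)) (f (act (snd p) z))" by (rule nat_approx_posE)
    then have "p \<in> W n" using p unfolding W_def K_def by auto
    then show "p \<in> \<Union>(range W)" by blast
  qed
  ultimately obtain \<F> where \<F>: "finite \<F>" "\<F> \<subseteq> range W" "K \<subseteq> \<Union>\<F>"
    using cK unfolding compactin_def by (metis (no_types, lifting) imageE)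
  then obtain I where I: "finite I" "\<F> = W ` I" using finite_subset_image by metis
  define n where "n = Max (insert 0 I)"
  have "W i \<subseteq> W n" if "i \<in> I" for i
    unfolding n_def using I(1) that by (intro W_mono Max_ge) auto
  then have KW: "K \<subseteq> W n" using \<F>(3) I(2) by blast
  show ?thesis
  proof (intro exI[of _ "1 / real (Suc n)"] conjI ballI impI)
    fix x y assume "x \<in> M" "y \<in> M" "r \<le> d x y"
    then have "(x, y) \<in> K" by (simp add: K_def)
    then have "(x, y) \<in> W n" using KW by blast
    then show "\<exists>z. 1 / real (Suc n) < mdist P (f (act x z)) (f (act y z))" by (simp add: W_def)
  qed simp
qed

end

section \<open>Baire category in the space of continuous maps\<close>

theorem theorem1p1:
  fixes X :: "'a metric" and act :: "'a \<Rightarrow> int \<Rightarrow> 'a"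
    and D :: "'b metric" and k :: nat
  assumes "compact_space (mtopology_of X)"
    and "minimal_system (mtopology_of X) act"
    and "mdim (mtopology_of X) act < ereal (real k)"
    and "superdendrite D"
  shows "for_almost_every (mtopology_of (cfunspace (mtopology_of X) (power_metric k D)))
           (\<lambda>f. embedding_map (mtopology_of X)
                  (product_topology (\<lambda>_::int. mtopology_of (power_metric k D)) UNIV)
                  (induced_map act f))"
proof -
  let ?X = "mtopology_of X" and ?M = "mspace X" and ?d = "mdist X"
  let ?P = "power_metric k D" and ?C = "cfunspace (mtopology_of X) (power_metric k D)"
  have X: "Metric_space.mtopology ?M ?d = ?X" by (simp add: mtopology_of_def)
  interpret Metric_space ?M ?d by simp
  interpret compact_dynamics ?M ?d act
    by unfold_locales (use assms(1,2) in \<open>simp_all add: X minimal_system_def\<close>)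
  interpret C: Metric_space "mspace ?C" "mdist ?C" by (rule Metric_space_mspace_mdist)
  interpret P: Metric_space "mspace ?P" "mdist ?P" by simp
  note mspace_cfunspace [simp del]
  note assms' = assms(1-3)[folded X]
  have ne: "?M \<noteq> {}" using assms(2) by (simp add: minimal_system_def)
  have \<U>0: "finite_open_cover mtopology {?M}"
    using openin_topspace[of mtopology] by (simp add: finite_open_cover_def)
  obtain L q where "L \<ge> 1" "q < k * L" "cover_dim_le mtopology (small_on act {?M} {0..<int L}) q"
    by (rule mdim_less_imp_cover_dim_le[OF assms'(3) ne \<U>0]) (rule that)
  then have "0 < k * L" by linarith
  \<comment> \<open>The mean dimension bound, applied to the trivial cover, shows that there is a
    coordinate; estimating the maximum metric coordinatewise requires a non-empty index set.\<close>
  then have k: "{..<k} \<noteq> {}" by (auto simp: lessThan_empty_iff)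
  \<comment> \<open>Continuous maps on a compact space are bounded, so membership in
    \<open>?C\<close> carries no separate boundedness condition.\<close>
  have memC: "f \<in> mspace ?C \<longleftrightarrow> (\<forall>x\<in>?M. f x \<in> mspace ?P) \<and> f \<in> extensional ?M \<and> continuous_map ?X (mtopology_of ?P) f" for f
  proof -
    have "compactin ?X (topspace ?X)" using assms(1) by (simp add: compact_space_def)
    from compactin_mspace_cfunspace[OF this, of ?P] show ?thesis by simp
  qed
  define E where "E n = {f\<in>mspace ?C. \<exists>e>0. \<forall>x\<in>?M. \<forall>y\<in>?M. 1 / real (Suc n) \<le> ?d x y \<longrightarrow>
      (\<exists>z. e < mdist ?P (f (act x z)) (f (act y z)))}" for n
  have E_open: "openin C.mtopology (E n)" for n
    unfolding C.openin_mtopology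
  proof (intro conjI allI impI)
    show "E n \<subseteq> mspace ?C" by (auto simp: E_def)
    fix f assume f: "f \<in> E n"
    then obtain e where e: "e > 0" "\<And>x y. x \<in> ?M \<Longrightarrow> y \<in> ?M \<Longrightarrow> 1 / real (Suc n) \<le> ?d x y \<Longrightarrow>
        \<exists>z. e < mdist ?P (f (act x z)) (f (act y z))" and fC: "f \<in> mspace ?C"
      unfolding E_def by auto
    have "C.mball f (e/3) \<subseteq> E n"
    proof
      fix g assume "g \<in> C.mball f (e/3)"
      then have gC: "g \<in> mspace ?C" and fg: "mdist ?C f g \<le> e/3" by auto
      have near: "mdist ?P (f x) (g x) \<le> e/3" if "x \<in> ?M" for x
        using mdist_cfunspace_imp_mdist_le[OF fC gC fg] that by simp
      have "\<exists>z. e/4 < mdist ?P (g (act x z)) (g (act y z))" if xy: "x \<in> ?M" "y \<in> ?M" "1 / real (Suc n) \<le> ?d x y" for x y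
      proof -
        obtain z where z: "e < mdist ?P (f (act x z)) (f (act y z))" using e(2)[OF xy] by blast
        have m: "f (act x z) \<in> mspace ?P" "f (act y z) \<in> mspace ?P" "g (act x z) \<in> mspace ?P" "g (act y z) \<in> mspace ?P"
          using fC gC xy unfolding memC by auto
        have "mdist ?P (f (act x z)) (f (act y z)) \<le> mdist ?P (f (act x z)) (g (act x z)) + mdist ?P (g (act x z)) (f (act y z))"
          using P.triangle m by blast
        also have "mdist ?P (g (act x z)) (f (act y z)) \<le> mdist ?P (g (act x z)) (g (act y z)) + mdist ?P (g (act y z)) (f (act y z))"
          using P.triangle m by blast
        also have "mdist ?P (g (act y z)) (f (act y z)) = mdist ?P (f (act y z)) (g (act y z))" by (rule P.commute)
        \<comment> \<open>Two errors of at most \<open>e / 3\<close> leave more than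
          \<open>e / 3\<close> of the separation.\<close>
        finally have "e/4 < mdist ?P (g (act x z)) (g (act y z))"
          using z near[OF act_in[OF xy(1)], of z] near[OF act_in[OF xy(2)], of z] e(1) by linarith
        then show ?thesis by blast
      qed
      then show "g \<in> E n" unfolding E_def using gC e(1) by (intro CollectI conjI exI[of _ "e/4"]) auto
    qed
    then show "\<exists>r>0. C.mball f r \<subseteq> E n" using e(1) by (intro exI[of _ "e/3"]) simp
  qed
  have E_dense: "C.mtopology closure_of E n = mspace ?C" for n
  proof -
    have "\<exists>g\<in>E n. g \<in> C.mball f r" if fC: "f \<in> mspace ?C" and r: "r > 0" for f r
    proof -
      have fc: "continuous_map mtopology (mtopology_of D) (\<lambda>x. f x i)" if "i < k" for i
        using fC that unfolding memC X mtopology_of_power_metric continuous_map_componentwise by simp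
      have r2: "r/2 > 0" "1 / real (Suc n) > 0" using r by auto
      obtain h where h: "\<And>i. i < k \<Longrightarrow> continuous_map mtopology (mtopology_of D) (h i)"
        "\<And>i x. i < k \<Longrightarrow> x \<in> ?M \<Longrightarrow> mdist D (h i x) (f x i) < r/2"
        "\<And>x y. x \<in> ?M \<Longrightarrow> y \<in> ?M \<Longrightarrow> 1 / real (Suc n) \<le> ?d x y \<Longrightarrow> \<exists>z. \<exists>i<k. h i (act x z) \<noteq> h i (act y z)"
        by (rule separating_approximation[OF assms'(2,3) assms(4) fc r2]) (assumption, rule that)
      have hD: "h i x \<in> mspace D" if "i < k" "x \<in> ?M" for i x
        using continuous_map_image_subset_topspace[OF h(1)[OF that(1)]] that(2) by auto
      define g where "g = (\<lambda>x\<in>?M. \<lambda>i\<in>{..<k}. h i x)"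
      have gP: "g x \<in> mspace ?P" if "x \<in> ?M" for x
        using that hD by (auto simp: g_def mspace_power_metric)
      have gc: "continuous_map ?X (mtopology_of ?P) g"
        unfolding mtopology_of_power_metric continuous_map_componentwise
      proof (intro conjI ballI)
        show "g ` topspace ?X \<subseteq> extensional {..<k}" by (auto simp: g_def)
        show "continuous_map ?X (mtopology_of D) (\<lambda>x. g x i)" if "i \<in> {..<k}" for i
          by (rule continuous_map_eq[of _ _ "h i"]) (use h(1)[of i] that in \<open>auto simp: X g_def\<close>)
      qed
      have gC: "g \<in> mspace ?C" unfolding memC using gP gc by (auto simp: g_def)
      have "mdist ?P (f x) (g x) \<le> r/2" if x: "x \<in> ?M" for x
      proof -
        have "mdist D (f x i) (g x i) \<le> r/2" if "i < k" for i
          using h(2)[OF that x] x that by (simp add: g_def mdist_commute)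
        moreover have "f x \<in> mspace (funspace {..<k} D)" "g x \<in> mspace (funspace {..<k} D)"
          using fC gP[OF x] x unfolding memC by (simp_all only: power_metric_def)
        ultimately show ?thesis unfolding power_metric_def
          by (auto simp only: Urysohn.funspace_mdist_le[OF _ _ k] lessThan_iff)
      qed
      then have "mdist ?C f g \<le> r/2" using r by (intro mdist_cfunspace_le) auto
      then have "g \<in> C.mball f r" using fC gC r by simp
      moreover have "g \<in> E n"
      proof -
        have sep: "\<exists>z. g (act x z) \<noteq> g (act y z)" if "x \<in> ?M" "y \<in> ?M" "1 / real (Suc n) \<le> ?d x y" for x y
        proof -
          from h(3)[OF that] obtain z i where "i < k" "h i (act x z) \<noteq> h i (act y z)" by blast
          then have "g (act x z) i \<noteq> g (act y z) i" using that by (simp add: g_def)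
          then show ?thesis by metis
        qed
        have "\<exists>e>0. \<forall>x\<in>?M. \<forall>y\<in>?M. 1 / real (Suc n) \<le> ?d x y \<longrightarrow> (\<exists>z. e < mdist ?P (g (act x z)) (g (act y z)))"
          by (rule uniformly_separated[OF gc[folded X]]) (rule sep)
        then show ?thesis unfolding E_def using gC by simp
      qed
      ultimately show ?thesis by blast
    qed
    then show ?thesis unfolding C.metric_closure_of by blast
  qed
  have compP: "compact_space P.mtopology"
  proof -
    have "compact_space (mtopology_of D)" using assms(4) by (simp add: superdendrite_def dendrite_def)
    then have "compact_space (mtopology_of ?P)" unfolding mtopology_of_power_metric by (simp add: compact_space_product_topology)
    then show ?thesis by (simp add: mtopology_of_def)
  qed
  have "C.mcomplete"
  proof -
    have "P.mcomplete" using compP by (rule P.compact_space_imp_mcomplete)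
    then have "mcomplete_of (cfunspace ?X P.Self)" by (rule P.mcomplete_cfunspace)
    then show ?thesis by (simp add: mcomplete_of_def P.Self_def)
  qed
  have dense: "C.mtopology closure_of (\<Inter>(range E)) = mspace ?C"
    by (rule C.metric_Baire_category[OF \<open>C.mcomplete\<close>]) (use E_open E_dense in auto)
  have emb: "embedding_map ?X (product_topology (\<lambda>_::int. mtopology_of ?P) UNIV) (induced_map act f)"
    if f: "f \<in> \<Inter>(range E)" for f
  proof -
    have fC: "f \<in> mspace ?C" using f by (auto simp: E_def)
    then have fc: "continuous_map ?X (mtopology_of ?P) f" by (simp add: memC)
    have cont: "continuous_map ?X (product_topology (\<lambda>_::int. mtopology_of ?P) UNIV) (induced_map act f)"
      unfolding continuous_map_componentwise_UNIV induced_map_def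
      using continuous_map_compose[OF continuous_act[unfolded X] fc] by (simp add: o_def)
    moreover have "Hausdorff_space (product_topology (\<lambda>_::int. mtopology_of ?P) UNIV)"
      unfolding Hausdorff_space_product_topology by (simp add: mtopology_of_def P.Hausdorff_space_mtopology)
    ultimately have "closed_map ?X (product_topology (\<lambda>_::int. mtopology_of ?P) UNIV) (induced_map act f)"
      using assms(1) by (intro T1_Spaces.continuous_imp_closed_map)
    moreover have "inj_on (induced_map act f) (topspace ?X)"
    proof (rule inj_onI, rule ccontr)
      fix x y assume xy: "x \<in> topspace ?X" "y \<in> topspace ?X" and eq: "induced_map act f x = induced_map act f y" and "x \<noteq> y"
      then have "0 < ?d x y" by simp
      then obtain n where n: "1 / real (Suc n) < ?d x y" by (rule nat_approx_posE)
      have "f \<in> E n" using f by blast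
      then obtain e where e: "e > 0" "\<forall>x\<in>?M. \<forall>y\<in>?M. 1 / real (Suc n) \<le> ?d x y \<longrightarrow>
          (\<exists>z. e < mdist ?P (f (act x z)) (f (act y z)))" unfolding E_def by blast
      then obtain z where z: "e < mdist ?P (f (act x z)) (f (act y z))" using n xy by force
      have "f (act x z) = f (act y z)" using fun_cong[OF eq, of z] by (simp add: induced_map_def)
      then show False using z e(1) fC xy by (simp add: memC)
    qed
    ultimately show ?thesis using cont by (intro injective_closed_imp_embedding_map)
  qed
  have "gdelta_in C.mtopology (\<Inter>(range E))"
    by (intro gdelta_in_Inter) (auto intro: open_imp_gdelta_in E_open)
  moreover have "mtopology_of ?C = C.mtopology" by (simp add: mtopology_of_def)
  ultimately show ?thesis
    unfolding for_almost_every_def using dense emb by (intro exI[of _ "\<Inter>(range E)"]) (simp add: C.topspace_mtopology)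
qed

end
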